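(* For $v\in[0,2]$ let $$J(v)=\int_0^w\frac{1+v-3t^2}{\sqrt{1-t^2}}\,dt+\int_w^1\frac{(1+v-3t^2)\sqrt{1+v}}{\sqrt{1-t^2}\,\sqrt{1+v-t^2}}\,dt,\qquad w=\sqrt{\frac{1+v}{3}},$$ let $v_0\approx 0.685935$ be the unique zero of $J$ in $[0,2]$, and let $\mathrm{R}=\arctan(v_0^{-1/2})$. Let $F$ be a compact subset of the elliptic plane and suppose that for some $\varrho>0$ the following two conditions are met: (1) the elliptic convex hull of $F$ contains a circle of radius $\varrho$ (in particular, $F$ is full-dimensional); (2) there exists a conic enclosing $F$ whose area is less than the area of a conic with semi-axis lengths $\mathrm{R}$ and $\varrho$. Then the enclosing conic of minimal area of $F$ is unique, i.e. among all conics enclosing $F$ there is exactly one of minimal area.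
   Context: The elliptic plane is the unit sphere $S^2\subset\mathbb{R}^3$ with antipodal points identified; its lines are the images of great circles, and angular distance and area are inherited from $S^2$ (the whole elliptic plane has area $2\pi$). A conic is a set $C=\{x\in S^2 : x^{T}Mx=0\}$ where $M\in\mathbb{R}^{3\times 3}$ is symmetric, invertible and indefinite, scaled so that it has eigenvalues $\nu_1\ge\nu_2>0$ and $\nu_3=-1$. Its interior is $\{x : x^{T}Mx<0\}$. A conic $C$ encloses $F$ if $x^{T}Mx\le 0$ for all $x\in F$. The semi-axis lengths of $C$ are $\alpha=\arctan(\nu_2^{-1/2})$ (major) and $\beta=\arctan(\nu_1^{-1/2})$ (minor). With $a=\tan\alpha$, $b=\tan\beta$, the area of $C$ (the area of its interior in the elliptic plane) is $$2\pi-\int_{-\pi}^{\pi}\sqrt{\frac{a^2\sin^2\varphi+b^2\cos^2\varphi}{a^2b^2+a^2\sin^2\varphi+b^2\cos^2\varphi}}\,d\varphi,$$ which is symmetric in $a$ and $b$; the area in condition (2) is the value of this expression for $a=\tan\mathrm{R}$, $b=\tan\varrho$. A circle of radius $\varrho\in(0,\pi/2)$ is a conic with $\alpha=\beta=\varrho$; in condition (1) it is understood together with its interior. A subset of the elliptic plane is called full-dimensional if it is not contained in a line. A subset of the elliptic plane is called convex if it is the image of $S^2\cap P$ for some convex cone $P\subset\mathbb{R}^3$ such that $P\setminus\{0\}$ lies in an open half-space bounded by a plane through the origin; the elliptic convex hull of $F$ is the intersection of all convex subsets containing $F$. The integral for $J(0)$ is improper with value $-\infty$. *)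

theory Defs
  imports "HOL-Analysis.Analysis"
begin

section \<open>The elliptic plane\<close>

quotient_type elliptic_point =
  "real^3" / partial: "\<lambda>x y. norm x = 1 \<and> (y = x \<or> y = - x)"
  morphisms rep_elliptic elliptic_class
proof (rule part_equivpI)
  show "\<exists>x::real^3. norm x = 1 \<and> (x = x \<or> x = - x)"
    by (rule exI[of _ "axis 1 1"]) (simp add: norm_axis_1)
qed (auto intro!: sympI transpI)

lemma elliptic_class_eq_iff:
  assumes "norm x = 1" "norm y = 1"
  shows "elliptic_class x = elliptic_class y \<longleftrightarrow> y = x \<or> y = - x"
  using Quotient_rel[OF Quotient_elliptic_point, of x y] assms by auto

lemma elliptic_class_surj: "\<exists>x. norm x = 1 \<and> elliptic_class x = p"
proof -
  have "norm (rep_elliptic p) = 1"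
    using Quotient_rep_reflp[OF Quotient_elliptic_point, of p] by simp
  then show ?thesis
    using Quotient_abs_rep[OF Quotient_elliptic_point, of p] by blast
qed

text \<open>The quotient topology of the unit sphere.\<close>

instantiation elliptic_point :: topological_space
begin

definition open_elliptic_point :: "elliptic_point set \<Rightarrow> bool" where
  "open_elliptic_point U \<longleftrightarrow>
     openin (top_of_set (sphere 0 1)) {x \<in> sphere 0 1. elliptic_class x \<in> U}"

instance
proof
  show "open (UNIV :: elliptic_point set)"
    unfolding open_elliptic_point_def by (simp only: UNIV_I simp_thms Collect_mem_eq openin_subtopology_self)
next
  fix S T :: "elliptic_point set"
  assume "open S" "open T"
  moreover have "{x \<in> sphere 0 1. elliptic_class x \<in> S \<inter> T} =
      {x \<in> sphere 0 1. elliptic_class x \<in> S} \<inter> {x \<in> sphere 0 1. elliptic_class x \<in> T}"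
    by blast
  ultimately show "open (S \<inter> T)"
    by (simp only: open_elliptic_point_def openin_Int)
next
  fix K :: "elliptic_point set set"
  assume "\<forall>S\<in>K. open S"
  moreover have "{x \<in> sphere 0 1. elliptic_class x \<in> \<Union>K} =
      (\<Union>S\<in>K. {x \<in> sphere 0 1. elliptic_class x \<in> S})"
    by blast
  ultimately show "open (\<Union>K)"
    by (auto simp only: open_elliptic_point_def intro!: openin_Union)
qed

end

text \<open>
  The spherical area of a subset of the unit sphere is three times the volume of the solid cone
  that joins it to the origin. Every point of the elliptic plane has two representatives on the
  sphere, whence the factor 3/2.
\<close>

definition elliptic_area :: "elliptic_point set \<Rightarrow> real" where
  "elliptic_area A =
     3 / 2 * measure lebesgue
       {r *\<^sub>R x | r x. 0 \<le> r \<and> r \<le> 1 \<and> x \<in> sphere 0 1 \<and> elliptic_class x \<in> A}"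

lemma elliptic_area_UNIV: "elliptic_area UNIV = 2 * pi"
proof -
  have "{r *\<^sub>R x | r x::real^3. 0 \<le> r \<and> r \<le> 1 \<and> x \<in> sphere 0 1 \<and> elliptic_class x \<in> UNIV}
      = cball 0 1" (is "?L = _")
  proof (intro equalityI subsetI)
    fix y :: "real^3" assume y: "y \<in> cball 0 1"
    have n: "norm (axis 1 1 :: real^3) = 1" by (simp add: norm_axis_1)
    show "y \<in> ?L"
    proof (cases "y = 0")
      case True
      then show ?thesis using n by (intro CollectI exI[of _ 0] exI[of _ "axis 1 1"]) simp
    next
      case False
      then show ?thesis using y
        by (intro CollectI exI[of _ "norm y"] exI[of _ "y /\<^sub>R norm y"]) simp
    qed
  qed auto
  then show ?thesis
    by (simp add: elliptic_area_def content_cball unit_ball_vol_3)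
qed

definition elliptic_convex :: "elliptic_point set \<Rightarrow> bool" where
  "elliptic_convex A \<longleftrightarrow>
     (\<exists>P u. convex P \<and> cone P \<and> u \<noteq> 0 \<and> (\<forall>x\<in>P - {0}. 0 < u \<bullet> x) \<and>
            A = elliptic_class ` (sphere 0 1 \<inter> P))"

definition elliptic_convex_hull :: "elliptic_point set \<Rightarrow> elliptic_point set" where
  "elliptic_convex_hull F = \<Inter> {A. elliptic_convex A \<and> F \<subseteq> A}"


section \<open>Conics\<close>

text \<open>Eigenvalues are listed with multiplicity, as the roots of the characteristic polynomial.\<close>

definition eigenvalues3 :: "real^3^3 \<Rightarrow> real \<Rightarrow> real \<Rightarrow> real \<Rightarrow> bool" where
  "eigenvalues3 M \<nu>\<^sub>1 \<nu>\<^sub>2 \<nu>\<^sub>3 \<longleftrightarrow>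
     (\<forall>t. det (mat t - M) = (t - \<nu>\<^sub>1) * (t - \<nu>\<^sub>2) * (t - \<nu>\<^sub>3))"

definition indefinite :: "real^3^3 \<Rightarrow> bool" where
  "indefinite M \<longleftrightarrow> (\<exists>x. x \<bullet> (M *v x) > 0) \<and> (\<exists>x. x \<bullet> (M *v x) < 0)"

definition conic_matrix :: "real^3^3 \<Rightarrow> bool" where
  "conic_matrix M \<longleftrightarrow>
     transpose M = M \<and> invertible M \<and> indefinite M \<and>
     (\<exists>\<nu>\<^sub>1 \<nu>\<^sub>2. \<nu>\<^sub>1 \<ge> \<nu>\<^sub>2 \<and> \<nu>\<^sub>2 > 0 \<and> eigenvalues3 M \<nu>\<^sub>1 \<nu>\<^sub>2 (-1))"

definition conic_curve :: "real^3^3 \<Rightarrow> elliptic_point set" where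
  "conic_curve M = elliptic_class ` {x \<in> sphere 0 1. x \<bullet> (M *v x) = 0}"

definition conic_interior :: "real^3^3 \<Rightarrow> elliptic_point set" where
  "conic_interior M = elliptic_class ` {x \<in> sphere 0 1. x \<bullet> (M *v x) < 0}"

definition encloses :: "real^3^3 \<Rightarrow> elliptic_point set \<Rightarrow> bool" where
  "encloses M F \<longleftrightarrow> (\<forall>x \<in> sphere 0 1. elliptic_class x \<in> F \<longrightarrow> x \<bullet> (M *v x) \<le> 0)"

definition conic_area :: "real^3^3 \<Rightarrow> real" where
  "conic_area M = elliptic_area (conic_interior M)"

definition semi_axes :: "real^3^3 \<Rightarrow> real \<Rightarrow> real \<Rightarrow> bool" where
  "semi_axes M \<alpha> \<beta> \<longleftrightarrow>
     (\<exists>\<nu>\<^sub>1 \<nu>\<^sub>2. \<nu>\<^sub>1 \<ge> \<nu>\<^sub>2 \<and> \<nu>\<^sub>2 > 0 \<and> eigenvalues3 M \<nu>\<^sub>1 \<nu>\<^sub>2 (-1) \<and>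
            \<alpha> = arctan (1 / sqrt \<nu>\<^sub>2) \<and> \<beta> = arctan (1 / sqrt \<nu>\<^sub>1))"

text \<open>A circle of radius \<open>\<rho>\<close>, understood together with its interior.\<close>

definition elliptic_disc :: "real \<Rightarrow> elliptic_point set \<Rightarrow> bool" where
  "elliptic_disc \<rho> D \<longleftrightarrow>
     (\<exists>M. conic_matrix M \<and> semi_axes M \<rho> \<rho> \<and> D = conic_curve M \<union> conic_interior M)"

text \<open>
  The area of a conic whose semi-axes have tangents \<open>a\<close> and \<open>b\<close>. The expression is symmetric in
  \<open>a\<close> and \<open>b\<close>, so it does not matter which of the two is the major one.
\<close>

definition semi_axes_area :: "real \<Rightarrow> real \<Rightarrow> real" where
  "semi_axes_area a b =
     2 * pi - integral {-pi..pi} (\<lambda>\<phi>.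
       sqrt ((a\<^sup>2 * (sin \<phi>)\<^sup>2 + b\<^sup>2 * (cos \<phi>)\<^sup>2) /
             (a\<^sup>2 * b\<^sup>2 + a\<^sup>2 * (sin \<phi>)\<^sup>2 + b\<^sup>2 * (cos \<phi>)\<^sup>2)))"

text \<open>
  The matrix of a conic is determined by the conic because of the normalisation of its
  eigenvalues, so the area of \<open>C\<close> may be expressed through \<open>M\<close>.
\<close>

definition minimal_enclosing_conic :: "elliptic_point set \<Rightarrow> elliptic_point set \<Rightarrow> bool" where
  "minimal_enclosing_conic F C \<longleftrightarrow>
     (\<exists>M. conic_matrix M \<and> C = conic_curve M \<and> encloses M F \<and>
          (\<forall>N. conic_matrix N \<and> encloses N F \<longrightarrow> conic_area M \<le> conic_area N))"


section \<open>The critical semi-axis length\<close>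

text \<open>
  At \<open>v = 0\<close> the second integrand has a non-integrable singularity at \<open>t = 1\<close>, and the improper
  integral is \<open>-\<infinity>\<close>; the value has to be set explicitly because the Henstock-Kurzweil integral returns \<open>0\<close> for
  non-integrable functions.
\<close>

definition J :: "real \<Rightarrow> ereal" where
  "J v = (if v = 0 then -\<infinity> else
     let w = sqrt ((1 + v) / 3) in
       ereal (integral {0..w} (\<lambda>t. (1 + v - 3 * t\<^sup>2) / sqrt (1 - t\<^sup>2)) +
              integral {w..1} (\<lambda>t. (1 + v - 3 * t\<^sup>2) * sqrt (1 + v) /
                                   (sqrt (1 - t\<^sup>2) * sqrt (1 + v - t\<^sup>2)))))"

definition v\<^sub>0 :: real where
  "v\<^sub>0 = (THE v. v \<in> {0..2} \<and> J v = 0)"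

definition critical_axis :: real where
  "critical_axis = arctan (1 / sqrt v\<^sub>0)"

end

theory Submission
  imports Defs
begin

text \<open>
  A conic is determined by its normalised matrix \<open>M\<close>, with eigenvalues \<open>p \<ge> v > 0\<close> and \<open>-1\<close>. Its area
  depends on \<open>v\<close> and \<open>p\<close> only: in polar coordinates around the centre it is the integral of \<open>g q\<close> over
  \<open>- \<pi>/2 \<le> \<phi> \<le> \<pi>/2\<close>, where \<open>q = v cos\<^sup>2 \<phi> + p sin\<^sup>2 \<phi>\<close> and \<open>g q = 2 (1 - sqrt (q / (1 + q)))\<close> is decreasing and
  strictly convex.

  Let \<open>M\<close> and \<open>N\<close> be different matrices of conics of minimal area enclosing \<open>F\<close>. Every matrix
  \<open>M + \<epsilon> (N - M)\<close> with \<open>\<epsilon>\<close> between 0 and 1 encloses \<open>F\<close>, because the condition \<open>x\<^sup>T M x \<le> 0\<close> is linear in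
  the matrix. It therefore suffices that the area has a negative derivative at \<open>\<epsilon> = 0\<close>
  (\<open>smaller_conic_between\<close>). Put \<open>w = - g'\<close> and let \<open>d\<^sub>1\<close>, \<open>d\<^sub>2\<close>, \<open>d\<^sub>3\<close> be the diagonal entries of \<open>N\<close> in an eigenframe
  of \<open>M\<close> for \<open>v\<close>, \<open>p\<close>, \<open>-1\<close>. The off-diagonal entries have no first-order effect, and the derivative is
  \<open>- (d\<^sub>1 W\<^sub>c + d\<^sub>2 W\<^sub>s + d\<^sub>3 W\<^sub>q)\<close>, where \<open>W\<^sub>c\<close>, \<open>W\<^sub>s\<close>, \<open>W\<^sub>q\<close> are the integrals of \<open>w (q \<phi>)\<close> times \<open>cos\<^sup>2\<close>, \<open>sin\<^sup>2\<close>, \<open>q\<close>.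
  If \<open>W\<^sub>s \<le> W\<^sub>c < W\<^sub>q\<close>, a rearrangement argument applies: \<open>N\<close> has eigenvalues \<open>p' \<ge> v' > 0\<close> and \<open>-1\<close>, its
  trace is \<open>d\<^sub>1 + d\<^sub>2 + d\<^sub>3\<close>, and \<open>d\<^sub>2 \<le> p'\<close>, \<open>d\<^sub>3 \<ge> -1\<close>, so that the derivative is at most
  \<open>W\<^sub>q - v' W\<^sub>c - p' W\<^sub>s\<close>. By convexity of \<open>g\<close> this is at most the area of \<open>N\<close> minus the area of \<open>M\<close>, which
  is 0. The estimate is strict unless \<open>d\<^sub>3 = -1\<close>. In that case both conics have the same centre, and strict
  convexity of \<open>g\<close> gives the strict inequality.

  The two hypotheses on the size of \<open>F\<close> serve to secure \<open>W\<^sub>c < W\<^sub>q\<close>, which holds as soon as \<open>v > 1/2\<close>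
  (\<open>weight_integral_cos_less\<close>). The substitution \<open>t = sin \<phi>\<close> shows that \<open>J\<close> is strictly increasing and that
  \<open>J (1/2) < 0\<close>, whence \<open>v\<^sub>0 > 1/2\<close> (\<open>critical_value\<close>). A conic enclosing \<open>F\<close> contains the convex hull of
  \<open>F\<close> and so a disc of radius \<open>\<rho>\<close>; its minor semi-axis is at least \<open>\<rho>\<close>, that is, \<open>p \<le> 1 / tan\<^sup>2 \<rho>\<close>
  (\<open>minor_axis_bound\<close>). Since the area decreases in \<open>v\<close> and in \<open>p\<close>, a conic with \<open>v \<le> v\<^sub>0\<close> is at least as large as
  the conic with semi-axes \<open>R\<close> and \<open>\<rho>\<close>, and the minimal conics have \<open>v > v\<^sub>0\<close>.

  A minimal conic exists because the enclosing conics with \<open>v\<^sub>0 \<le> v \<le> p \<le> 1 / tan\<^sup>2 \<rho>\<close> form a compact family,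
  parametrised by eigenframes and eigenvalues, on which the area is continuous.
\<close>


section \<open>The critical value exceeds 1/2\<close>

text \<open>
  The two integrands that define \<open>J\<close>, without the common factor \<open>1 / sqrt (1 - t\<^sup>2)\<close>, merged into one function:
  the first belongs to \<open>1 + v - 3 t\<^sup>2 \<ge> 0\<close>, that is \<open>t \<le> w\<close>, and the second to \<open>t \<ge> w\<close>.
\<close>

definition J_density :: "real \<Rightarrow> real \<Rightarrow> real" where
  "J_density v t = max (1 + v - 3 * t\<^sup>2) 0 + min (1 + v - 3 * t\<^sup>2) 0 * sqrt ((1 + v) / (1 + v - t\<^sup>2))"

lemma continuous_on_J_density:
  "continuous_on ({0<..} \<times> S) (\<lambda>(v, \<phi>). J_density v (sin \<phi>))"
proof -
  have "1 + v - (sin x)\<^sup>2 \<noteq> 0" if "0 < v" for v x :: real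
    using that by (smt (verit) sin_squared_eq zero_le_power2)
  then show ?thesis
    unfolding J_density_def split_beta by (auto intro!: continuous_intros)
qed

text \<open>
  The substitution \<open>t = sin \<phi>\<close> absorbs the factor \<open>1 / sqrt (1 - t\<^sup>2)\<close>, which is singular at \<open>t = 1\<close>.
\<close>

lemma J_eq_integral_density:
  assumes v: "0 < v" "v \<le> 2"
  shows "J v = ereal (integral {0..pi/2} (\<lambda>\<phi>. J_density v (sin \<phi>)))"
proof -
  define w where "w = sqrt ((1 + v) / 3)"
  have w: "0 \<le> w" "w \<le> 1" "w\<^sup>2 = (1 + v) / 3"
    using v by (auto simp: w_def)
  define f where "f t = J_density v t / sqrt (1 - t\<^sup>2)" for t
  have cont: "continuous_on {0..pi/2} (\<lambda>\<phi>. J_density v (sin \<phi>))"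
    by (rule continuous_on_compose2[OF continuous_on_J_density[of UNIV], where f="Pair v", unfolded prod.case])
      (use v in \<open>auto intro!: continuous_intros\<close>)
  have eq: "\<bar>cos \<phi>\<bar> * f (sin \<phi>) = J_density v (sin \<phi>)" if "\<phi> \<in> {0..pi/2} - {pi/2}" for \<phi>
  proof -
    have "cos \<phi> > 0" using that by (intro cos_gt_zero_pi) auto
    then show ?thesis by (simp add: f_def cos_squared_eq[symmetric])
  qed
  have ai: "(\<lambda>\<phi>. J_density v (sin \<phi>)) absolutely_integrable_on {0..pi/2}"
    using absolutely_integrable_continuous_real[OF cont] .
  \<comment> \<open>At the end point \<open>\<pi>/2\<close> the original integrand has the default value of a division by zero.\<close>
  have neg: "negligible {pi/2}" by simp
  have ai': "(\<lambda>\<phi>. \<bar>cos \<phi>\<bar> * f (sin \<phi>)) absolutely_integrable_on {0..pi/2}"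
    by (rule absolutely_integrable_spike[OF ai neg]) (use eq in auto)
  have int': "integral {0..pi/2} (\<lambda>\<phi>. \<bar>cos \<phi>\<bar> * f (sin \<phi>)) = integral {0..pi/2} (\<lambda>\<phi>. J_density v (sin \<phi>))"
    by (rule integral_spike[OF neg]) (use eq in auto)
  have img: "sin ` {0..pi/2} = {0..1::real}"
  proof (intro equalityI subsetI)
    fix y :: real assume y: "y \<in> {0..1}"
    then show "y \<in> sin ` {0..pi/2}"
      by (intro image_eqI[of _ _ "arcsin y"]) (use arcsin_le_arcsin[of 0 y] arcsin_ubound[of y] in auto)
  qed (auto intro!: sin_ge_zero)
  have inj: "inj_on sin {0..pi/2}"
    by (rule inj_onI) (auto intro!: sin_inj_pi)
  have "f absolutely_integrable_on sin ` {0..pi/2} \<and>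
        integral (sin ` {0..pi/2}) f = integral {0..pi/2} (\<lambda>\<phi>. \<bar>cos \<phi>\<bar> * f (sin \<phi>))"
    by (subst has_absolute_integral_change_of_variables_1'[symmetric, where g' = cos])
      (use ai' inj in \<open>auto intro!: derivative_eq_intros\<close>)
  then have fi: "f integrable_on {0..1}" and
    fint: "integral {0..1} f = integral {0..pi/2} (\<lambda>\<phi>. J_density v (sin \<phi>))"
    unfolding img int' using set_lebesgue_integral_eq_integral(1) by auto
  have "integral {0..w} (\<lambda>t. (1 + v - 3 * t\<^sup>2) / sqrt (1 - t\<^sup>2)) = integral {0..w} f"
  proof (rule integral_cong)
    fix t assume "t \<in> {0..w}"
    then have "t\<^sup>2 \<le> w\<^sup>2" by (intro power_mono) auto
    then show "(1 + v - 3 * t\<^sup>2) / sqrt (1 - t\<^sup>2) = f t"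
      using w by (simp add: f_def J_density_def)
  qed
  moreover have "integral {w..1} (\<lambda>t. (1 + v - 3 * t\<^sup>2) * sqrt (1 + v) /
      (sqrt (1 - t\<^sup>2) * sqrt (1 + v - t\<^sup>2))) = integral {w..1} f"
  proof (rule integral_cong)
    fix t assume t: "t \<in> {w..1}"
    then have "w\<^sup>2 \<le> t\<^sup>2" using w by (intro power_mono) auto
    then have "max (1 + v - 3 * t\<^sup>2) 0 = 0" "min (1 + v - 3 * t\<^sup>2) 0 = 1 + v - 3 * t\<^sup>2"
      using w by auto
    then show "(1 + v - 3 * t\<^sup>2) * sqrt (1 + v) / (sqrt (1 - t\<^sup>2) * sqrt (1 + v - t\<^sup>2)) = f t"
      by (simp add: f_def J_density_def real_sqrt_divide)
  qed
  moreover have "integral {0..w} f + integral {w..1} f = integral {0..1} f"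
    using w fi by (intro Henstock_Kurzweil_Integration.integral_combine) auto
  ultimately show ?thesis
    using v fint by (simp add: J_def w_def[symmetric] Let_def)
qed

text \<open>
  Where \<open>X = 1 + v - 3 t\<^sup>2\<close> is negative, it is multiplied by a factor that is at least 1 and decreases in \<open>v\<close>;
  both effects make the product grow at least as fast as \<open>X\<close> itself.
\<close>

lemma J_density_increase:
  assumes "0 < v" "v \<le> v'" "t\<^sup>2 \<le> 1"
  shows "v' - v \<le> J_density v' t - J_density v t"
proof -
  define X X' where "X = 1 + v - 3 * t\<^sup>2" and "X' = 1 + v' - 3 * t\<^sup>2"
  define k k' where "k = sqrt ((1 + v) / (1 + v - t\<^sup>2))" and "k' = sqrt ((1 + v') / (1 + v' - t\<^sup>2))"
  have d: "0 < 1 + v - t\<^sup>2" "0 < 1 + v' - t\<^sup>2" using assms by linarith+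
  have k1: "1 \<le> k" unfolding k_def using d by (simp add: real_le_rsqrt field_simps)
  have "v * t\<^sup>2 \<le> v' * t\<^sup>2" using assms by (intro mult_right_mono) auto
  then have "(1 + v') / (1 + v' - t\<^sup>2) \<le> (1 + v) / (1 + v - t\<^sup>2)"
    using d assms by (simp add: field_simps)
  then have kk: "k' \<le> k" unfolding k_def k'_def by simp
  have XX: "X' - X = v' - v" by (simp add: X_def X'_def)
  have "max X 0 + min X 0 * k + (X' - X) \<le> max X' 0 + min X' 0 * k'"
  proof -
    have a: "min X' 0 * k \<le> min X' 0 * k'"
      using kk by (intro mult_left_mono_neg) auto
    have "(min X' 0 - min X 0) * 1 \<le> (min X' 0 - min X 0) * k"
      using k1 XX assms by (intro mult_left_mono) auto
    moreover have "max X' 0 + min X' 0 = X'" "max X 0 + min X 0 = X" by auto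
    ultimately show ?thesis using a by (simp add: algebra_simps)
  qed
  then show ?thesis
    unfolding J_density_def X_def[symmetric] X'_def[symmetric] k_def[symmetric] k'_def[symmetric]
    using XX by linarith
qed

text \<open>
  By the previous lemma \<open>J\<close> is strictly increasing on \<open>(0, 2]\<close>, so it has at most one zero. For \<open>v = 1/2\<close> the
  density is at most \<open>3/2 cos (2 \<phi>)\<close>, whose integral vanishes, because a factor greater than 1 is
  applied where the cosine is negative. For \<open>v = 2\<close> the density is nonnegative.
\<close>

lemma critical_value: "1/2 < v\<^sub>0"
proof -
  define K where "K v = integral {0..pi/2} (\<lambda>\<phi>. J_density v (sin \<phi>))" for v
  have JK: "J v = ereal (K v)" if "v \<in> {0<..2}" for v
    using that J_eq_integral_density by (auto simp: K_def)
  have cont1: "continuous_on {0..pi/2} (\<lambda>\<phi>. J_density v (sin \<phi>))" if "0 < v" for v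
    by (rule continuous_on_compose2[OF continuous_on_J_density[of UNIV], where f="Pair v", unfolded prod.case])
      (use that in \<open>auto intro!: continuous_intros\<close>)
  have mono: "K v < K v'" if "0 < v" "v < v'" for v v'
  proof -
    have "integral {0..pi/2} (\<lambda>\<phi>. v' - v) \<le> integral {0..pi/2} (\<lambda>\<phi>. J_density v' (sin \<phi>) - J_density v (sin \<phi>))"
      using that by (intro integral_le integrable_continuous_real continuous_intros cont1 J_density_increase)
        (auto simp: sin_squared_eq)
    also have "\<dots> = K v' - K v" unfolding K_def
      using that by (intro integral_diff integrable_continuous_real cont1) auto
    finally have "pi / 2 * (v' - v) \<le> K v' - K v" by simp
    moreover have "0 < pi / 2 * (v' - v)" using that by simp
    ultimately show ?thesis by linarith
  qed
  have contK: "continuous_on {1/2..2} K"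
  proof -
    have "continuous_on {0<..} (\<lambda>v. integral (cbox 0 (pi/2)) (\<lambda>\<phi>. J_density v (sin \<phi>)))"
      by (rule integral_continuous_on_param) (rule continuous_on_J_density)
    then have "continuous_on {0<..} K" by (simp add: K_def cbox_interval)
    then show ?thesis by (rule continuous_on_subset) auto
  qed
  have K_half: "K (1/2) < 0"
  proof -
    have s: "1 + 1/2 - 3 * (sin \<phi>)\<^sup>2 = 3/2 * cos (2 * \<phi>)" for \<phi> :: real
      by (simp add: cos_double_sin)
    have le: "J_density (1/2) (sin \<phi>) \<le> 3/2 * cos (2 * \<phi>)" for \<phi>
    proof -
      have "(sin \<phi>)\<^sup>2 \<le> 1" by (simp add: sin_squared_eq)
      then have "1 \<le> sqrt ((1 + 1/2) / (1 + 1/2 - (sin \<phi>)\<^sup>2))"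
        by (intro real_le_rsqrt) (auto simp: field_simps)
      then have "min (3/2 * cos (2 * \<phi>)) 0 * sqrt ((1 + 1/2) / (1 + 1/2 - (sin \<phi>)\<^sup>2)) \<le> min (3/2 * cos (2 * \<phi>)) 0 * 1"
        by (intro mult_left_mono_neg) auto
      then show ?thesis unfolding J_density_def s by linarith
    qed
    have "sqrt 3 > 1" by simp
    then have lt: "J_density (1/2) (sin (pi/2)) < 3/2 * cos (2 * (pi/2))"
      by (simp add: J_density_def)
    have "K (1/2) < integral {0..pi/2} (\<lambda>\<phi>. 3/2 * cos (2 * \<phi>))"
    proof (rule ccontr)
      assume *: "\<not> K (1/2) < integral {0..pi/2} (\<lambda>\<phi>. 3/2 * cos (2 * \<phi>))"
      define D where "D \<phi> = 3/2 * cos (2 * \<phi>) - J_density (1/2) (sin \<phi>)" for \<phi>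
      have cD: "continuous_on {0..pi/2} D" unfolding D_def by (intro continuous_intros cont1) auto
      have "integral {0..pi/2} D = integral {0..pi/2} (\<lambda>\<phi>. 3/2 * cos (2 * \<phi>)) - K (1/2)"
        unfolding D_def K_def by (intro integral_diff integrable_continuous_real continuous_intros cont1) auto
      moreover have "integral {0..pi/2} D \<ge> 0"
        using le by (intro integral_nonneg integrable_continuous_real cD) (auto simp: D_def)
      ultimately have "integral {0..pi/2} D = 0" using * by linarith
      moreover have "0 \<le> D \<phi>" for \<phi> using le[of \<phi>] unfolding D_def by linarith
      ultimately have "D (pi/2) = 0"
        using integral_eq_0_iff[OF cD] by auto
      then show False using lt by (simp add: D_def)
    qed
    also have "((\<lambda>\<phi>. 3/2 * cos (2 * \<phi>)) has_integral (3/4 * sin (2 * (pi/2)) - 3/4 * sin (2 * 0))) {0..pi/2}"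
      by (intro fundamental_theorem_of_calculus)
        (auto intro!: derivative_eq_intros simp flip: has_real_derivative_iff_has_vector_derivative)
    then have "integral {0..pi/2} (\<lambda>\<phi>. 3/2 * cos (2 * \<phi>)) = 0"
      by (intro integral_unique) simp
    finally show ?thesis .
  qed
  have K_2: "0 \<le> K 2"
    unfolding K_def
  proof (intro integral_nonneg integrable_continuous_real cont1)
    fix \<phi> :: real
    have "(sin \<phi>)\<^sup>2 \<le> 1" by (simp add: sin_squared_eq)
    then show "0 \<le> J_density 2 (sin \<phi>)" by (simp add: J_density_def)
  qed simp
  obtain v where v: "v \<in> {1/2..2}" "K v = 0"
    using IVT'[OF _ _ _ contK, of 0] K_half K_2 by auto
  have "v\<^sub>0 = v"
    unfolding v\<^sub>0_def
  proof (rule the_equality)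
    show "v \<in> {0..2} \<and> J v = 0" using v JK[of v] by auto
    fix u assume u: "u \<in> {0..2} \<and> J u = 0"
    then have "u \<noteq> 0" by (auto simp: J_def)
    with u have u': "u \<in> {0<..2}" by auto
    then have "K u = 0" using JK[of u] u by auto
    then show "u = v" using mono[of u v] mono[of v u] u' v by force
  qed
  moreover have "v \<noteq> 1/2" using v(2) K_half by force
  ultimately show ?thesis using v(1) by auto
qed


section \<open>Weighted integrals over directions\<close>

text \<open>
  The ray from the centre in a direction in which the form has the value \<open>q\<close> leaves the conic at the angle
  \<open>\<theta>\<close> with \<open>cot \<theta> = sqrt q\<close>. It contributes \<open>1 - cos \<theta>\<close> to the area, and so does the opposite ray, whence
  the factor 2.
\<close>

definition arc_density :: "real \<Rightarrow> real" where
  "arc_density q = 2 * (1 - sqrt (q / (1 + q)))"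

text \<open>
  The rate of decrease of \<open>arc_density\<close>.
\<close>

definition arc_weight :: "real \<Rightarrow> real" where
  "arc_weight q = 1 / (sqrt q * (1 + q) * sqrt (1 + q))"

definition quad2 :: "real \<Rightarrow> real \<Rightarrow> real \<Rightarrow> real" where
  "quad2 v p \<phi> = v * (cos \<phi>)\<^sup>2 + p * (sin \<phi>)\<^sup>2"

lemma quad2_ge: "min v p \<le> quad2 v p \<phi>"
proof -
  have "min v p * ((cos \<phi>)\<^sup>2 + (sin \<phi>)\<^sup>2) \<le> v * (cos \<phi>)\<^sup>2 + p * (sin \<phi>)\<^sup>2"
    unfolding distrib_left by (intro add_mono mult_right_mono) auto
  then show ?thesis by (simp add: quad2_def)
qed

lemma quad2_pos: "0 < v \<Longrightarrow> 0 < p \<Longrightarrow> 0 < quad2 v p \<phi>"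
  using quad2_ge[of v p \<phi>] by (auto simp: min_def split: if_splits)

lemma continuous_on_quad2 [continuous_intros]:
  "continuous_on S (quad2 v p)"
  unfolding quad2_def by (intro continuous_intros)

lemma arc_density_deriv:
  assumes "0 < q"
  shows "(arc_density has_real_derivative - arc_weight q) (at q)"
proof -
  have s: "sqrt (q / (1 + q)) = sqrt q / sqrt (1 + q)" by (rule real_sqrt_divide)
  have "((\<lambda>q. 2 * (1 - sqrt (q / (1 + q)))) has_real_derivative
      - 2 * (((1 * (1 + q) - q * 1) / ((1 + q) * (1 + q))) * (inverse (sqrt (q / (1 + q))) / 2))) (at q)"
    using assms by (auto intro!: derivative_eq_intros simp: divide_less_0_iff)
  also have "- 2 * (((1 * (1 + q) - q * 1) / ((1 + q) * (1 + q))) * (inverse (sqrt (q / (1 + q))) / 2))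
     = - arc_weight q"
  proof -
    have "sqrt (1 + q) * sqrt (1 + q) = 1 + q" using assms by simp
    then have "inverse (sqrt (q / (1 + q))) / (1 + q) = 1 / (sqrt q * sqrt (1 + q))"
      using assms unfolding s by (simp add: divide_simps)
    then have "inverse (sqrt (q / (1 + q))) / (1 + q) / (1 + q) = arc_weight q"
      by (simp add: arc_weight_def ac_simps)
    then show ?thesis by (simp add: ac_simps)
  qed
  finally show ?thesis unfolding arc_density_def[abs_def] .
qed

lemma arc_weight_less: "0 < q \<Longrightarrow> q < r \<Longrightarrow> arc_weight r < arc_weight q"
  unfolding arc_weight_def
  by (intro divide_strict_left_mono mult_strict_mono mult_pos_pos) auto

lemma continuous_on_arc_weight:
  assumes "continuous_on S f" "\<And>x. x \<in> S \<Longrightarrow> 0 < f x"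
  shows "continuous_on S (\<lambda>x. arc_weight (f x))"
proof -
  have "1 + f x \<noteq> 0 \<and> f x \<noteq> 0" if "x \<in> S" for x
    using assms(2)[OF that] by linarith
  then show ?thesis
    unfolding arc_weight_def by (intro continuous_intros assms(1)) auto
qed

lemma continuous_on_arc_density:
  assumes "continuous_on S f" "\<And>x. x \<in> S \<Longrightarrow> 0 < f x"
  shows "continuous_on S (\<lambda>x. arc_density (f x))"
proof -
  have "1 + f x \<noteq> 0" if "x \<in> S" for x
    using assms(2)[OF that] by linarith
  then show ?thesis
    unfolding arc_density_def by (intro continuous_intros assms(1)) auto
qed

text \<open>
  Strict convexity: the graph lies above its tangents, because \<open>arc_weight\<close> is strictly decreasing.
\<close>

lemma arc_density_tangent:
  assumes "0 < q" "0 < r" "q \<noteq> r"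
  shows "arc_density q - arc_weight q * (r - q) < arc_density r"
proof (cases "q < r")
  case True
  obtain z where z: "q < z" "z < r" "arc_density r - arc_density q = (r - q) * - arc_weight z"
    using MVT2[OF True, of arc_density "\<lambda>x. - arc_weight x"] assms arc_density_deriv by auto
  have "(r - q) * arc_weight z < (r - q) * arc_weight q"
    using True z assms by (intro mult_strict_left_mono arc_weight_less) auto
  with z(3) show ?thesis by (simp add: algebra_simps)
next
  case False
  then have lt: "r < q" using assms by auto
  obtain z where z: "r < z" "z < q" "arc_density q - arc_density r = (q - r) * - arc_weight z"
    using MVT2[OF lt, of arc_density "\<lambda>x. - arc_weight x"] assms arc_density_deriv by auto
  have "(q - r) * arc_weight q < (q - r) * arc_weight z"
    using lt z assms by (intro mult_strict_left_mono arc_weight_less) auto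
  with z(3) show ?thesis by (simp add: algebra_simps)
qed

lemma arc_density_antimono:
  assumes "0 < q" "q \<le> r" shows "arc_density r \<le> arc_density q"
proof -
  have "q / (1 + q) \<le> r / (1 + r)" using assms by (simp add: field_simps)
  then show ?thesis by (simp add: arc_density_def)
qed

lemma integral_pos_continuous:
  fixes f :: "real \<Rightarrow> real"
  assumes "continuous_on {a..b} f" "\<And>x. x \<in> {a..b} \<Longrightarrow> 0 \<le> f x" "x \<in> {a..b}" "f x \<noteq> 0" "a < b"
  shows "0 < integral {a..b} f"
proof -
  have "0 \<le> integral {a..b} f"
    by (intro integral_nonneg integrable_continuous_real assms)
  moreover have "integral {a..b} f \<noteq> 0"
    using integral_eq_0_iff[OF assms(1) \<open>a < b\<close> assms(2)] assms(3,4) by blast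
  ultimately show ?thesis by linarith
qed

definition conic_area_fun :: "real \<Rightarrow> real \<Rightarrow> real" where
  "conic_area_fun v p = integral {-pi/2..pi/2} (\<lambda>\<phi>. arc_density (quad2 v p \<phi>))"

lemma conic_area_fun_antimono:
  assumes "0 < v" "v \<le> v'" "0 < p" "p \<le> p'"
  shows "conic_area_fun v' p' \<le> conic_area_fun v p"
  unfolding conic_area_fun_def
proof (intro integral_le integrable_continuous_real continuous_on_arc_density continuous_on_quad2)
  fix \<phi> :: real
  show "arc_density (quad2 v' p' \<phi>) \<le> arc_density (quad2 v p \<phi>)"
    using assms by (intro arc_density_antimono quad2_pos) (auto simp: quad2_def intro!: add_mono mult_right_mono)
qed (use assms in \<open>auto intro!: quad2_pos\<close>)

text \<open>
  The weight decreases in \<open>q\<close>, and \<open>q\<close> is at most its mean value \<open>m\<close> where \<open>cos\<^sup>2 \<phi> \<ge> sin\<^sup>2 \<phi>\<close> and at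
  least \<open>m\<close> elsewhere.
  Replacing the weight by the constant \<open>arc_weight m\<close> therefore lowers the integral of the weight times
  \<open>cos (2 \<phi>)\<close>, and with a constant weight this integral is 0.
\<close>

lemma weight_integral_sin_le_cos:
  assumes "0 < v" "v \<le> p"
  shows "integral {-pi/2..pi/2} (\<lambda>\<phi>. arc_weight (quad2 v p \<phi>) * (sin \<phi>)\<^sup>2)
       \<le> integral {-pi/2..pi/2} (\<lambda>\<phi>. arc_weight (quad2 v p \<phi>) * (cos \<phi>)\<^sup>2)"
proof -
  let ?w = "\<lambda>\<phi>. arc_weight (quad2 v p \<phi>)"
  let ?I = "integral {-pi/2..pi/2}"
  define m where "m = (v + p) / 2"
  have c: "continuous_on {-pi/2..pi/2} ?w"
    using assms by (intro continuous_on_arc_weight continuous_on_quad2 quad2_pos) auto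
  have pos: "0 < quad2 v p \<phi>" for \<phi> using assms by (intro quad2_pos) auto
  have q: "quad2 v p \<phi> = m - (p - v) / 2 * cos (2 * \<phi>)" for \<phi>
  proof -
    show ?thesis unfolding quad2_def m_def cos_double_cos sin_squared_eq by (simp add: field_simps)
  qed
  have "((\<lambda>\<phi>. arc_weight m * cos (2 * \<phi>)) has_integral
      (arc_weight m * sin (2 * (pi/2)) / 2 - arc_weight m * sin (2 * (-pi/2)) / 2)) {-pi/2..pi/2}"
    by (intro fundamental_theorem_of_calculus)
      (auto intro!: derivative_eq_intros simp flip: has_real_derivative_iff_has_vector_derivative)
  then have "?I (\<lambda>\<phi>. arc_weight m * cos (2 * \<phi>)) = 0" by (intro integral_unique) simp
  then have "0 = ?I (\<lambda>\<phi>. arc_weight m * cos (2 * \<phi>))" by simp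
  also have "\<dots> \<le> ?I (\<lambda>\<phi>. ?w \<phi> * cos (2 * \<phi>))"
  proof (intro integral_le integrable_continuous_real continuous_intros c)
    fix \<phi> :: real
    show "arc_weight m * cos (2 * \<phi>) \<le> ?w \<phi> * cos (2 * \<phi>)"
    proof (cases "0 \<le> cos (2 * \<phi>)")
      case True
      then have "quad2 v p \<phi> \<le> m" using mult_nonneg_nonneg[of "(p - v) / 2" "cos (2 * \<phi>)"] assms unfolding q by simp
      then have "arc_weight m \<le> ?w \<phi>" using arc_weight_less[of "quad2 v p \<phi>" m] pos[of \<phi>] by force
      then show ?thesis using True by (intro mult_right_mono)
    next
      case False
      then have "m \<le> quad2 v p \<phi>" using mult_nonneg_nonpos[of "(p - v) / 2" "cos (2 * \<phi>)"] assms unfolding q by simp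
      moreover have "0 < m" using assms by (simp add: m_def)
      ultimately have "?w \<phi> \<le> arc_weight m" using arc_weight_less[of m "quad2 v p \<phi>"] by force
      then show ?thesis using False by (intro mult_right_mono_neg) auto
    qed
  qed
  also have "\<dots> = ?I (\<lambda>\<phi>. ?w \<phi> * (cos \<phi>)\<^sup>2 - ?w \<phi> * (sin \<phi>)\<^sup>2)"
    by (simp only: cos_double right_diff_distrib)
  also have "\<dots> = ?I (\<lambda>\<phi>. ?w \<phi> * (cos \<phi>)\<^sup>2) - ?I (\<lambda>\<phi>. ?w \<phi> * (sin \<phi>)\<^sup>2)"
    by (intro integral_diff integrable_continuous_real continuous_intros c)
  finally show ?thesis by simp
qed

text \<open>
  Write the weight as \<open>r q / q\<^sup>2\<close> with the increasing function \<open>r q = (q / (1 + q))\<^sup>3\<^sup>/\<^sup>2\<close>. Both \<open>q\<close> and \<open>q - cos\<^sup>2 \<phi>\<close>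
  increase with \<open>sin\<^sup>2 \<phi>\<close>, and the latter changes its sign at most once, at a value \<open>q0\<close> of \<open>q\<close>. Replacing \<open>r q\<close> by the
  constant \<open>r q0\<close> thus lowers the integral of \<open>r q (q - cos\<^sup>2 \<phi>) / q\<^sup>2\<close>. With this constant it can be computed:
  \<open>(q - cos\<^sup>2 \<phi>) / q\<^sup>2\<close> equals \<open>(1 - 1 / (2 v)) / q\<close> plus a multiple of the derivative of \<open>cos \<phi> sin \<phi> / q\<close>, which
  vanishes at both ends of the interval. This is where \<open>v > 1/2\<close> is needed.
\<close>

lemma weight_integral_cos_less:
  assumes v: "1/2 < v" "v \<le> p"
  shows "integral {-pi/2..pi/2} (\<lambda>\<phi>. arc_weight (quad2 v p \<phi>) * (cos \<phi>)\<^sup>2)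
       < integral {-pi/2..pi/2} (\<lambda>\<phi>. arc_weight (quad2 v p \<phi>) * quad2 v p \<phi>)"
proof -
  let ?q = "quad2 v p"
  let ?I = "integral {-pi/2..pi/2}"
  define r where "r q = sqrt q * q / (sqrt (1 + q) * (1 + q))" for q :: real
  have pos: "0 < ?q \<phi>" for \<phi> using v by (intro quad2_pos) auto
  then have nz: "?q \<phi> \<noteq> 0" for \<phi> by (metis less_irrefl)
  have cw: "continuous_on {-pi/2..pi/2} (\<lambda>\<phi>. arc_weight (?q \<phi>))"
    using pos by (intro continuous_on_arc_weight continuous_on_quad2) auto
  have r: "arc_weight q = r q / q\<^sup>2" if "0 < q" for q
  proof -
    have "sqrt q * sqrt q = q" using that by simp
    then have "sqrt q * q / q\<^sup>2 = 1 / sqrt q"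
      using that by (simp add: field_simps power2_eq_square)
    then have "(sqrt q * q / q\<^sup>2) / (sqrt (1 + q) * (1 + q)) = (1 / sqrt q) / (sqrt (1 + q) * (1 + q))" by simp
    then show ?thesis unfolding r_def arc_weight_def divide_divide_eq_left by (simp only: ac_simps)
  qed
  have r_mono: "r q \<le> r q'" if "0 < q" "q \<le> q'" for q q'
  proof -
    have m: "q / (1 + q) \<le> q' / (1 + q')" using that by (simp add: field_simps)
    have "r x = sqrt (x / (1 + x)) * (x / (1 + x))" for x by (simp add: r_def real_sqrt_divide)
    then show ?thesis using m that by (simp only:) (intro mult_mono, auto)
  qed
  \<comment> \<open>\<open>m\<close> is the value of \<open>sin\<^sup>2 \<phi>\<close> at which \<open>q - cos\<^sup>2 \<phi>\<close> changes its sign, and \<open>q0\<close> the value of \<open>q\<close> there;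
    for \<open>v \<ge> 1\<close> there is no change of sign and \<open>q0\<close> is the minimum of \<open>q\<close>.\<close>
  define m where "m = max 0 ((1 - v) / (1 + p - v))"
  define q0 where "q0 = v + (p - v) * m"
  have q0: "v \<le> q0" using v by (simp add: q0_def m_def)
  have q_s: "?q \<phi> = v + (p - v) * (sin \<phi>)\<^sup>2" for \<phi>
    unfolding quad2_def cos_squared_eq by (simp add: algebra_simps)
  have qc: "?q \<phi> - (cos \<phi>)\<^sup>2 = (1 + p - v) * (sin \<phi>)\<^sup>2 - (1 - v)" for \<phi>
    unfolding quad2_def cos_squared_eq by (simp add: algebra_simps)
  have single_crossing: "r q0 * ((?q \<phi> - (cos \<phi>)\<^sup>2) / (?q \<phi>)\<^sup>2) \<le> arc_weight (?q \<phi>) * (?q \<phi> - (cos \<phi>)\<^sup>2)" for \<phi>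
  proof -
    have "r q0 * (?q \<phi> - (cos \<phi>)\<^sup>2) \<le> r (?q \<phi>) * (?q \<phi> - (cos \<phi>)\<^sup>2)"
    proof (cases "m \<le> (sin \<phi>)\<^sup>2")
      case True
      then have "(1 - v) / (1 + p - v) \<le> (sin \<phi>)\<^sup>2" by (simp add: m_def)
      then have "0 \<le> ?q \<phi> - (cos \<phi>)\<^sup>2" using v unfolding qc by (simp add: field_simps)
      moreover have "q0 \<le> ?q \<phi>" unfolding q0_def q_s using True v by (intro add_left_mono mult_left_mono) auto
      ultimately show ?thesis using q0 v by (intro mult_right_mono r_mono) auto
    next
      case False
      then have "(sin \<phi>)\<^sup>2 < (1 - v) / (1 + p - v)" unfolding m_def
        by (smt (verit) zero_le_power2)
      then have "?q \<phi> - (cos \<phi>)\<^sup>2 \<le> 0" using v unfolding qc by (simp add: field_simps)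
      moreover have "?q \<phi> \<le> q0" unfolding q0_def q_s using False v by (intro add_left_mono mult_left_mono) auto
      ultimately show ?thesis using pos by (intro mult_right_mono_neg r_mono) auto
    qed
    then have "r q0 * (?q \<phi> - (cos \<phi>)\<^sup>2) / (?q \<phi>)\<^sup>2 \<le> r (?q \<phi>) * (?q \<phi> - (cos \<phi>)\<^sup>2) / (?q \<phi>)\<^sup>2"
      by (intro divide_right_mono) auto
    then show ?thesis using pos[of \<phi>] by (simp add: r)
  qed
  have ci: "continuous_on {-pi/2..pi/2} (\<lambda>\<phi>. 1 / ?q \<phi>)"
    using nz by (intro continuous_intros) auto
  have "((\<lambda>\<phi>. (v * (cos \<phi>)\<^sup>2 - p * (sin \<phi>)\<^sup>2) * - 1 / (?q \<phi>)\<^sup>2) has_integral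
     - (cos (pi/2) * sin (pi/2) / ?q (pi/2)) - - (cos (-pi/2) * sin (-pi/2) / ?q (-pi/2))) {-pi/2..pi/2}"
  proof (rule fundamental_theorem_of_calculus)
    fix \<phi> :: real
    have d: "(?q has_real_derivative 2 * (p - v) * (sin \<phi> * cos \<phi>)) (at \<phi>)"
      unfolding quad2_def[abs_def]
      by (auto intro!: derivative_eq_intros simp: algebra_simps)
    have sq: "(sin \<phi>)\<^sup>2 = 1 - (cos \<phi>)\<^sup>2" by (rule sin_squared_eq)
    have num: "(cos \<phi> * cos \<phi> - sin \<phi> * sin \<phi>) * ?q \<phi> - cos \<phi> * sin \<phi> * (2 * (p - v) * (sin \<phi> * cos \<phi>))
        = v * (cos \<phi>)\<^sup>2 - p * (sin \<phi>)\<^sup>2"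
    proof -
      have "(cos \<phi> * cos \<phi> - sin \<phi> * sin \<phi>) * ?q \<phi> - cos \<phi> * sin \<phi> * (2 * (p - v) * (sin \<phi> * cos \<phi>))
        = (v * (cos \<phi>)\<^sup>2 - p * (sin \<phi>)\<^sup>2) * ((sin \<phi>)\<^sup>2 + (cos \<phi>)\<^sup>2)"
        unfolding quad2_def by algebra
      then show ?thesis by simp
    qed
    have "((\<lambda>\<phi>. - (cos \<phi> * sin \<phi> / ?q \<phi>)) has_real_derivative
       - (((cos \<phi> * cos \<phi> - sin \<phi> * sin \<phi>) * ?q \<phi> - cos \<phi> * sin \<phi> * (2 * (p - v) * (sin \<phi> * cos \<phi>)))
         / (?q \<phi> * ?q \<phi>))) (at \<phi>)"
      using nz[of \<phi>] by (auto intro!: derivative_eq_intros d simp: algebra_simps)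
    then show "((\<lambda>\<phi>. - (cos \<phi> * sin \<phi> / ?q \<phi>)) has_vector_derivative (v * (cos \<phi>)\<^sup>2 - p * (sin \<phi>)\<^sup>2) * - 1 / (?q \<phi>)\<^sup>2)
       (at \<phi> within {-pi/2..pi/2})"
      unfolding num has_real_derivative_iff_has_vector_derivative[symmetric]
      by (simp only: power2_eq_square mult_minus1_right minus_divide_left has_field_derivative_at_within)
  qed simp
  then have zero: "?I (\<lambda>\<phi>. (v * (cos \<phi>)\<^sup>2 - p * (sin \<phi>)\<^sup>2) * - 1 / (?q \<phi>)\<^sup>2) = 0"
    by (simp add: integral_unique)
  have split: "(?q \<phi> - (cos \<phi>)\<^sup>2) / (?q \<phi>)\<^sup>2 = (1 - 1 / (2 * v)) * (1 / ?q \<phi>)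
      + 1 / (2 * v) * ((v * (cos \<phi>)\<^sup>2 - p * (sin \<phi>)\<^sup>2) * - 1 / (?q \<phi>)\<^sup>2)" for \<phi>
  proof -
    have "?q \<phi> - (cos \<phi>)\<^sup>2 = (1 - 1 / (2 * v)) * ?q \<phi> + 1 / (2 * v) * ((v * (cos \<phi>)\<^sup>2 - p * (sin \<phi>)\<^sup>2) * - 1)"
      using v unfolding quad2_def by (simp add: field_simps)
    then have "(?q \<phi> - (cos \<phi>)\<^sup>2) / (?q \<phi>)\<^sup>2 = ((1 - 1 / (2 * v)) * ?q \<phi>) / (?q \<phi>)\<^sup>2
      + (1 / (2 * v) * ((v * (cos \<phi>)\<^sup>2 - p * (sin \<phi>)\<^sup>2) * - 1)) / (?q \<phi>)\<^sup>2"
      by (simp add: add_divide_distrib)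
    then show ?thesis using nz[of \<phi>] by (simp add: power2_eq_square)
  qed
  have cs: "continuous_on {-pi/2..pi/2} (\<lambda>\<phi>. (v * (cos \<phi>)\<^sup>2 - p * (sin \<phi>)\<^sup>2) * - 1 / (?q \<phi>)\<^sup>2)"
    using nz by (intro continuous_intros) auto
  have "0 < r q0 * ((1 - 1 / (2 * v)) * ?I (\<lambda>\<phi>. 1 / ?q \<phi>))"
  proof (intro mult_pos_pos)
    show "0 < r q0" using q0 v by (simp add: r_def)
    show "0 < 1 - 1 / (2 * v)" using v by (simp add: field_simps)
    show "0 < ?I (\<lambda>\<phi>. 1 / ?q \<phi>)"
      using pos nz by (intro integral_pos_continuous[where x=0] ci) (auto intro: less_imp_le)
  qed
  also have "\<dots> = ?I (\<lambda>\<phi>. r q0 * ((?q \<phi> - (cos \<phi>)\<^sup>2) / (?q \<phi>)\<^sup>2))"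
  proof -
    have "?I (\<lambda>\<phi>. (1 - 1 / (2 * v)) * (1 / ?q \<phi>) + 1 / (2 * v) * ((v * (cos \<phi>)\<^sup>2 - p * (sin \<phi>)\<^sup>2) * - 1 / (?q \<phi>)\<^sup>2))
       = (1 - 1 / (2 * v)) * ?I (\<lambda>\<phi>. 1 / ?q \<phi>) + 1 / (2 * v) * 0"
      unfolding zero[symmetric] integral_mult_right[symmetric]
      by (intro integral_add integrable_continuous_real continuous_on_mult_left ci cs)
    then show ?thesis unfolding integral_mult_right split by simp
  qed
  also have "\<dots> \<le> ?I (\<lambda>\<phi>. arc_weight (?q \<phi>) * (?q \<phi> - (cos \<phi>)\<^sup>2))"
    using single_crossing nz
    by (intro integral_le integrable_continuous_real continuous_intros cw) auto
  also have "\<dots> = ?I (\<lambda>\<phi>. arc_weight (?q \<phi>) * ?q \<phi> - arc_weight (?q \<phi>) * (cos \<phi>)\<^sup>2)"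
    by (simp add: algebra_simps)
  also have "\<dots> = ?I (\<lambda>\<phi>. arc_weight (?q \<phi>) * ?q \<phi>) - ?I (\<lambda>\<phi>. arc_weight (?q \<phi>) * (cos \<phi>)\<^sup>2)"
    by (intro integral_diff integrable_continuous_real continuous_intros cw)
  finally show ?thesis by simp
qed


section \<open>Volumes of quadratic cones in the unit ball\<close>

lemma nn_integral_vec3:
  fixes f :: "real^3 \<Rightarrow> ennreal"
  assumes [measurable]: "f \<in> borel_measurable borel"
  shows "(\<integral>\<^sup>+y. f y \<partial>lborel) = (\<integral>\<^sup>+x. \<integral>\<^sup>+y. \<integral>\<^sup>+z. f (vector [x, y, z]) \<partial>lborel \<partial>lborel \<partial>lborel)"
proof -
  define \<iota> :: "real \<times> real \<times> real \<Rightarrow> real^3" where "\<iota> = (\<lambda>(x, y, z). vector [x, y, z])"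
  have \<iota>_eq: "\<iota> p = fst p *\<^sub>R axis 1 1 + fst (snd p) *\<^sub>R axis 2 1 + snd (snd p) *\<^sub>R axis 3 1" for p
    by (simp add: \<iota>_def vec_eq_iff forall_3 axis_def split_beta)
  have "continuous_on UNIV \<iota>"
    unfolding \<iota>_eq[abs_def] by (intro continuous_intros)
  then have \<iota>_m [measurable]: "\<iota> \<in> borel_measurable borel"
    by (rule borel_measurable_continuous_onI)
  have L: "(lborel :: (real^3) measure) = distr lborel borel \<iota>"
  proof (rule lborel_eqI)
    fix l u :: "real^3"
    assume lu: "\<And>b. b \<in> Basis \<Longrightarrow> l \<bullet> b \<le> u \<bullet> b"
    have le: "l $ i \<le> u $ i" for i
    proof -
      have "(axis i 1 :: real^3) \<in> Basis" by (auto simp: Basis_vec_def)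
      from lu[OF this] show ?thesis by (simp add: inner_axis)
    qed
    have pre: "\<iota> -` box l u \<inter> space lborel = {l$1<..<u$1} \<times> {l$2<..<u$2} \<times> {l$3<..<u$3}"
      by (auto simp: \<iota>_def mem_box_cart forall_3)
    have "emeasure (distr lborel borel \<iota>) (box l u) = emeasure lborel ({l$1<..<u$1} \<times> {l$2<..<u$2} \<times> {l$3<..<u$3})"
      unfolding pre[symmetric] by (intro emeasure_distr) auto
    also have "\<dots> = emeasure lborel {l$1<..<u$1} * emeasure lborel ({l$2<..<u$2} \<times> {l$3<..<u$3})"
      using lborel.emeasure_pair_measure_Times[of "{l$1<..<u$1}" lborel "{l$2<..<u$2} \<times> {l$3<..<u$3}"]
      unfolding lborel_prod by (simp add: borel_prod[symmetric] del: borel_prod)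
    also have "emeasure lborel ({l$2<..<u$2} \<times> {l$3<..<u$3}) = emeasure lborel {l$2<..<u$2} * emeasure lborel {l$3<..<u$3}"
      using lborel.emeasure_pair_measure_Times[of "{l$2<..<u$2}" lborel "{l$3<..<u$3}"]
      unfolding lborel_prod by simp
    also have "emeasure lborel {l$1<..<u$1} * (emeasure lborel {l$2<..<u$2} * emeasure lborel {l$3<..<u$3})
        = ennreal (u$1 - l$1) * (ennreal (u$2 - l$2) * ennreal (u$3 - l$3))"
      by (simp only: emeasure_lborel_Ioo le)
    also have "\<dots> = ennreal (\<Prod>i\<in>UNIV. u $ i - l $ i)"
    proof -
      have "(\<Prod>i\<in>UNIV. u $ i - l $ i) = (u$1 - l$1) * ((u$2 - l$2) * (u$3 - l$3))"
        unfolding UNIV_3 by simp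
      then show ?thesis using le by (simp only: ennreal_mult'[symmetric] diff_ge_0_iff_ge mult_nonneg_nonneg)
    qed
    also have "(\<Prod>i\<in>UNIV. u $ i - l $ i) = (\<Prod>b\<in>Basis. (u - l) \<bullet> b)"
      unfolding Basis_vec_def
      by (subst prod.UNION_disjoint) (auto simp: axis_eq_axis inner_axis)
    finally show "emeasure (distr lborel borel \<iota>) (box l u) = (\<Prod>b\<in>Basis. (u - l) \<bullet> b)" .
  qed simp
  have "(\<integral>\<^sup>+y. f y \<partial>lborel) = (\<integral>\<^sup>+p. f (\<iota> p) \<partial>(lborel \<Otimes>\<^sub>M lborel))"
    by (subst L, subst nn_integral_distr) (auto simp: lborel_prod)
  also have "\<dots> = (\<integral>\<^sup>+x. \<integral>\<^sup>+q. f (\<iota> (x, q)) \<partial>(lborel \<Otimes>\<^sub>M lborel) \<partial>lborel)"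
    by (subst lborel_prod, rule lborel.nn_integral_fst[symmetric]) (simp add: lborel_prod)
  also have "\<dots> = (\<integral>\<^sup>+x. \<integral>\<^sup>+y. \<integral>\<^sup>+z. f (\<iota> (x, y, z)) \<partial>lborel \<partial>lborel \<partial>lborel)"
    by (intro nn_integral_cong lborel.nn_integral_fst[symmetric]) (simp add: lborel_prod)
  finally show ?thesis by (simp add: \<iota>_def)
qed

text \<open>
  The radial integral over the chord through the origin in the direction \<open>(1, t, s)\<close>, where
  \<open>K = 1 + t\<^sup>2 + s\<^sup>2\<close>.
\<close>

lemma nn_integral_square_cball:
  fixes K :: real
  assumes "0 < K"
  shows "(\<integral>\<^sup>+x. ennreal (x\<^sup>2) * indicator {x. x\<^sup>2 * K \<le> 1} x \<partial>lborel) = ennreal (2/3 / (K * sqrt K))"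
proof -
  define R where "R = 1 / sqrt K"
  have R: "0 < R" "R\<^sup>2 = 1 / K" using assms by (auto simp: R_def power_divide)
  have "{x. x\<^sup>2 * K \<le> 1} = {-R..R}"
  proof -
    have "x\<^sup>2 * K \<le> 1 \<longleftrightarrow> x\<^sup>2 \<le> R\<^sup>2" for x using assms unfolding R(2) by (simp add: pos_le_divide_eq)
    moreover have "x\<^sup>2 \<le> R\<^sup>2 \<longleftrightarrow> \<bar>x\<bar> \<le> R" for x using R(1) abs_le_square_iff[of x R] by simp
    ultimately have "x\<^sup>2 * K \<le> 1 \<longleftrightarrow> x \<in> {-R..R}" for x
      by (simp only: abs_le_iff atLeastAtMost_iff) linarith
    then show ?thesis by blast
  qed
  moreover have "(\<integral>\<^sup>+x. ennreal (x\<^sup>2) * indicator {-R..R} x \<partial>lborel) = ennreal (R^3 / 3 - (-R)^3 / 3)"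
    using R by (intro nn_integral_FTC_Icc) (auto intro!: derivative_eq_intros)
  moreover have "R^3 / 3 - (-R)^3 / 3 = 2/3 / (K * sqrt K)"
    using assms by (simp add: R_def power3_eq_cube field_simps)
  ultimately show ?thesis by (simp only:)
qed

text \<open>
  If \<open>\<sigma> = cot \<theta>\<close> then \<open>tail \<sigma> = 1 - cos \<theta>\<close>, the area per unit of angle of a circular sector of radius \<open>\<theta>\<close>.
\<close>

definition tail :: "real \<Rightarrow> real" where
  "tail \<sigma> = 1 - \<sigma> / sqrt (1 + \<sigma>\<^sup>2)"

lemma tail_nonneg: "0 \<le> tail \<sigma>"
proof -
  have "\<sigma> \<le> sqrt (1 + \<sigma>\<^sup>2)" by (rule real_le_rsqrt) simp
  then show ?thesis by (simp add: tail_def divide_le_eq_1 add_pos_nonneg)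
qed

text \<open>
  In the gnomonic chart \<open>y\<^sub>1 = 1\<close> the area element is \<open>(1 + t\<^sup>2 + s\<^sup>2)\<^sup>-\<^sup>3\<^sup>/\<^sup>2\<close>; here \<open>K = 1 + t\<^sup>2\<close>. The antiderivative in
  \<open>s\<close> is \<open>s / (K sqrt (K + s\<^sup>2))\<close>.
\<close>

lemma nn_integral_chart_tail:
  fixes K z :: real
  assumes "0 < K"
  shows "(\<integral>\<^sup>+s. ennreal (1 / ((K + s\<^sup>2) * sqrt (K + s\<^sup>2))) * indicator {z..} s \<partial>lborel)
       = ennreal (tail (z / sqrt K) / K)"
proof -
  have pos: "0 < K + s\<^sup>2" for s using assms by (simp add: add_pos_nonneg)
  have "(\<integral>\<^sup>+s. ennreal (1 / ((K + s\<^sup>2) * sqrt (K + s\<^sup>2))) * indicator {z..} s \<partial>lborel)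
     = ennreal (1 / K - z / (K * sqrt (K + z\<^sup>2)))"
  proof (rule nn_integral_FTC_atLeast)
    fix s :: real
    have "sqrt (K + s\<^sup>2) * sqrt (K + s\<^sup>2) = K + s\<^sup>2" using pos[of s] by simp
    then have e: "(1 * (K * sqrt (K + s\<^sup>2)) - s * (K * (2 * s * (inverse (sqrt (K + s\<^sup>2)) / 2)))) / ((K * sqrt (K + s\<^sup>2)) * (K * sqrt (K + s\<^sup>2)))
        = 1 / ((K + s\<^sup>2) * sqrt (K + s\<^sup>2))"
      using assms pos[of s] by (simp add: divide_simps) (simp add: algebra_simps power2_eq_square)
    have "((\<lambda>s. s / (K * sqrt (K + s\<^sup>2))) has_real_derivative
        (1 * (K * sqrt (K + s\<^sup>2)) - s * (K * (2 * s * (inverse (sqrt (K + s\<^sup>2)) / 2)))) / ((K * sqrt (K + s\<^sup>2)) * (K * sqrt (K + s\<^sup>2)))) (at s)"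
      using pos[of s] assms by (auto intro!: derivative_eq_intros simp: power2_eq_square)
    then show "((\<lambda>s. s / (K * sqrt (K + s\<^sup>2))) has_real_derivative 1 / ((K + s\<^sup>2) * sqrt (K + s\<^sup>2))) (at s)"
      unfolding e .
    show "0 \<le> 1 / ((K + s\<^sup>2) * sqrt (K + s\<^sup>2))" using pos[of s] by simp
  next
    have "((\<lambda>s. 1 / (K * sqrt (K * (inverse s)\<^sup>2 + 1))) \<longlongrightarrow> 1 / (K * sqrt (K * 0\<^sup>2 + 1))) at_top"
      using assms by (intro tendsto_intros tendsto_inverse_0_at_top filterlim_ident) auto
    moreover have "\<forall>\<^sub>F s in at_top. 1 / (K * sqrt (K * (inverse s)\<^sup>2 + 1)) = s / (K * sqrt (K + s\<^sup>2))"
      using eventually_gt_at_top[of 0]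
    proof eventually_elim
      case (elim s)
      have "K * (inverse s)\<^sup>2 + 1 = (K + s\<^sup>2) / s\<^sup>2" using elim by (simp add: field_simps)
      then have "sqrt (K * (inverse s)\<^sup>2 + 1) = sqrt (K + s\<^sup>2) / s" using elim by (simp add: real_sqrt_divide)
      then show ?case using elim by simp
    qed
    ultimately show "((\<lambda>s. s / (K * sqrt (K + s\<^sup>2))) \<longlongrightarrow> 1 / K) at_top"
      by (simp add: tendsto_cong)
  qed simp
  also have "1 / K - z / (K * sqrt (K + z\<^sup>2)) = tail (z / sqrt K) / K"
  proof -
    have "sqrt K * sqrt (1 + (z / sqrt K)\<^sup>2) = sqrt (K + z\<^sup>2)"
      using assms by (simp add: power_divide real_sqrt_mult[symmetric] algebra_simps)
    then have "z / sqrt K / sqrt (1 + (z / sqrt K)\<^sup>2) = z / sqrt (K + z\<^sup>2)"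
      by (simp only: divide_divide_eq_left)
    then show ?thesis unfolding tail_def by (simp only: diff_divide_distrib divide_divide_eq_left mult.commute[of K])
  qed
  finally show ?thesis .
qed

text \<open>
  The positive root of \<open>m s\<^sup>2 - 2 h s - Q\<close>. The negative root is \<open>- cot_root m (- h) Q\<close>.
\<close>

definition cot_root :: "real \<Rightarrow> real \<Rightarrow> real \<Rightarrow> real" where
  "cot_root m h Q = (h + sqrt (h\<^sup>2 + m * Q)) / m"

lemma quadratic_negative_iff:
  assumes "0 < m" "0 < Q"
  shows "Q + 2 * h * s - m * s\<^sup>2 < 0 \<longleftrightarrow> cot_root m h Q < s \<or> cot_root m (- h) Q < - s"
proof -
  define d where "d = sqrt (h\<^sup>2 + m * Q)"
  have d: "0 \<le> d" "d\<^sup>2 = h\<^sup>2 + m * Q"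
    using assms by (auto simp: d_def)
  have "Q + 2 * h * s - m * s\<^sup>2 < 0 \<longleftrightarrow> 0 < (m * s - h)\<^sup>2 - d\<^sup>2"
  proof -
    have "(m * s - h)\<^sup>2 - d\<^sup>2 = - m * (Q + 2 * h * s - m * s\<^sup>2)"
      unfolding d by (simp add: power2_eq_square algebra_simps)
    then show ?thesis using assms by (simp add: mult_less_0_iff zero_less_mult_iff)
  qed
  also have "\<dots> \<longleftrightarrow> d < \<bar>m * s - h\<bar>"
    using abs_le_square_iff[of "m * s - h" d] d(1) by auto
  also have "\<dots> \<longleftrightarrow> cot_root m h Q < s \<or> cot_root m (- h) Q < - s"
  proof -
    have eqs: "cot_root m h Q = (h + d) / m" "cot_root m (- h) Q = (- h + d) / m"
      by (simp_all add: cot_root_def d_def)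
    show ?thesis unfolding eqs using assms(1) by (auto simp: field_simps abs_if)
  qed
  finally show ?thesis .
qed

text \<open>
  The contribution of a direction \<open>u\<close> and its opposite to the area of a conic whose form takes the value
  \<open>Q + 2 h s - m s\<^sup>2\<close> on the vector \<open>(u, s)\<close>. The origin of the polar coordinates corresponds to \<open>s = \<infinity>\<close>.
\<close>

definition sector_density :: "real \<Rightarrow> real \<Rightarrow> real \<Rightarrow> real" where
  "sector_density m h Q = tail (cot_root m h Q) + tail (cot_root m (- h) Q)"

text \<open>
  The substitution \<open>s = \<sigma> sqrt K\<close> normalises the direction \<open>(1, t)\<close> to a unit vector, which divides \<open>h\<close> by
  \<open>sqrt K\<close> and \<open>Q\<close> by \<open>K\<close>.
\<close>

lemma nn_integral_chart_fibre:
  assumes "0 < K" "0 < m" "0 < Q"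
  shows "(\<integral>\<^sup>+s. ennreal (1 / ((K + s\<^sup>2) * sqrt (K + s\<^sup>2))) * indicator {s. Q + 2 * h * s - m * s\<^sup>2 < 0} s \<partial>lborel)
     = ennreal (sector_density m (h / sqrt K) (Q / K) / K)" (is "?L = _")
proof -
  let ?f = "\<lambda>s. ennreal (1 / ((K + s\<^sup>2) * sqrt (K + s\<^sup>2)))"
  define z where "z = cot_root m h Q"
  define z' where "z' = cot_root m (- h) Q"
  have "\<bar>h\<bar> < sqrt (h\<^sup>2 + m * Q)" using assms by (intro real_less_rsqrt) auto
  then have zz: "0 < z" "0 < z'" using assms by (auto simp: z_def z'_def cot_root_def)
  have scale: "cot_root m (h / sqrt K) (Q / K) = cot_root m h Q / sqrt K" for h
  proof -
    have "(h / sqrt K)\<^sup>2 + m * (Q / K) = (h\<^sup>2 + m * Q) / K"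
      using assms by (simp add: power_divide add_divide_distrib)
    then have "cot_root m (h / sqrt K) (Q / K) = (h / sqrt K + sqrt (h\<^sup>2 + m * Q) / sqrt K) / m"
      by (simp only: cot_root_def real_sqrt_divide)
    then show ?thesis unfolding cot_root_def by (simp add: add_divide_distrib ac_simps)
  qed
  have "AE s in lborel. s \<noteq> z \<and> s \<noteq> - z'"
    using AE_lborel_singleton[of z] AE_lborel_singleton[of "- z'"] by eventually_elim auto
  then have "?L = (\<integral>\<^sup>+s. ?f s * indicator {z..} s + ?f s * indicator {z'..} (- s) \<partial>lborel)"
  proof (intro nn_integral_cong_AE, eventually_elim)
    case (elim s)
    then show ?case
      using zz quadratic_negative_iff[OF assms(2,3), of h s] unfolding z_def[symmetric] z'_def[symmetric]
      by (auto simp: indicator_def)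
  qed
  also have "\<dots> = (\<integral>\<^sup>+s. ?f s * indicator {z..} s \<partial>lborel) + (\<integral>\<^sup>+s. ?f s * indicator {z'..} (- s) \<partial>lborel)"
    by (intro nn_integral_add) measurable
  also have "(\<integral>\<^sup>+s. ?f s * indicator {z'..} (- s) \<partial>lborel) = (\<integral>\<^sup>+s. ?f s * indicator {z'..} s \<partial>lborel)"
    by (subst nn_integral_real_affine[of _ "-1" 0]) auto
  finally have "?L = ennreal (tail (z / sqrt K) / K) + ennreal (tail (z' / sqrt K) / K)"
    using assms by (simp only: nn_integral_chart_tail)
  also have "\<dots> = ennreal (sector_density m (h / sqrt K) (Q / K) / K)"
    using assms scale[of h] scale[of "- h"] tail_nonneg
    by (simp add: sector_density_def z_def z'_def ennreal_plus[symmetric] add_divide_distrib del: ennreal_plus)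
  finally show ?thesis .
qed

definition sector_q :: "real \<Rightarrow> real \<Rightarrow> real \<Rightarrow> real \<Rightarrow> real" where
  "sector_q a b c \<phi> = a * (cos \<phi>)\<^sup>2 + 2 * b * (cos \<phi> * sin \<phi>) + c * (sin \<phi>)\<^sup>2"

definition sector_h :: "real \<Rightarrow> real \<Rightarrow> real \<Rightarrow> real" where
  "sector_h h1 h2 \<phi> = h1 * cos \<phi> + h2 * sin \<phi>"

lemma continuous_on_sector_density:
  assumes "continuous_on S m" "continuous_on S h" "continuous_on S Q" "\<And>x. x \<in> S \<Longrightarrow> m x \<noteq> 0"
  shows "continuous_on S (\<lambda>x. sector_density (m x) (h x) (Q x))"
proof -
  have "sqrt (1 + x\<^sup>2) \<noteq> 0" for x :: real
    using add_pos_nonneg[of 1 "x\<^sup>2"] by auto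
  then show ?thesis
    unfolding sector_density_def tail_def cot_root_def using assms(4)
    by (intro continuous_intros assms(1-3)) auto
qed

definition quad3 :: "real \<Rightarrow> real \<Rightarrow> real \<Rightarrow> real \<Rightarrow> real \<Rightarrow> real \<Rightarrow> real \<Rightarrow> real \<Rightarrow> real \<Rightarrow> real" where
  "quad3 a b c h1 h2 m x y z =
     a * x\<^sup>2 + 2 * b * (x * y) + c * y\<^sup>2 + 2 * (h1 * x + h2 * y) * z - m * z\<^sup>2"

text \<open>
  The indicator function of a cone in the unit ball, as a function of three coordinates, for use in iterated
  integrals.
\<close>

definition ball_cone :: "real \<Rightarrow> real \<Rightarrow> real \<Rightarrow> real \<Rightarrow> real \<Rightarrow> real \<Rightarrow> real \<Rightarrow> real \<Rightarrow> real \<Rightarrow> ennreal" where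
  "ball_cone a b c h1 h2 m x y z =
     (if x\<^sup>2 + y\<^sup>2 + z\<^sup>2 \<le> 1 \<and> quad3 a b c h1 h2 m x y z < 0 then 1 else 0)"

lemma measurable_ball_cone [measurable]:
  assumes [measurable]: "f \<in> borel_measurable M" "f' \<in> borel_measurable M" "f'' \<in> borel_measurable M"
  shows "(\<lambda>\<omega>. ball_cone a b c h1 h2 m (f \<omega>) (f' \<omega>) (f'' \<omega>)) \<in> borel_measurable M"
  unfolding ball_cone_def quad3_def by measurable

text \<open>
  The cone is swept out by the lines through the origin in the directions \<open>(1, t, s)\<close>. Integrating along the
  lines first produces the area element of the gnomonic chart, the integral over \<open>s\<close> is the area of a double
  sector, and \<open>t = tan \<phi>\<close> turns the remaining integral into one over directions. A form with a
  component \<open>h\<close> is allowed, since the conics near a given one are not centred at its centre.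
\<close>

lemma emeasure_quadratic_cone:
  assumes m: "0 < m" and Q: "\<And>\<phi>. 0 < sector_q a b c \<phi>"
  shows "emeasure lborel {y::real^3. norm y \<le> 1 \<and>
quad3 a b c h1 h2 m (y$1) (y$2) (y$3) < 0}
     = ennreal (2/3 * integral {-pi/2..pi/2} (\<lambda>\<phi>. sector_density m (sector_h h1 h2 \<phi>) (sector_q a b c \<phi>)))"
    (is "emeasure lborel ?S = _")
proof -
  let ?N = "quad3 a b c h1 h2 m"
  let ?g = "ball_cone a b c h1 h2 m"
  define D where "D \<phi> = sector_density m (sector_h h1 h2 \<phi>) (sector_q a b c \<phi>)" for \<phi>
  have "?S = cball 0 1 \<inter> {y. ?N (y$1) (y$2) (y$3) < 0}" by auto
  moreover have "open {y::real^3. ?N (y$1) (y$2) (y$3) < 0}"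
    unfolding quad3_def by (intro open_Collect_less continuous_intros)
  ultimately have S_sets: "?S \<in> sets borel" by (simp only: sets.Int borel_open borel_closed closed_cball)
  have "emeasure lborel ?S = (\<integral>\<^sup>+y. indicator ?S y \<partial>lborel)"
    using S_sets by simp
  also have "\<dots> = (\<integral>\<^sup>+x. \<integral>\<^sup>+y. \<integral>\<^sup>+z. ?g x y z \<partial>lborel \<partial>lborel \<partial>lborel)"
    using S_sets by (subst nn_integral_vec3)
      (auto simp: ball_cone_def quad3_def norm_le_square inner_vec_def sum_3 power2_eq_square indicator_def intro!: nn_integral_cong)
  also have "\<dots> = (\<integral>\<^sup>+x. \<integral>\<^sup>+t. \<integral>\<^sup>+s. ennreal (x\<^sup>2) * ?g x (x * t) (x * s) \<partial>lborel \<partial>lborel \<partial>lborel)"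
  proof (rule nn_integral_cong_AE)
    show "AE x in lborel. (\<integral>\<^sup>+y. \<integral>\<^sup>+z. ?g x y z \<partial>lborel \<partial>lborel) = (\<integral>\<^sup>+t. \<integral>\<^sup>+s. ennreal (x\<^sup>2) * ?g x (x * t) (x * s) \<partial>lborel \<partial>lborel)"
      using AE_lborel_singleton[of 0]
    proof eventually_elim
      case (elim x)
      have "(\<integral>\<^sup>+y. \<integral>\<^sup>+z. ?g x y z \<partial>lborel \<partial>lborel) = \<bar>x\<bar> * (\<integral>\<^sup>+t. \<integral>\<^sup>+z. ?g x (0 + x * t) z \<partial>lborel \<partial>lborel)"
        by (rule nn_integral_real_affine[OF _ elim]) measurable
      also have "\<dots> = \<bar>x\<bar> * (\<integral>\<^sup>+t. \<bar>x\<bar> * (\<integral>\<^sup>+s. ?g x (x * t) (0 + x * s) \<partial>lborel) \<partial>lborel)"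
        by (intro arg_cong[where f="\<lambda>u. _ * u"] nn_integral_cong)
          (simp add: nn_integral_real_affine[OF _ elim, of "\<lambda>z. ?g x (x * _) z" 0])
      also have "\<dots> = (\<integral>\<^sup>+t. \<integral>\<^sup>+s. \<bar>x\<bar> * (\<bar>x\<bar> * ?g x (x * t) (x * s)) \<partial>lborel \<partial>lborel)"
        by (simp add: nn_integral_cmult)
      also have "\<dots> = (\<integral>\<^sup>+t. \<integral>\<^sup>+s. ennreal (x\<^sup>2) * ?g x (x * t) (x * s) \<partial>lborel \<partial>lborel)"
        by (simp add: mult.assoc[symmetric] ennreal_mult'[symmetric] power2_eq_square)
      finally show ?case .
    qed
  qed
  also have "\<dots> = (\<integral>\<^sup>+t. \<integral>\<^sup>+x. \<integral>\<^sup>+s. ennreal (x\<^sup>2) * ?g x (x * t) (x * s) \<partial>lborel \<partial>lborel \<partial>lborel)"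
    by (rule lborel_pair.Fubini') measurable
  also have "\<dots> = (\<integral>\<^sup>+t. \<integral>\<^sup>+s. \<integral>\<^sup>+x. ennreal (x\<^sup>2) * ?g x (x * t) (x * s) \<partial>lborel \<partial>lborel \<partial>lborel)"
    by (intro nn_integral_cong lborel_pair.Fubini') measurable
  also have "\<dots> = (\<integral>\<^sup>+t. \<integral>\<^sup>+s. ennreal (2/3) * (ennreal (1 / ((1 + t\<^sup>2 + s\<^sup>2) * sqrt (1 + t\<^sup>2 + s\<^sup>2)))
      * indicator {s. ?N 1 t s < 0} s) \<partial>lborel \<partial>lborel)"
  proof (intro nn_integral_cong)
    fix t s :: real
    have K: "0 < 1 + t\<^sup>2 + s\<^sup>2" by (simp add: add_pos_nonneg)
    have "ennreal (x\<^sup>2) * ?g x (x * t) (x * s) = ennreal (x\<^sup>2) * indicator {x. x\<^sup>2 * (1 + t\<^sup>2 + s\<^sup>2) \<le> 1} x * indicator {s. ?N 1 t s < 0} s" for x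
    proof (cases "x = 0")
      case False
      have "?N x (x * t) (x * s) = x\<^sup>2 * ?N 1 t s" "x\<^sup>2 + (x * t)\<^sup>2 + (x * s)\<^sup>2 = x\<^sup>2 * (1 + t\<^sup>2 + s\<^sup>2)"
        by (simp_all add: quad3_def power2_eq_square algebra_simps)
      then show ?thesis using False by (simp add: ball_cone_def indicator_def mult_less_0_iff)
    qed simp
    then show "(\<integral>\<^sup>+x. ennreal (x\<^sup>2) * ?g x (x * t) (x * s) \<partial>lborel)
       = ennreal (2/3) * (ennreal (1 / ((1 + t\<^sup>2 + s\<^sup>2) * sqrt (1 + t\<^sup>2 + s\<^sup>2))) * indicator {s. ?N 1 t s < 0} s)"
      using nn_integral_square_cball[OF K] K
      by (simp add: nn_integral_multc mult.assoc[symmetric] ennreal_mult'[symmetric])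
  qed
  also have "\<dots> = (\<integral>\<^sup>+t. ennreal (2/3 * (inverse (1 + t\<^sup>2) * D (arctan t))) \<partial>lborel)"
  proof (intro nn_integral_cong)
    fix t :: real
    have K: "0 < 1 + t\<^sup>2" by (simp add: add_pos_nonneg)
    have c: "cos (arctan t) = 1 / sqrt (1 + t\<^sup>2)" and s: "sin (arctan t) = t / sqrt (1 + t\<^sup>2)"
      by (simp_all add: cos_arctan sin_arctan)
    have q: "sector_q a b c (arctan t) = (a + 2 * b * t + c * t\<^sup>2) / (1 + t\<^sup>2)"
      using K unfolding sector_q_def c s by (simp add: power_divide add_divide_distrib power2_eq_square)
    have h: "sector_h h1 h2 (arctan t) = (h1 + h2 * t) / sqrt (1 + t\<^sup>2)"
      unfolding sector_h_def c s by (simp add: add_divide_distrib)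
    have Qt: "0 < a + 2 * b * t + c * t\<^sup>2"
      using Q[of "arctan t"] K unfolding q by (simp add: zero_less_divide_iff)
    have "(\<integral>\<^sup>+s. ennreal (2/3) * (ennreal (1 / ((1 + t\<^sup>2 + s\<^sup>2) * sqrt (1 + t\<^sup>2 + s\<^sup>2))) * indicator {s. ?N 1 t s < 0} s) \<partial>lborel)
      = ennreal (2/3) * (\<integral>\<^sup>+s. (ennreal (1 / ((1 + t\<^sup>2 + s\<^sup>2) * sqrt (1 + t\<^sup>2 + s\<^sup>2))) * indicator {s. ?N 1 t s < 0} s) \<partial>lborel)"
      unfolding quad3_def by (rule nn_integral_cmult) measurable
    also have "\<dots> = ennreal (2/3) * ennreal (D (arctan t) / (1 + t\<^sup>2))"
      using nn_integral_chart_fibre[OF K m Qt, of "h1 + h2 * t"] by (simp add: quad3_def D_def q h)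
    finally show "(\<integral>\<^sup>+s. ennreal (2/3) * (ennreal (1 / ((1 + t\<^sup>2 + s\<^sup>2) * sqrt (1 + t\<^sup>2 + s\<^sup>2))) * indicator {s. ?N 1 t s < 0} s) \<partial>lborel)
      = ennreal (2/3 * (inverse (1 + t\<^sup>2) * D (arctan t)))"
      by (simp add: ennreal_mult'[symmetric] field_simps)
  qed
  also have "\<dots> = ennreal (2/3 * integral {-pi/2..pi/2} D)"
  proof -
    have contD: "continuous_on S D" for S
      unfolding D_def sector_h_def sector_q_def using m by (intro continuous_on_sector_density continuous_intros) auto
    have ai: "D absolutely_integrable_on {-pi/2..pi/2}"
      using absolutely_integrable_continuous_real[OF contD] .
    have img: "range arctan = {-pi/2<..<pi/2}"
    proof (intro equalityI subsetI)
      fix y :: real assume "y \<in> {-pi/2<..<pi/2}"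
      then have "y = arctan (tan y)" by (simp add: arctan_tan)
      then show "y \<in> range arctan" by blast
    qed (use arctan_lbound arctan_ubound in auto)
    have "D absolutely_integrable_on {-pi/2<..<pi/2} \<and> integral {-pi/2<..<pi/2} D = integral {-pi/2..pi/2} D"
    proof
      show "D absolutely_integrable_on {-pi/2<..<pi/2}"
        using ai by (rule set_integrable_subset) auto
      show "integral {-pi/2<..<pi/2} D = integral {-pi/2..pi/2} D"
        using integral_open_interval_real[of "-pi/2" "pi/2" D] by simp
    qed
    then have 1: "(\<lambda>t. \<bar>inverse (1 + t\<^sup>2)\<bar> * D (arctan t)) absolutely_integrable_on UNIV \<and>
        integral UNIV (\<lambda>t. \<bar>inverse (1 + t\<^sup>2)\<bar> * D (arctan t)) = integral {-pi/2..pi/2} D"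
      unfolding img[symmetric]
      by (subst has_absolute_integral_change_of_variables_1')
        (auto intro!: derivative_eq_intros inj_onI simp: arctan_eq_iff)
    have nonneg: "0 \<le> inverse (1 + t\<^sup>2) * D (arctan t)" for t
      by (auto simp: D_def sector_density_def intro!: mult_nonneg_nonneg add_nonneg_nonneg tail_nonneg)
    have abs: "\<bar>inverse (1 + t\<^sup>2)\<bar> = inverse (1 + t\<^sup>2)" for t :: real by simp
    have "((\<lambda>t. inverse (1 + t\<^sup>2) * D (arctan t)) has_integral integral {-pi/2..pi/2} D) UNIV"
      using 1 unfolding abs has_integral_iff by (auto dest: set_lebesgue_integral_eq_integral(1))
    then have "((\<lambda>t. 2/3 * (inverse (1 + t\<^sup>2) * D (arctan t))) has_integral 2/3 * integral {-pi/2..pi/2} D) UNIV"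
      by (rule has_integral_mult_right)
    from nn_integral_has_integral_lebesgue'[OF _ this] nonneg show ?thesis by simp
  qed
  finally show ?thesis unfolding D_def .
qed


section \<open>Orthonormal frames and eigenframes\<close>

definition orthonormal_frame :: "real^3 \<Rightarrow> real^3 \<Rightarrow> real^3 \<Rightarrow> bool" where
  "orthonormal_frame e1 e2 e3 \<longleftrightarrow>
     e1 \<bullet> e1 = 1 \<and> e2 \<bullet> e2 = 1 \<and> e3 \<bullet> e3 = 1 \<and> e1 \<bullet> e2 = 0 \<and> e1 \<bullet> e3 = 0 \<and> e2 \<bullet> e3 = 0"

lemma frame_inner:
  assumes "orthonormal_frame e1 e2 e3"
  shows "e1 \<bullet> e1 = 1" "e2 \<bullet> e2 = 1" "e3 \<bullet> e3 = 1" "e1 \<bullet> e2 = 0" "e1 \<bullet> e3 = 0" "e2 \<bullet> e3 = 0"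
    "e2 \<bullet> e1 = 0" "e3 \<bullet> e1 = 0" "e3 \<bullet> e2 = 0"
  using assms by (auto simp: orthonormal_frame_def inner_commute)

definition frame_map :: "real^3 \<Rightarrow> real^3 \<Rightarrow> real^3 \<Rightarrow> real^3 \<Rightarrow> real^3" where
  "frame_map e1 e2 e3 y = y$1 *\<^sub>R e1 + y$2 *\<^sub>R e2 + y$3 *\<^sub>R e3"

lemma orthogonal_transformation_frame_map:
  assumes "orthonormal_frame e1 e2 e3"
  shows "orthogonal_transformation (frame_map e1 e2 e3)"
  unfolding orthogonal_transformation_def
proof
  show "linear (frame_map e1 e2 e3)"
    by (rule linearI) (simp_all add: frame_map_def algebra_simps)
  have "frame_map e1 e2 e3 v \<bullet> frame_map e1 e2 e3 w = v$1 * w$1 + v$2 * w$2 + v$3 * w$3" for v w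
    using frame_inner[OF assms] by (simp add: frame_map_def inner_simps)
  then show "\<forall>v w. frame_map e1 e2 e3 v \<bullet> frame_map e1 e2 e3 w = v \<bullet> w"
    by (simp add: inner_vec_def sum_3)
qed

lemma frame_expansion:
  assumes "orthonormal_frame e1 e2 e3"
  shows "y = (y \<bullet> e1) *\<^sub>R e1 + (y \<bullet> e2) *\<^sub>R e2 + (y \<bullet> e3) *\<^sub>R e3"
proof -
  obtain z where z: "y = frame_map e1 e2 e3 z"
    using orthogonal_transformation_surj[OF orthogonal_transformation_frame_map[OF assms]] by (metis surjD)
  then have "y \<bullet> e1 = z$1" "y \<bullet> e2 = z$2" "y \<bullet> e3 = z$3"
    using frame_inner[OF assms] by (simp_all add: frame_map_def inner_simps)
  then show ?thesis using z by (simp add: frame_map_def)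
qed

lemma frame_inner_expansion:
  assumes "orthonormal_frame e1 e2 e3"
  shows "x \<bullet> y = (x \<bullet> e1) * (y \<bullet> e1) + (x \<bullet> e2) * (y \<bullet> e2) + (x \<bullet> e3) * (y \<bullet> e3)"
  by (subst frame_expansion[OF assms, of x]) (simp add: inner_simps inner_commute)

lemma symmetric_matrix_inner:
  fixes M :: "real^3^3"
  assumes "transpose M = M"
  shows "x \<bullet> (M *v y) = (M *v x) \<bullet> y"
  using assms by (metis dot_lmul_matrix transpose_matrix_vector)

lemma frame_quadratic_form:
  fixes M :: "real^3^3"
  assumes M: "transpose M = M"
  shows "frame_map e1 e2 e3 y \<bullet> (M *v frame_map e1 e2 e3 y) =
     quad3 (e1 \<bullet> (M *v e1)) (e1 \<bullet> (M *v e2)) (e2 \<bullet> (M *v e2)) (e1 \<bullet> (M *v e3)) (e2 \<bullet> (M *v e3))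
       (- (e3 \<bullet> (M *v e3))) (y$1) (y$2) (y$3)"
proof -
  have sym: "e2 \<bullet> (M *v e1) = e1 \<bullet> (M *v e2)" "e3 \<bullet> (M *v e1) = e1 \<bullet> (M *v e3)" "e3 \<bullet> (M *v e2) = e2 \<bullet> (M *v e3)"
    using symmetric_matrix_inner[OF M] by (simp_all add: inner_commute)
  show ?thesis
    unfolding frame_map_def quad3_def
    by (simp add: matrix_vector_right_distrib scaleR_matrix_vector_assoc[symmetric] matrix_vector_mult_scaleR inner_simps sym)
      (simp add: algebra_simps power2_eq_square)
qed

lemma elliptic_class_in_conic_interior:
  assumes "norm x = 1"
  shows "elliptic_class x \<in> conic_interior M \<longleftrightarrow> x \<bullet> (M *v x) < 0"
proof -
  have "(- y) \<bullet> (M *v (- y)) = y \<bullet> (M *v y)" for y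
    by (simp add: linear_neg[OF matrix_vector_mul_linear])
  then show ?thesis
    unfolding conic_interior_def using assms elliptic_class_eq_iff by (force simp: image_iff)
qed

text \<open>
  The area formula for a conic in an arbitrary frame whose third vector lies in the interior and
  whose first two vectors span a line outside the conic. An orthogonal map
  takes the cone of the conic to a cone in standard coordinates.
\<close>

theorem conic_area_in_frame:
  fixes M :: "real^3^3"
  assumes frame: "orthonormal_frame e1 e2 e3" and M: "transpose M = M"
    and neg: "e3 \<bullet> (M *v e3) < 0"
    and pos: "\<And>\<phi>. 0 < sector_q (e1 \<bullet> (M *v e1)) (e1 \<bullet> (M *v e2)) (e2 \<bullet> (M *v e2)) \<phi>"
  shows "conic_area M = integral {-pi/2..pi/2} (\<lambda>\<phi>. sector_density (- (e3 \<bullet> (M *v e3)))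
     (sector_h (e1 \<bullet> (M *v e3)) (e2 \<bullet> (M *v e3)) \<phi>)
     (sector_q (e1 \<bullet> (M *v e1)) (e1 \<bullet> (M *v e2)) (e2 \<bullet> (M *v e2)) \<phi>))" (is "_ = ?I")
proof -
  let ?f = "frame_map e1 e2 e3"
  let ?N = "quad3 (e1 \<bullet> (M *v e1)) (e1 \<bullet> (M *v e2)) (e2 \<bullet> (M *v e2)) (e1 \<bullet> (M *v e3)) (e2 \<bullet> (M *v e3)) (- (e3 \<bullet> (M *v e3)))"
  define S where "S = {y::real^3. norm y \<le> 1 \<and> ?N (y$1) (y$2) (y$3) < 0}"
  define C where "C = {r *\<^sub>R x | r x. 0 \<le> r \<and> r \<le> 1 \<and> x \<in> sphere 0 1 \<and> elliptic_class x \<in> conic_interior M}"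
  note ot = orthogonal_transformation_frame_map[OF frame]
  have "S = cball 0 1 \<inter> {y. ?N (y$1) (y$2) (y$3) < 0}" by (auto simp: S_def)
  moreover have "open {y::real^3. ?N (y$1) (y$2) (y$3) < 0}"
    unfolding quad3_def by (intro open_Collect_less continuous_intros)
  ultimately have S_sets: "S \<in> sets borel" by (simp only: sets.Int borel_open borel_closed closed_cball)
  have S_int: "0 \<le> ?I"
  proof (rule integral_nonneg)
    show "(\<lambda>\<phi>. sector_density (- (e3 \<bullet> (M *v e3)))
      (sector_h (e1 \<bullet> (M *v e3)) (e2 \<bullet> (M *v e3)) \<phi>)
      (sector_q (e1 \<bullet> (M *v e1)) (e1 \<bullet> (M *v e2)) (e2 \<bullet> (M *v e2)) \<phi>)) integrable_on {-pi/2..pi/2}"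
      unfolding sector_h_def sector_q_def using neg
      by (intro integrable_continuous_real continuous_on_sector_density continuous_intros) auto
  qed (auto simp: sector_density_def intro!: add_nonneg_nonneg tail_nonneg)
  have emS: "emeasure lborel S = ennreal (2/3 * ?I)"
    unfolding S_def using neg pos by (intro emeasure_quadratic_cone) auto
  then have mS: "measure lebesgue S = 2/3 * ?I"
    using S_sets S_int by (simp add: measure_def measure_completion)
  have S_lm: "S \<in> lmeasurable"
    using S_sets emS by (auto intro!: fmeasurableI simp: fmeasurable_def)
  have T: "?f ` S = {y. norm y \<le> 1 \<and> y \<bullet> (M *v y) < 0}"
  proof -
    have "y \<in> ?f ` S" if y: "norm y \<le> 1" "y \<bullet> (M *v y) < 0" for y
    proof -
      obtain z where z: "y = ?f z" using orthogonal_transformation_surj[OF ot] by (metis surjD)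
      then have "z \<in> S"
        using y orthogonal_transformation_norm[OF ot, of z] frame_quadratic_form[OF M, of e1 e2 e3 z] by (simp add: S_def)
      then show ?thesis using z by blast
    qed
    then show ?thesis
      using frame_quadratic_form[OF M, of e1 e2 e3] orthogonal_transformation_norm[OF ot]
      by (auto simp: S_def)
  qed
  have scale: "(r *\<^sub>R x) \<bullet> (M *v (r *\<^sub>R x)) = r\<^sup>2 * (x \<bullet> (M *v x))" for r x
    by (simp add: matrix_vector_mult_scaleR power2_eq_square)
  have "C = ?f ` S \<union> (C \<inter> {0})"
  proof (intro equalityI subsetI)
    fix y assume y: "y \<in> C"
    then obtain r x where rx: "y = r *\<^sub>R x" "0 \<le> r" "r \<le> 1" "norm x = 1" "x \<bullet> (M *v x) < 0"
      by (auto simp: C_def elliptic_class_in_conic_interior)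
    then show "y \<in> ?f ` S \<union> (C \<inter> {0})"
      using y unfolding T by (cases "r = 0") (auto simp: scale mult_pos_neg simp del: inner_scaleR_left)
  next
    fix y assume "y \<in> ?f ` S \<union> (C \<inter> {0})"
    moreover have "y \<in> C" if "norm y \<le> 1" "y \<bullet> (M *v y) < 0"
    proof -
      have "y \<noteq> 0" using that by auto
      then have y: "y = norm y *\<^sub>R (y /\<^sub>R norm y)" "norm (y /\<^sub>R norm y) = 1" by auto
      have "(y /\<^sub>R norm y) \<bullet> (M *v (y /\<^sub>R norm y)) < 0"
        unfolding scale using that \<open>y \<noteq> 0\<close> by (simp add: mult_pos_neg)
      then have "elliptic_class (y /\<^sub>R norm y) \<in> conic_interior M"
        using y(2) by (simp only: elliptic_class_in_conic_interior)
      then show ?thesis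
        unfolding C_def using y that(1) by (intro CollectI exI[of _ "norm y"] exI[of _ "y /\<^sub>R norm y"]) auto
    qed
    ultimately show "y \<in> C" unfolding T by auto
  qed
  moreover have "C \<inter> {0} \<in> null_sets lebesgue"
    by (rule null_sets_completion_subset[of _ "{0}"]) auto
  moreover have "?f ` S \<in> sets lebesgue"
    using measurable_orthogonal_image[OF ot S_lm] by auto
  ultimately have "measure lebesgue C = measure lebesgue (?f ` S)"
    using measure_Un_null_set by metis
  also have "\<dots> = 2/3 * ?I"
    using measure_orthogonal_image[OF ot S_lm] mS by simp
  finally show ?thesis
    by (simp add: conic_area_def elliptic_area_def C_def)
qed

text \<open>
  A vector where a positive semidefinite form vanishes minimises the form, so the derivative of the form there,
  which is \<open>2 N x\<close>, is zero. The step length \<open>t\<close> in the direction \<open>N x\<close> is chosen so that the quadratic term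
  cannot outweigh the linear one.
\<close>

lemma psd_null_vector:
  fixes N :: "real^3^3"
  assumes N: "transpose N = N" and psd: "\<And>z. 0 \<le> z \<bullet> (N *v z)" and x: "x \<bullet> (N *v x) = 0"
  shows "N *v x = 0"
proof -
  define y where "y = N *v x"
  define c where "c = y \<bullet> (N *v y)"
  define t where "t = - (y \<bullet> y) / (c + 1)"
  have c: "0 \<le> c" using psd by (simp add: c_def)
  have "0 \<le> (x + t *\<^sub>R y) \<bullet> (N *v (x + t *\<^sub>R y))" by (rule psd)
  also have "\<dots> = 2 * t * (y \<bullet> y) + t\<^sup>2 * c"
  proof -
    have "x \<bullet> (N *v y) = y \<bullet> y" using symmetric_matrix_inner[OF N] by (simp add: y_def)
    then show ?thesis using x
      by (simp add: matrix_vector_right_distrib matrix_vector_mult_scaleR inner_simps y_def[symmetric] c_def power2_eq_square)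
        (simp add: algebra_simps)
  qed
  also have "\<dots> = - (y \<bullet> y)\<^sup>2 * (c + 2) / (c + 1)\<^sup>2"
    using c unfolding t_def by (simp add: divide_simps power2_eq_square) (simp add: algebra_simps)
  finally have "(y \<bullet> y)\<^sup>2 * (c + 2) / (c + 1)\<^sup>2 \<le> 0" by simp
  then have "(y \<bullet> y)\<^sup>2 \<le> 0"
    using c by (simp add: divide_le_0_iff mult_le_0_iff)
  then show ?thesis by (simp add: y_def)
qed

definition eigenframe :: "real^3^3 \<Rightarrow> real \<Rightarrow> real \<Rightarrow> real \<Rightarrow> real^3 \<Rightarrow> real^3 \<Rightarrow> real^3 \<Rightarrow> bool" where
  "eigenframe M a b c e1 e2 e3 \<longleftrightarrow> orthonormal_frame e1 e2 e3 \<and>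
     M *v e1 = a *\<^sub>R e1 \<and> M *v e2 = b *\<^sub>R e2 \<and> M *v e3 = c *\<^sub>R e3"

lemma eigenframe_form:
  assumes "eigenframe M a b c e1 e2 e3"
  shows "x \<bullet> (M *v y) = a * ((x \<bullet> e1) * (y \<bullet> e1)) + b * ((x \<bullet> e2) * (y \<bullet> e2)) + c * ((x \<bullet> e3) * (y \<bullet> e3))"
proof -
  have f: "orthonormal_frame e1 e2 e3" using assms by (simp add: eigenframe_def)
  have "M *v y = (y \<bullet> e1) *\<^sub>R (a *\<^sub>R e1) + (y \<bullet> e2) *\<^sub>R (b *\<^sub>R e2) + (y \<bullet> e3) *\<^sub>R (c *\<^sub>R e3)"
    by (subst frame_expansion[OF f, of y])
      (use assms in \<open>simp add: eigenframe_def matrix_vector_right_distrib matrix_vector_mult_scaleR\<close>)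
  then show ?thesis by (simp add: inner_simps algebra_simps)
qed

lemma eigenframe_symmetric:
  assumes "eigenframe M a b c e1 e2 e3"
  shows "transpose M = M"
proof -
  have "axis i 1 \<bullet> (M *v axis j 1) = axis j 1 \<bullet> (M *v axis i 1)" for i j :: 3
    unfolding eigenframe_form[OF assms] by (simp add: ac_simps)
  then have "M $ i $ j = M $ j $ i" for i j
    by (simp add: inner_axis' matrix_vector_mult_basis column_def)
  then show ?thesis by (simp add: transpose_def vec_eq_iff)
qed

lemma eigenframe_unique:
  assumes "eigenframe M a b c e1 e2 e3" "eigenframe N a b c e1 e2 e3"
  shows "M = N"
proof -
  have "axis i 1 \<bullet> (M *v axis j 1) = axis i 1 \<bullet> (N *v axis j 1)" for i j :: 3
    unfolding eigenframe_form[OF assms(1)] eigenframe_form[OF assms(2)] by simp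
  then show ?thesis
    by (simp add: inner_axis' matrix_vector_mult_basis column_def vec_eq_iff)
qed

text \<open>
  The matrix \<open>P\<close> whose columns are the frame conjugates \<open>M\<close> to a diagonal matrix.
\<close>

lemma eigenframe_det:
  assumes "eigenframe M a b c e1 e2 e3"
  shows "det (mat t - M) = (t - a) * (t - b) * (t - c)"
proof -
  have f: "orthonormal_frame e1 e2 e3" using assms by (simp add: eigenframe_def)
  let ?f = "frame_map e1 e2 e3"
  define P where "P = matrix ?f"
  define D :: "real^3^3" where "D = (\<chi> i j. if i = j then (vector [t - a, t - b, t - c] :: real^3) $ i else 0)"
  have "orthogonal_matrix P" and lin: "linear ?f"
    using orthogonal_transformation_frame_map[OF f] by (auto simp: orthogonal_transformation_matrix P_def)
  then have P: "det P \<noteq> 0" using det_orthogonal_matrix[of P] by auto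
  have Px: "P *v x = ?f x" for x using lin by (simp add: P_def matrix_works)
  have Dx: "D *v x = vector [(t - a) * x$1, (t - b) * x$2, (t - c) * x$3]" for x
    by (simp add: D_def vec_eq_iff forall_3 matrix_vector_mult_def sum_3)
  have "((mat t - M) ** P) *v x = (P ** D) *v x" for x
  proof -
    have "((mat t - M) ** P) *v x = t *\<^sub>R ?f x - M *v ?f x"
      by (simp add: matrix_vector_mul_assoc[symmetric] Px matrix_vector_mult_diff_rdistrib)
        (simp add: mat_def matrix_vector_mult_def vec_eq_iff if_distrib[of "\<lambda>u. u * _"] cong: if_cong)
    also have "\<dots> = ?f (D *v x)"
      using assms unfolding Dx
      by (simp add: frame_map_def eigenframe_def matrix_vector_right_distrib matrix_vector_mult_scaleR algebra_simps)
    finally show ?thesis by (simp add: matrix_vector_mul_assoc[symmetric] Px)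
  qed
  then have "(mat t - M) ** P = P ** D" by (simp add: matrix_eq)
  then have "det (mat t - M) * det P = det P * det D" by (metis det_mul)
  moreover have "det D = (t - a) * (t - b) * (t - c)"
    by (simp add: det_3 D_def)
  ultimately show ?thesis using P by simp
qed

lemma eigenvector_exists:
  fixes M :: "real^3^3"
  assumes "det (mat t - M) = 0"
  obtains e where "norm e = 1" "M *v e = t *\<^sub>R e"
proof -
  have "\<not> invertible (mat t - M)" using assms by (simp add: invertible_det_nz)
  then obtain x where x: "x \<noteq> 0" "(mat t - M) *v x = 0"
    using invertible_left_inverse matrix_left_invertible_ker by blast
  have "(mat t - M) *v x = t *\<^sub>R x - M *v x"
    by (simp add: matrix_vector_mult_diff_rdistrib)
      (simp add: mat_def matrix_vector_mult_def vec_eq_iff if_distrib[of "\<lambda>u. u * _"] cong: if_cong)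
  with x have "M *v x = t *\<^sub>R x" by simp
  then have "M *v (x /\<^sub>R norm x) = t *\<^sub>R (x /\<^sub>R norm x)" by (simp add: matrix_vector_mult_scaleR)
  then show thesis using x(1) by (intro that[of "x /\<^sub>R norm x"]) auto
qed

lemma complete_frame:
  assumes "norm e1 = 1" "norm e3 = 1" "e1 \<bullet> e3 = 0"
  shows "orthonormal_frame e1 (cross3 e3 e1) e3"
proof -
  have "(norm (cross3 e3 e1))\<^sup>2 = 1"
    using norm_cross_dot[of e3 e1] assms by (simp add: inner_commute)
  then show ?thesis
    using assms by (simp add: orthonormal_frame_def dot_cross_self norm_eq_1 power2_norm_eq_inner[symmetric])
qed

text \<open>
  The orthogonal complement of two eigenvectors of a symmetric matrix is invariant, and here it is a line.
\<close>

lemma frame_third_eigenvector: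
  fixes M :: "real^3^3"
  assumes f: "orthonormal_frame e1 e2 e3" and M: "transpose M = M"
    and "M *v e1 = a *\<^sub>R e1" "M *v e3 = c *\<^sub>R e3"
  shows "eigenframe M a (e2 \<bullet> (M *v e2)) c e1 e2 e3"
proof -
  have "(M *v e2) \<bullet> e1 = 0" "(M *v e2) \<bullet> e3 = 0"
    using symmetric_matrix_inner[OF M, of e2 e1] symmetric_matrix_inner[OF M, of e2 e3] assms frame_inner[OF f] by simp_all
  then have "M *v e2 = (e2 \<bullet> (M *v e2)) *\<^sub>R e2"
    by (subst frame_expansion[OF f, of "M *v e2"]) (simp add: inner_commute)
  then show ?thesis using assms by (simp add: eigenframe_def)
qed

lemma conic_eigenframe:
  assumes M: "transpose M = M" and ev: "eigenvalues3 M p v (-1)" and "0 < v" "v \<le> p"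
  obtains e1 e2 e3 where "eigenframe M v p (-1) e1 e2 e3"
proof -
  have det: "det (mat t - M) = (t - p) * (t - v) * (t - (-1))" for t
    using ev by (simp add: eigenvalues3_def)
  obtain e1 where e1: "norm e1 = 1" "M *v e1 = v *\<^sub>R e1"
    using eigenvector_exists[of v M] det by auto
  obtain e3 where e3: "norm e3 = 1" "M *v e3 = (-1) *\<^sub>R e3"
    using eigenvector_exists[of "-1" M] det by auto
  have "v * (e1 \<bullet> e3) = - (e1 \<bullet> e3)"
    using symmetric_matrix_inner[OF M, of e1 e3] e1 e3 by simp
  then have "(v + 1) * (e1 \<bullet> e3) = 0" by (simp add: algebra_simps)
  then have "e1 \<bullet> e3 = 0" using \<open>0 < v\<close> by simp
  then have f: "orthonormal_frame e1 (cross3 e3 e1) e3" using complete_frame e1 e3 by blast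
  define e2 where "e2 = cross3 e3 e1"
  define \<mu> where "\<mu> = e2 \<bullet> (M *v e2)"
  have ef: "eigenframe M v \<mu> (-1) e1 e2 e3"
    unfolding \<mu>_def e2_def using frame_third_eigenvector[OF f M e1(2) e3(2)] .
  have "(0 - v) * (0 - \<mu>) * (0 - (-1)) = (0 - p) * (0 - v) * (0 - (-1 :: real))"
    using eigenframe_det[OF ef, of 0] det[of 0] by simp
  then have "\<mu> = p" using \<open>0 < v\<close> by simp
  with ef that show thesis by blast
qed

lemma eigenframe_conic_matrix:
  assumes ef: "eigenframe M v p (-1) e1 e2 e3" and "0 < v" "v \<le> p"
  shows "eigenvalues3 M p v (-1)" "conic_matrix M"
proof -
  show ev: "eigenvalues3 M p v (-1)"
    using eigenframe_det[OF ef] by (simp add: eigenvalues3_def)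
  have "det (mat 0 - M) \<noteq> 0" using eigenframe_det[OF ef, of 0] assms by simp
  moreover have "mat 0 - M = - M" by (simp add: vec_eq_iff mat_def)
  ultimately have "det M \<noteq> 0" by (simp add: det_3)
  then have "invertible M" by (simp add: invertible_det_nz)
  moreover have "e1 \<bullet> (M *v e1) > 0" "e3 \<bullet> (M *v e3) < 0"
    using assms frame_inner[of e1 e2 e3] by (auto simp: eigenframe_def)
  then have "indefinite M" unfolding indefinite_def by blast
  ultimately show "conic_matrix M"
    using ev assms eigenframe_symmetric[OF ef] unfolding conic_matrix_def by blast
qed

text \<open>
  The Rayleigh quotient attains its maximum \<open>\<mu>\<close> on the sphere, and a maximiser is a null vector of the positive
  semidefinite matrix \<open>\<mu> - M\<close>.
\<close>

lemma maximal_eigenvector: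
  fixes M :: "real^3^3"
  assumes M: "transpose M = M"
  obtains e where "norm e = 1" "M *v e = (e \<bullet> (M *v e)) *\<^sub>R e"
    "\<And>x. x \<bullet> (M *v x) \<le> (e \<bullet> (M *v e)) * (x \<bullet> x)"
proof -
  have cont: "continuous_on (sphere 0 1) (\<lambda>x::real^3. x \<bullet> (M *v x))"
    by (intro continuous_intros linear_continuous_on_compose[of _ _ "\<lambda>x. M *v x"]) (auto simp: matrix_vector_mul_linear)
  have "(axis 1 1 :: real^3) \<in> sphere 0 1" by (simp add: norm_axis_1)
  then have ne: "sphere 0 1 \<noteq> ({} :: (real^3) set)" by (metis empty_iff)
  obtain e where e: "e \<in> sphere 0 1" "\<And>x::real^3. x \<in> sphere 0 1 \<Longrightarrow> x \<bullet> (M *v x) \<le> e \<bullet> (M *v e)"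
    using continuous_attains_sup[OF compact_sphere ne cont] by blast
  define \<mu> where "\<mu> = e \<bullet> (M *v e)"
  have le: "x \<bullet> (M *v x) \<le> \<mu> * (x \<bullet> x)" for x
  proof (cases "x = 0")
    case False
    define u where "u = x /\<^sub>R norm x"
    have x: "x = norm x *\<^sub>R u" "u \<in> sphere 0 1" using False by (auto simp: u_def)
    have "x \<bullet> (M *v x) = (norm x)\<^sup>2 * (u \<bullet> (M *v u))"
      by (subst (1 2) x(1)) (simp add: matrix_vector_mult_scaleR power2_eq_square)
    also have "\<dots> \<le> (norm x)\<^sup>2 * \<mu>"
      unfolding \<mu>_def by (intro mult_left_mono e x) auto
    finally show ?thesis by (simp add: power2_norm_eq_inner mult.commute)
  qed simp
  have Nx: "(mat \<mu> - M) *v x = \<mu> *\<^sub>R x - M *v x" for x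
    by (simp add: matrix_vector_mult_diff_rdistrib)
      (simp add: mat_def matrix_vector_mult_def vec_eq_iff if_distrib[of "\<lambda>u. u * _"] cong: if_cong)
  have "(mat \<mu> - M) *v e = 0"
  proof (rule psd_null_vector)
    show "transpose (mat \<mu> - M) = mat \<mu> - M"
      using M by (simp add: transpose_def mat_def vec_eq_iff)
    show "0 \<le> z \<bullet> ((mat \<mu> - M) *v z)" for z
      using le[of z] unfolding Nx by (simp add: inner_diff_right)
    show "e \<bullet> ((mat \<mu> - M) *v e) = 0"
      using e(1) unfolding Nx by (simp add: inner_diff_right \<mu>_def norm_eq_1)
  qed
  then have "M *v e = \<mu> *\<^sub>R e" unfolding Nx by simp
  show thesis
  proof (rule that)
    show "norm e = 1" using e(1) by simp
    show "M *v e = (e \<bullet> (M *v e)) *\<^sub>R e" unfolding \<mu>_def[symmetric] by fact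
    show "x \<bullet> (M *v x) \<le> (e \<bullet> (M *v e)) * (x \<bullet> x)" for x unfolding \<mu>_def[symmetric] by (rule le)
  qed
qed

text \<open>
  A symmetric matrix that is negative on a vector and positive on the orthogonal plane has the signature of a
  conic; division by the modulus of its negative eigenvalue gives the required normalisation.
\<close>

lemma indefinite_rescales_to_conic:
  fixes M :: "real^3^3"
  assumes M: "transpose M = M" and neg: "n \<bullet> (M *v n) < 0"
    and pos: "\<And>x. x \<bullet> n = 0 \<Longrightarrow> x \<noteq> 0 \<Longrightarrow> 0 < x \<bullet> (M *v x)"
  obtains k where "0 < k" "conic_matrix (k *\<^sub>R M)"
proof -
  have neg_vec: "(- M) *v x = - (M *v x)" for x
    by (simp add: matrix_vector_mult_def vec_eq_iff sum_negf)
  have "transpose (- M) = - M" using M by (simp add: transpose_def vec_eq_iff)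
  then obtain e3 where e3': "norm e3 = 1" "(- M) *v e3 = (e3 \<bullet> ((- M) *v e3)) *\<^sub>R e3"
    "\<And>x. x \<bullet> ((- M) *v x) \<le> (e3 \<bullet> ((- M) *v e3)) * (x \<bullet> x)"
    using maximal_eigenvector by metis
  define c where "c = e3 \<bullet> (M *v e3)"
  have e3: "M *v e3 = c *\<^sub>R e3" "\<And>x. c * (x \<bullet> x) \<le> x \<bullet> (M *v x)"
    using e3'(2,3) by (auto simp: neg_vec c_def)
  obtain e2 where e2: "norm e2 = 1" "M *v e2 = (e2 \<bullet> (M *v e2)) *\<^sub>R e2"
    "\<And>x. x \<bullet> (M *v x) \<le> (e2 \<bullet> (M *v e2)) * (x \<bullet> x)"
    using maximal_eigenvector[OF M] by metis
  define b where "b = e2 \<bullet> (M *v e2)"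
  have c: "c < 0"
  proof -
    have "c * (n \<bullet> n) < 0" using e3(2)[of n] neg by linarith
    then show ?thesis by (simp add: mult_less_0_iff) (meson inner_ge_zero not_le)
  qed
  obtain z where z: "z \<bullet> n = 0" "z \<noteq> 0"
    using orthogonal_to_vector_exists[of n] by (auto simp: orthogonal_def inner_commute)
  have b: "0 < b"
  proof -
    have "0 < b * (z \<bullet> z)" using pos[OF z] e2(3)[of z] by (simp add: b_def)
    moreover have "0 < z \<bullet> z" using z(2) by simp
    ultimately show ?thesis by (simp add: zero_less_mult_iff)
  qed
  have "b * (e2 \<bullet> e3) = c * (e2 \<bullet> e3)"
    using symmetric_matrix_inner[OF M, of e2 e3] e2(2) e3(1) by (auto simp: b_def[symmetric])
  moreover have "b \<noteq> c" using b c by linarith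
  ultimately have "e2 \<bullet> e3 = 0" by simp
  then have f: "orthonormal_frame e2 (cross3 e3 e2) e3" using complete_frame e2(1) e3'(1) by blast
  define e1 where "e1 = cross3 e3 e2"
  define a where "a = e1 \<bullet> (M *v e1)"
  have "eigenframe M b a c e2 e1 e3"
    unfolding a_def e1_def using frame_third_eigenvector[OF f M] e2(2) e3(1) by (simp add: b_def)
  then have ef: "eigenframe M a b c e1 e2 e3"
    by (auto simp: eigenframe_def orthonormal_frame_def inner_commute)
  then have f': "orthonormal_frame e1 e2 e3" by (simp add: eigenframe_def)
  \<comment> \<open>Otherwise the form is nonpositive on the plane spanned by \<open>e1\<close> and \<open>e3\<close>, which has a nonzero vector
    in common with the plane orthogonal to \<open>n\<close>.\<close>
  have a: "0 < a"
  proof (rule ccontr)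
    assume a: "\<not> 0 < a"
    define x where "x = (if e3 \<bullet> n = 0 \<and> e1 \<bullet> n = 0 then e1 else (e3 \<bullet> n) *\<^sub>R e1 - (e1 \<bullet> n) *\<^sub>R e3)"
    have xn: "x \<bullet> n = 0" by (simp add: x_def inner_simps)
    have comp: "x \<bullet> e2 = 0" "x \<bullet> e1 = (if e3 \<bullet> n = 0 \<and> e1 \<bullet> n = 0 then 1 else e3 \<bullet> n)"
      "x \<bullet> e3 = (if e3 \<bullet> n = 0 \<and> e1 \<bullet> n = 0 then 0 else - (e1 \<bullet> n))"
      using frame_inner[OF f'] by (auto simp: x_def inner_simps)
    have "x \<noteq> 0" using comp by (auto split: if_splits)
    then have "0 < x \<bullet> (M *v x)" using pos xn by blast
    also have "x \<bullet> (M *v x) = a * (x \<bullet> e1)\<^sup>2 + c * (x \<bullet> e3)\<^sup>2"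
      unfolding eigenframe_form[OF ef] by (simp add: comp(1) power2_eq_square)
    also have "\<dots> \<le> 0"
      using a c by (intro add_nonpos_nonpos mult_nonpos_nonneg) auto
    finally show False by simp
  qed
  have ab: "a \<le> b" using e2(3)[of e1] frame_inner(1)[OF f'] by (simp add: a_def b_def)
  define k where "k = - (1 / c)"
  have k: "0 < k" "k * c = -1" using c by (auto simp: k_def)
  have "eigenframe (k *\<^sub>R M) (k * a) (k * b) (-1) e1 e2 e3"
    using ef k(2) by (simp add: eigenframe_def scaleR_matrix_vector_assoc[symmetric])
  then have "conic_matrix (k *\<^sub>R M)"
    by (rule eigenframe_conic_matrix) (use a ab k in auto)
  with k(1) that show thesis by blast
qed


section \<open>The first variation of the area\<close>

lemma tail_deriv:
  "(tail has_real_derivative - (1 / ((1 + x\<^sup>2) * sqrt (1 + x\<^sup>2)))) (at x)"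
proof -
  have pos: "0 < 1 + x\<^sup>2" by (simp add: add_pos_nonneg)
  have "sqrt (1 + x\<^sup>2) * sqrt (1 + x\<^sup>2) = 1 + x\<^sup>2" using pos by simp
  then have e: "- ((1 * sqrt (1 + x\<^sup>2) - x * (2 * x * (inverse (sqrt (1 + x\<^sup>2)) / 2))) / (sqrt (1 + x\<^sup>2) * sqrt (1 + x\<^sup>2)))
     = - (1 / ((1 + x\<^sup>2) * sqrt (1 + x\<^sup>2)))"
    using pos by (simp add: divide_simps) (simp add: algebra_simps power2_eq_square)
  have "((\<lambda>x. 1 - x / sqrt (1 + x\<^sup>2)) has_real_derivative
     - ((1 * sqrt (1 + x\<^sup>2) - x * (2 * x * (inverse (sqrt (1 + x\<^sup>2)) / 2))) / (sqrt (1 + x\<^sup>2) * sqrt (1 + x\<^sup>2)))) (at x)"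
    using pos by (auto intro!: derivative_eq_intros simp: power2_eq_square)
  then show ?thesis unfolding e tail_def[abs_def] .
qed

text \<open>
  The derivative in \<open>\<epsilon>\<close> of \<open>cot_root (1 - \<epsilon> \<eta>) (\<epsilon> l) (q + \<epsilon> k)\<close>, as it comes out of the quotient rule.
\<close>

definition cot_root_deriv :: "real \<Rightarrow> real \<Rightarrow> real \<Rightarrow> real \<Rightarrow> real \<Rightarrow> real" where
  "cot_root_deriv \<epsilon> \<eta> l q k =
     ((l + (2 * (\<epsilon> * l) * l + (1 - \<epsilon> * \<eta>) * k - \<eta> * (q + \<epsilon> * k)) / (2 * sqrt ((\<epsilon> * l)\<^sup>2 + (1 - \<epsilon> * \<eta>) * (q + \<epsilon> * k)))) * (1 - \<epsilon> * \<eta>)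
       + (\<epsilon> * l + sqrt ((\<epsilon> * l)\<^sup>2 + (1 - \<epsilon> * \<eta>) * (q + \<epsilon> * k))) * \<eta>) / (1 - \<epsilon> * \<eta>)\<^sup>2"

lemma cot_root_has_deriv:
  assumes "0 < 1 - \<epsilon> * \<eta>" "0 < q + \<epsilon> * k"
  shows "((\<lambda>\<epsilon>. cot_root (1 - \<epsilon> * \<eta>) (\<epsilon> * l) (q + \<epsilon> * k)) has_real_derivative cot_root_deriv \<epsilon> \<eta> l q k) (at \<epsilon>)"
proof -
  define R where "R = (\<epsilon> * l)\<^sup>2 + (1 - \<epsilon> * \<eta>) * (q + \<epsilon> * k)"
  have R: "0 < R" using assms by (simp add: R_def add_nonneg_pos)
  have dR: "((\<lambda>\<epsilon>. sqrt ((\<epsilon> * l)\<^sup>2 + (1 - \<epsilon> * \<eta>) * (q + \<epsilon> * k))) has_real_derivative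
     (2 * (\<epsilon> * l) * l + (1 - \<epsilon> * \<eta>) * k - \<eta> * (q + \<epsilon> * k)) / (2 * sqrt R)) (at \<epsilon>)"
    using R unfolding R_def
    by (auto intro!: derivative_eq_intros simp: divide_simps algebra_simps power2_eq_square)
  have dl: "((\<lambda>\<epsilon>. \<epsilon> * l) has_real_derivative l) (at \<epsilon>)"
    and dm: "((\<lambda>\<epsilon>. 1 - \<epsilon> * \<eta>) has_real_derivative - \<eta>) (at \<epsilon>)"
    by (auto intro!: derivative_eq_intros)
  have "1 - \<epsilon> * \<eta> \<noteq> 0" using assms(1) by simp
  from DERIV_divide[OF DERIV_add[OF dl dR] dm this] show ?thesis
    unfolding cot_root_def cot_root_deriv_def R_def by (simp add: power2_eq_square)
qed

text \<open>
  Differentiation under the integral sign. At \<open>\<epsilon> = 0\<close> the two roots move by \<open>l\<close> and \<open>- l\<close>, apart from a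
  common term, and the corresponding terms cancel: a shift of the centre has no first-order effect on the area.
\<close>

lemma sector_integral_deriv:
  fixes l q k :: "real \<Rightarrow> real"
  assumes cont: "continuous_on {a..b} l" "continuous_on {a..b} q" "continuous_on {a..b} k"
    and U: "0 \<in> U" "convex U"
    and pos: "\<And>\<epsilon>. \<epsilon> \<in> U \<Longrightarrow> 0 < 1 - \<epsilon> * \<eta>" "\<And>\<epsilon> \<phi>. \<epsilon> \<in> U \<Longrightarrow> \<phi> \<in> {a..b} \<Longrightarrow> 0 < q \<phi> + \<epsilon> * k \<phi>"
  shows "((\<lambda>\<epsilon>. integral {a..b} (\<lambda>\<phi>. sector_density (1 - \<epsilon> * \<eta>) (\<epsilon> * l \<phi>) (q \<phi> + \<epsilon> * k \<phi>)))
     has_real_derivative integral {a..b} (\<lambda>\<phi>. - (arc_weight (q \<phi>) * (k \<phi> + \<eta> * q \<phi>)))) (at 0 within U)"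
proof -
  define \<sigma> where "\<sigma> \<epsilon> l q k = cot_root (1 - \<epsilon> * \<eta>) (\<epsilon> * l) (q + \<epsilon> * k)" for \<epsilon> l q k
  define t' where "t' x = - (1 / ((1 + x\<^sup>2) * sqrt (1 + x\<^sup>2)))" for x :: real
  define f' where "f' \<epsilon> \<phi> = t' (\<sigma> \<epsilon> (l \<phi>) (q \<phi>) (k \<phi>)) * cot_root_deriv \<epsilon> \<eta> (l \<phi>) (q \<phi>) (k \<phi>)
     + t' (\<sigma> \<epsilon> (- l \<phi>) (q \<phi>) (k \<phi>)) * cot_root_deriv \<epsilon> \<eta> (- l \<phi>) (q \<phi>) (k \<phi>)" for \<epsilon> \<phi>
  have R: "0 < (\<epsilon> * l')\<^sup>2 + (1 - \<epsilon> * \<eta>) * (q \<phi> + \<epsilon> * k \<phi>)" if "\<epsilon> \<in> U" "\<phi> \<in> {a..b}" for \<epsilon> \<phi> l'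
    using pos[OF that(1)] that by (simp add: add_nonneg_pos)
  have pc: "continuous_on (U \<times> {a..b}) (\<lambda>x. l (snd x))" "continuous_on (U \<times> {a..b}) (\<lambda>x. q (snd x))"
    "continuous_on (U \<times> {a..b}) (\<lambda>x. k (snd x))"
    using cont by (auto intro!: continuous_on_compose2[of "{a..b}" _ _ snd] continuous_intros)
  have nz: "1 - fst x * \<eta> \<noteq> 0" "sqrt ((fst x * l')\<^sup>2 + (1 - fst x * \<eta>) * (q (snd x) + fst x * k (snd x))) \<noteq> 0"
    if "x \<in> U \<times> {a..b}" for x l'
    using that R[of "fst x" "snd x" l'] pos(1)[of "fst x"] by auto
  have sq: "(1 + x\<^sup>2) \<noteq> 0 \<and> sqrt (1 + x\<^sup>2) \<noteq> 0" for x :: real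
    using add_pos_nonneg[of 1 "x\<^sup>2"] by auto
  have "((\<lambda>\<epsilon>. integral (cbox a b) (\<lambda>\<phi>. sector_density (1 - \<epsilon> * \<eta>) (\<epsilon> * l \<phi>) (q \<phi> + \<epsilon> * k \<phi>)))
     has_real_derivative integral (cbox a b) (f' 0)) (at 0 within U)"
  proof (rule leibniz_rule_field_derivative[OF _ _ _ U])
    fix \<epsilon> \<phi> assume ep: "\<epsilon> \<in> U" "\<phi> \<in> cbox a b"
    note d = DERIV_chain2[OF tail_deriv cot_root_has_deriv]
    have p: "0 < 1 - \<epsilon> * \<eta>" "0 < q \<phi> + \<epsilon> * k \<phi>" using pos ep by auto
    have "((\<lambda>\<epsilon>. sector_density (1 - \<epsilon> * \<eta>) (\<epsilon> * l \<phi>) (q \<phi> + \<epsilon> * k \<phi>)) has_real_derivative f' \<epsilon> \<phi>) (at \<epsilon>)"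
      using DERIV_add[OF d[OF p, of "l \<phi>"] d[OF p, of "- l \<phi>"]]
      by (simp add: sector_density_def f'_def t'_def \<sigma>_def)
    then show "((\<lambda>\<epsilon>. sector_density (1 - \<epsilon> * \<eta>) (\<epsilon> * l \<phi>) (q \<phi> + \<epsilon> * k \<phi>)) has_real_derivative f' \<epsilon> \<phi>) (at \<epsilon> within U)"
      by (rule has_field_derivative_at_within)
  next
    fix \<epsilon> assume "\<epsilon> \<in> U"
    then show "(\<lambda>\<phi>. sector_density (1 - \<epsilon> * \<eta>) (\<epsilon> * l \<phi>) (q \<phi> + \<epsilon> * k \<phi>)) integrable_on cbox a b"
      using pos(1)[of \<epsilon>] unfolding cbox_interval
      by (intro integrable_continuous_real continuous_on_sector_density continuous_intros cont) auto
  next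
    show "continuous_on (U \<times> cbox a b) (\<lambda>(\<epsilon>, \<phi>). f' \<epsilon> \<phi>)"
      unfolding f'_def t'_def \<sigma>_def cot_root_def cot_root_deriv_def split_beta cbox_interval
      using nz sq by (intro continuous_intros pc) auto
  qed
  also have "integral (cbox a b) (f' 0) = integral {a..b} (\<lambda>\<phi>. - (arc_weight (q \<phi>) * (k \<phi> + \<eta> * q \<phi>)))"
    unfolding cbox_interval
  proof (rule integral_cong)
    fix \<phi> assume "\<phi> \<in> {a..b}"
    then have q: "0 < q \<phi>" using pos(2)[OF U(1)] by simp
    have \<sigma>: "\<sigma> 0 l' (q \<phi>) (k \<phi>) = sqrt (q \<phi>)" for l' by (simp add: \<sigma>_def cot_root_def)
    have s: "sqrt (q \<phi>) * sqrt (q \<phi>) = q \<phi>" using q by simp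
    have "cot_root_deriv 0 \<eta> (l \<phi>) (q \<phi>) (k \<phi>) + cot_root_deriv 0 \<eta> (- l \<phi>) (q \<phi>) (k \<phi>) = (k \<phi> - \<eta> * q \<phi>) / sqrt (q \<phi>) + 2 * \<eta> * sqrt (q \<phi>)"
      by (simp add: cot_root_deriv_def)
    also have "\<dots> = (k \<phi> + \<eta> * q \<phi>) / sqrt (q \<phi>)"
      using q s by (simp add: field_simps)
    finally have "f' 0 \<phi> = t' (sqrt (q \<phi>)) * ((k \<phi> + \<eta> * q \<phi>) / sqrt (q \<phi>))"
      unfolding f'_def \<sigma> distrib_left[symmetric] by simp
    also have "\<dots> = - (arc_weight (q \<phi>) * (k \<phi> + \<eta> * q \<phi>))"
      using q by (simp add: t'_def arc_weight_def)
    finally show "f' 0 \<phi> = - (arc_weight (q \<phi>) * (k \<phi> + \<eta> * q \<phi>))" .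
  qed
  finally show ?thesis by (simp add: cbox_interval)
qed

lemma sector_density_centred:
  assumes "0 < q"
  shows "sector_density 1 0 q = arc_density q"
  using assms by (simp add: sector_density_def tail_def cot_root_def arc_density_def real_sqrt_divide)

lemma quad2_eq_sector_q: "quad2 v p = sector_q v 0 p"
  by (simp add: quad2_def sector_q_def fun_eq_iff)

lemma conic_area_eigenframe:
  assumes ef: "eigenframe M v p (-1) e1 e2 e3" and "0 < v" "0 < p"
  shows "conic_area M = conic_area_fun v p"
proof -
  have f: "orthonormal_frame e1 e2 e3" using ef by (simp add: eigenframe_def)
  have e: "e1 \<bullet> (M *v e1) = v" "e1 \<bullet> (M *v e2) = 0" "e2 \<bullet> (M *v e2) = p"
    "e1 \<bullet> (M *v e3) = 0" "e2 \<bullet> (M *v e3) = 0" "e3 \<bullet> (M *v e3) = -1"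
    using ef frame_inner[OF f] by (simp_all add: eigenframe_def)
  have "conic_area M = integral {-pi/2..pi/2} (\<lambda>\<phi>. sector_density 1 (sector_h 0 0 \<phi>) (sector_q v 0 p \<phi>))"
    using conic_area_in_frame[OF f eigenframe_symmetric[OF ef]] quad2_pos[OF assms(2,3)]
    unfolding e quad2_eq_sector_q by simp
  also have "\<dots> = conic_area_fun v p"
    unfolding conic_area_fun_def quad2_eq_sector_q
    using quad2_pos[OF assms(2,3)] by (intro integral_cong) (simp add: sector_h_def sector_density_centred quad2_eq_sector_q)
  finally show ?thesis .
qed

lemma eigenframe_trace:
  assumes ef: "eigenframe M a b c f1 f2 f3" and e: "orthonormal_frame e1 e2 e3"
  shows "e1 \<bullet> (M *v e1) + e2 \<bullet> (M *v e2) + e3 \<bullet> (M *v e3) = a + b + c"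
proof -
  have f: "orthonormal_frame f1 f2 f3" using ef by (simp add: eigenframe_def)
  have "(e1 \<bullet> u) * (e1 \<bullet> u) + (e2 \<bullet> u) * (e2 \<bullet> u) + (e3 \<bullet> u) * (e3 \<bullet> u) = u \<bullet> u" for u
    using frame_inner_expansion[OF e, of u u] by (simp add: inner_commute)
  from this[of f1] this[of f2] this[of f3]
  have s: "(e1 \<bullet> f1) * (e1 \<bullet> f1) + (e2 \<bullet> f1) * (e2 \<bullet> f1) + (e3 \<bullet> f1) * (e3 \<bullet> f1) = 1"
    "(e1 \<bullet> f2) * (e1 \<bullet> f2) + (e2 \<bullet> f2) * (e2 \<bullet> f2) + (e3 \<bullet> f2) * (e3 \<bullet> f2) = 1"
    "(e1 \<bullet> f3) * (e1 \<bullet> f3) + (e2 \<bullet> f3) * (e2 \<bullet> f3) + (e3 \<bullet> f3) * (e3 \<bullet> f3) = 1"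
    using frame_inner[OF f] by simp_all
  have "e1 \<bullet> (M *v e1) + e2 \<bullet> (M *v e2) + e3 \<bullet> (M *v e3) =
     a * ((e1 \<bullet> f1) * (e1 \<bullet> f1) + (e2 \<bullet> f1) * (e2 \<bullet> f1) + (e3 \<bullet> f1) * (e3 \<bullet> f1))
   + b * ((e1 \<bullet> f2) * (e1 \<bullet> f2) + (e2 \<bullet> f2) * (e2 \<bullet> f2) + (e3 \<bullet> f2) * (e3 \<bullet> f2))
   + c * ((e1 \<bullet> f3) * (e1 \<bullet> f3) + (e2 \<bullet> f3) * (e2 \<bullet> f3) + (e3 \<bullet> f3) * (e3 \<bullet> f3))"
    unfolding eigenframe_form[OF ef] by (simp only: algebra_simps)
  then show ?thesis by (simp only: s)
qed

text \<open>
  A value of the form on a unit vector is a weighted mean of the eigenvalues.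
\<close>

lemma eigenframe_bounds:
  assumes ef: "eigenframe M v p c f1 f2 f3" and "c \<le> v" "v \<le> p" and x: "x \<bullet> x = 1"
  shows "c \<le> x \<bullet> (M *v x)" "x \<bullet> (M *v x) \<le> p"
proof -
  have f: "orthonormal_frame f1 f2 f3" using ef by (simp add: eigenframe_def)
  have one: "(x \<bullet> f1) * (x \<bullet> f1) + (x \<bullet> f2) * (x \<bullet> f2) + (x \<bullet> f3) * (x \<bullet> f3) = 1"
    using frame_inner_expansion[OF f, of x x] x by simp
  have "c * 1 \<le> x \<bullet> (M *v x)"
    unfolding eigenframe_form[OF ef] one[symmetric] distrib_left
    using assms by (intro add_mono mult_right_mono) auto
  then show "c \<le> x \<bullet> (M *v x)" by simp
  have "x \<bullet> (M *v x) \<le> p * 1"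
    unfolding eigenframe_form[OF ef] one[symmetric] distrib_left
    using assms by (intro add_mono mult_right_mono) auto
  then show "x \<bullet> (M *v x) \<le> p" by simp
qed


section \<open>A smaller conic between two conics of equal area\<close>

text \<open>
  The eigenvalue \<open>-1\<close> is simple, so \<open>e\<close> is parallel to the third vector of the frame.
\<close>

lemma eigenframe_positive_on_complement:
  assumes ef: "eigenframe N v p (-1) f1 f2 f3" and "0 < v" "v \<le> p"
    and e: "norm e = 1" "N *v e = - e" and x: "x \<bullet> e = 0" "x \<noteq> 0"
  shows "0 < x \<bullet> (N *v x)"
proof -
  have f: "orthonormal_frame f1 f2 f3" using ef by (simp add: eigenframe_def)
  have Nf: "N *v f1 = v *\<^sub>R f1" "N *v f2 = p *\<^sub>R f2" using ef by (auto simp: eigenframe_def)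
  note sym = symmetric_matrix_inner[OF eigenframe_symmetric[OF ef]]
  have "v * (e \<bullet> f1) = - (e \<bullet> f1)" "p * (e \<bullet> f2) = - (e \<bullet> f2)"
    using sym[of e f1] sym[of e f2] unfolding Nf e(2) by simp_all
  then have "(v + 1) * (e \<bullet> f1) = 0" "(p + 1) * (e \<bullet> f2) = 0" by (simp_all add: algebra_simps)
  then have "e \<bullet> f1 = 0" "e \<bullet> f2 = 0" using assms by auto
  then have e3: "e = (e \<bullet> f3) *\<^sub>R f3" using frame_expansion[OF f, of e] by simp
  then have "e \<bullet> f3 \<noteq> 0" using e(1) by auto
  moreover have "(e \<bullet> f3) * (x \<bullet> f3) = 0" using x(1) e3 by (metis inner_scaleR_right)
  ultimately have x3: "x \<bullet> f3 = 0" by simp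
  have "0 < v * (x \<bullet> x)" using assms by simp
  also have "\<dots> = v * ((x \<bullet> f1) * (x \<bullet> f1)) + v * ((x \<bullet> f2) * (x \<bullet> f2))"
    using frame_inner_expansion[OF f, of x x] x3 by (simp add: algebra_simps)
  also have "\<dots> \<le> v * ((x \<bullet> f1) * (x \<bullet> f1)) + p * ((x \<bullet> f2) * (x \<bullet> f2))"
    using assms by (intro add_left_mono mult_right_mono) auto
  also have "\<dots> = x \<bullet> (N *v x)" unfolding eigenframe_form[OF ef] using x3 by simp
  finally show ?thesis .
qed

lemma sector_q_as_form:
  fixes N :: "real^3^3"
  assumes "transpose N = N" and x: "x = cos \<phi> *\<^sub>R e1 + sin \<phi> *\<^sub>R e2"
  shows "x \<bullet> (N *v x) = sector_q (e1 \<bullet> (N *v e1)) (e1 \<bullet> (N *v e2)) (e2 \<bullet> (N *v e2)) \<phi>"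
proof -
  have "e2 \<bullet> (N *v e1) = e1 \<bullet> (N *v e2)"
    using symmetric_matrix_inner[OF assms(1), of e1 e2] by (simp add: inner_commute)
  then show ?thesis
    unfolding x sector_q_def
    by (simp add: matrix_vector_right_distrib matrix_vector_mult_scaleR inner_simps)
      (simp add: algebra_simps power2_eq_square)
qed

text \<open>
  The integrand is odd.
\<close>

lemma weight_integral_cross_term:
  assumes "0 < v" "0 < p"
  shows "integral {-pi/2..pi/2} (\<lambda>\<phi>. arc_weight (quad2 v p \<phi>) * (cos \<phi> * sin \<phi>)) = 0" (is "?I = 0")
proof -
  have "?I = integral {-pi/2..pi/2} (\<lambda>\<phi>. arc_weight (quad2 v p (- \<phi>)) * (cos (- \<phi>) * sin (- \<phi>)))"
    using Henstock_Kurzweil_Integration.integral_reflect_real[of "pi/2" "-pi/2" "\<lambda>\<phi>. arc_weight (quad2 v p \<phi>) * (cos \<phi> * sin \<phi>)"] by simp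
  also have "\<dots> = - ?I" by (simp add: quad2_def)
  finally show ?thesis by simp
qed

text \<open>
  The integrated tangent inequality for \<open>arc_density\<close>, that is, convexity of the area in forms with a common
  centre, with strictness for different forms.
\<close>

lemma arc_density_integral_tangent:
  assumes "continuous_on {-pi/2..pi/2} q" "continuous_on {-pi/2..pi/2} r"
    "\<And>x. 0 < q x" "\<And>x. 0 < r x"
  shows "integral {-pi/2..pi/2} (\<lambda>\<phi>. arc_density (q \<phi>)) - integral {-pi/2..pi/2} (\<lambda>\<phi>. arc_density (r \<phi>))
      \<le> integral {-pi/2..pi/2} (\<lambda>\<phi>. arc_weight (q \<phi>) * (r \<phi> - q \<phi>))" (is "?L \<le> ?R")
    and "\<phi>\<^sub>0 \<in> {-pi/2..pi/2} \<Longrightarrow> q \<phi>\<^sub>0 \<noteq> r \<phi>\<^sub>0 \<Longrightarrow>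
      integral {-pi/2..pi/2} (\<lambda>\<phi>. arc_density (q \<phi>)) - integral {-pi/2..pi/2} (\<lambda>\<phi>. arc_density (r \<phi>))
      < integral {-pi/2..pi/2} (\<lambda>\<phi>. arc_weight (q \<phi>) * (r \<phi> - q \<phi>))"
proof -
  define D where "D \<phi> = arc_weight (q \<phi>) * (r \<phi> - q \<phi>) - (arc_density (q \<phi>) - arc_density (r \<phi>))" for \<phi>
  note c = continuous_on_arc_weight[OF assms(1,3)] continuous_on_arc_density[OF assms(1,3)] continuous_on_arc_density[OF assms(2,4)]
  have cD: "continuous_on {-pi/2..pi/2} D"
    unfolding D_def by (intro continuous_intros c assms)
  have "integral {-pi/2..pi/2} D = ?R - integral {-pi/2..pi/2} (\<lambda>\<phi>. arc_density (q \<phi>) - arc_density (r \<phi>))"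
    unfolding D_def by (intro integral_diff integrable_continuous_real continuous_intros c assms)
  also have "integral {-pi/2..pi/2} (\<lambda>\<phi>. arc_density (q \<phi>) - arc_density (r \<phi>)) = ?L"
    by (intro integral_diff integrable_continuous_real c)
  finally have ID: "integral {-pi/2..pi/2} D = ?R - ?L" .
  have pos: "0 < D \<phi>" if "q \<phi> \<noteq> r \<phi>" for \<phi>
    using arc_density_tangent[OF assms(3,4) that] by (simp add: D_def)
  have nonneg: "0 \<le> D \<phi>" for \<phi>
    using pos[of \<phi>] by (cases "q \<phi> = r \<phi>") (auto simp: D_def)
  show "?L \<le> ?R"
    using integral_nonneg[OF integrable_continuous_real[OF cD]] nonneg ID by simp
  show "?L < ?R" if "\<phi>\<^sub>0 \<in> {-pi/2..pi/2}" "q \<phi>\<^sub>0 \<noteq> r \<phi>\<^sub>0"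
    using integral_pos_continuous[OF cD nonneg that(1)] pos[OF that(2)] ID by simp
qed

text \<open>
  The integral is minus the derivative of the area on the way from \<open>M\<close> to \<open>N\<close>. If \<open>d3 > -1\<close>, the three weight
  integrals are ordered oppositely to the eigenvalues of \<open>N\<close>, so the sum of the products with the diagonal
  entries of \<open>N\<close> exceeds the sum of the products with the eigenvalues, and the latter is at least
  the area of \<open>M\<close> minus the area of \<open>N\<close> by convexity. If \<open>d3 = -1\<close>, then \<open>e3\<close> is an eigenvector of \<open>N\<close>, the conics have a
  common centre, and strict convexity can be applied to the form of \<open>N\<close> itself.
\<close>

lemma first_variation_sign:
  assumes M: "eigenframe M v p (-1) e1 e2 e3" and vp: "1/2 < v" "v \<le> p"
    and N: "eigenframe N v' p' (-1) f1 f2 f3" and vp': "0 < v'" "v' \<le> p'"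
    and area: "conic_area N \<le> conic_area M" and ne: "M \<noteq> N"
  shows "0 < integral {-pi/2..pi/2} (\<lambda>\<phi>. arc_weight (quad2 v p \<phi>) *
     (sector_q (e1 \<bullet> (N *v e1)) (e1 \<bullet> (N *v e2)) (e2 \<bullet> (N *v e2)) \<phi> + (e3 \<bullet> (N *v e3)) * quad2 v p \<phi>))"
    (is "0 < ?V")
proof -
  let ?I = "integral {-pi/2..pi/2}"
  let ?q = "quad2 v p"
  define w where "w \<phi> = arc_weight (?q \<phi>)" for \<phi>
  define d1 d12 d2 d3 where "d1 = e1 \<bullet> (N *v e1)" and "d12 = e1 \<bullet> (N *v e2)" and "d2 = e2 \<bullet> (N *v e2)" and "d3 = e3 \<bullet> (N *v e3)"
  have e: "orthonormal_frame e1 e2 e3" and f: "orthonormal_frame f1 f2 f3"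
    using M N by (auto simp: eigenframe_def)
  have v0: "0 < v" "0 < p" "0 < p'" using vp vp' by auto
  have qpos: "0 < ?q \<phi>" for \<phi> using v0 by (intro quad2_pos)
  have cw: "continuous_on {-pi/2..pi/2} w"
    unfolding w_def using qpos by (intro continuous_on_arc_weight continuous_on_quad2) auto
  have areaM: "conic_area M = ?I (\<lambda>\<phi>. arc_density (?q \<phi>))"
    using conic_area_eigenframe[OF M] v0 by (simp add: conic_area_fun_def)
  have V: "?V = ?I (\<lambda>\<phi>. w \<phi> * (sector_q d1 d12 d2 \<phi> + d3 * ?q \<phi>))"
    by (simp add: w_def d1_def d12_def d2_def d3_def)
  have d3: "-1 \<le> d3" and d2: "d2 \<le> p'"
    using eigenframe_bounds[OF N _ _ frame_inner(3)[OF e]] eigenframe_bounds[OF N _ _ frame_inner(2)[OF e]] vp'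
    by (auto simp: d3_def d2_def)
  show ?thesis
  proof (cases "d3 = -1")
    case False
    define Wc Ws Wq where "Wc = ?I (\<lambda>\<phi>. w \<phi> * (cos \<phi>)\<^sup>2)" and "Ws = ?I (\<lambda>\<phi>. w \<phi> * (sin \<phi>)\<^sup>2)"
      and "Wq = ?I (\<lambda>\<phi>. w \<phi> * ?q \<phi>)"
    have lin: "?I (\<lambda>\<phi>. a * (w \<phi> * (cos \<phi>)\<^sup>2) + b * (w \<phi> * (cos \<phi> * sin \<phi>)) + c * (w \<phi> * (sin \<phi>)\<^sup>2) + d * (w \<phi> * ?q \<phi>))
       = a * Wc + c * Ws + d * Wq" for a b c d
    proof -
      have 0: "?I (\<lambda>\<phi>. w \<phi> * (cos \<phi> * sin \<phi>)) = 0"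
        using weight_integral_cross_term[OF v0(1,2)] by (simp add: w_def)
      have i: "(\<lambda>\<phi>. a * (w \<phi> * (cos \<phi>)\<^sup>2)) integrable_on {-pi/2..pi/2}" "(\<lambda>\<phi>. b * (w \<phi> * (cos \<phi> * sin \<phi>))) integrable_on {-pi/2..pi/2}"
        "(\<lambda>\<phi>. c * (w \<phi> * (sin \<phi>)\<^sup>2)) integrable_on {-pi/2..pi/2}" "(\<lambda>\<phi>. d * (w \<phi> * ?q \<phi>)) integrable_on {-pi/2..pi/2}"
        by (intro integrable_continuous_real continuous_intros cw)+
      show ?thesis
        by (simp only: integral_add integrable_add i 0 integral_mult_right Wc_def Ws_def Wq_def mult_zero_right add_0_right)
    qed
    have "?V = ?I (\<lambda>\<phi>. d1 * (w \<phi> * (cos \<phi>)\<^sup>2) + (2 * d12) * (w \<phi> * (cos \<phi> * sin \<phi>)) + d2 * (w \<phi> * (sin \<phi>)\<^sup>2) + d3 * (w \<phi> * ?q \<phi>))"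
      by (rule trans[OF V]) (simp only: sector_q_def algebra_simps)
    then have V': "?V = d1 * Wc + d2 * Ws + d3 * Wq" unfolding lin .
    have W: "Ws \<le> Wc" "Wc < Wq"
      using weight_integral_sin_le_cos[OF v0(1) vp(2)] weight_integral_cos_less[OF vp] by (simp_all add: Wc_def Ws_def Wq_def w_def)
    have tr: "d1 = v' + p' - 1 - d2 - d3"
      using eigenframe_trace[OF N e] by (simp add: d1_def d2_def d3_def)
    have "0 \<le> conic_area M - conic_area N" using area by simp
    also have "\<dots> \<le> ?I (\<lambda>\<phi>. w \<phi> * (quad2 v' p' \<phi> - ?q \<phi>))"
      unfolding areaM conic_area_eigenframe[OF N vp'(1) v0(3)] conic_area_fun_def w_def
      using qpos quad2_pos[OF vp'(1) v0(3)]
      by (intro arc_density_integral_tangent continuous_on_quad2) auto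
    also have "\<dots> = ?I (\<lambda>\<phi>. v' * (w \<phi> * (cos \<phi>)\<^sup>2) + 0 * (w \<phi> * (cos \<phi> * sin \<phi>)) + p' * (w \<phi> * (sin \<phi>)\<^sup>2) + (-1) * (w \<phi> * ?q \<phi>))"
      unfolding quad2_def[of v' p'] by (intro arg_cong[where f = ?I] ext) (simp add: algebra_simps)
    also have "\<dots> = v' * Wc + p' * Ws - Wq" unfolding lin by simp
    also have "\<dots> < d1 * Wc + d2 * Ws + d3 * Wq"
    proof -
      have "0 \<le> (p' - d2) * (Wc - Ws)" using W d2 by simp
      moreover have "0 < (d3 + 1) * (Wq - Wc)" using W d3 False by simp
      ultimately show ?thesis unfolding tr by (simp add: algebra_simps)
    qed
    finally show ?thesis unfolding V' .
  next
    case True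
    have Ne3: "N *v e3 = - e3"
    proof -
      have plus: "(N + mat 1) *v x = N *v x + x" for x
        by (simp add: matrix_vector_mult_add_rdistrib)
      have "(N + mat 1) *v e3 = 0"
      proof (rule psd_null_vector)
        show "transpose (N + mat 1) = N + mat 1"
          using eigenframe_symmetric[OF N] by (simp add: transpose_def mat_def vec_eq_iff)
        show "0 \<le> z \<bullet> ((N + mat 1) *v z)" for z
        proof -
          have "0 \<le> (v' + 1) * ((z \<bullet> f1) * (z \<bullet> f1)) + (p' + 1) * ((z \<bullet> f2) * (z \<bullet> f2))"
            using vp' by (intro add_nonneg_nonneg mult_nonneg_nonneg[OF _ zero_le_square]) auto
          then show ?thesis
            unfolding plus inner_add_right eigenframe_form[OF N]
            using frame_inner_expansion[OF f, of z z] by (simp add: algebra_simps)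
        qed
        show "e3 \<bullet> ((N + mat 1) *v e3) = 0"
          unfolding plus inner_add_right using True frame_inner(3)[OF e] by (simp add: d3_def)
      qed
      then show ?thesis unfolding plus by (simp add: eq_neg_iff_add_eq_0)
    qed
    have ne3: "norm e3 = 1" using frame_inner(3)[OF e] by (simp add: norm_eq_1)
    have Qpos: "0 < sector_q d1 d12 d2 \<phi>" for \<phi>
    proof -
      define x where "x = cos \<phi> *\<^sub>R e1 + sin \<phi> *\<^sub>R e2"
      have "x \<bullet> x = (cos \<phi>)\<^sup>2 + (sin \<phi>)\<^sup>2" "x \<bullet> e3 = 0"
        using frame_inner[OF e] by (simp_all add: x_def inner_simps power2_eq_square)
      then have "0 < x \<bullet> (N *v x)"
        by (intro eigenframe_positive_on_complement[OF N vp' ne3 Ne3]) auto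
      then show ?thesis
        unfolding sector_q_as_form[OF eigenframe_symmetric[OF N] x_def] by (simp add: d1_def d12_def d2_def)
    qed
    have cQ: "continuous_on {-pi/2..pi/2} (sector_q d1 d12 d2)"
      unfolding sector_q_def by (intro continuous_intros)
    have cross: "e1 \<bullet> (N *v e3) = 0" "e2 \<bullet> (N *v e3) = 0"
      unfolding Ne3 using frame_inner[OF e] by simp_all
    have areaN: "conic_area N = ?I (\<lambda>\<phi>. arc_density (sector_q d1 d12 d2 \<phi>))"
    proof -
      have "conic_area N = ?I (\<lambda>\<phi>. sector_density 1 (sector_h 0 0 \<phi>) (sector_q d1 d12 d2 \<phi>))"
        using conic_area_in_frame[OF e eigenframe_symmetric[OF N]] Qpos True cross
        unfolding d1_def d12_def d2_def d3_def by simp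
      then show ?thesis using Qpos by (simp add: sector_h_def sector_density_centred)
    qed
    have V': "?V = ?I (\<lambda>\<phi>. w \<phi> * (sector_q d1 d12 d2 \<phi> - ?q \<phi>))"
      unfolding V True by simp
    have "\<exists>\<phi>\<in>{-pi/2..pi/2}. ?q \<phi> \<noteq> sector_q d1 d12 d2 \<phi>"
    proof (rule ccontr)
      assume "\<not> ?thesis"
      then have eq: "?q \<phi> = sector_q d1 d12 d2 \<phi>" if "\<phi> \<in> {-pi/2..pi/2}" for \<phi> using that by blast
      have 1: "d1 = v" using eq[of 0] by (simp add: quad2_def sector_q_def)
      have 2: "d2 = p" using eq[of "pi/2"] by (simp add: quad2_def sector_q_def)
      have "2 * d12 * (cos (pi/4) * sin (pi/4)) = 0"
        using eq[of "pi/4"] 1 2 by (simp add: quad2_def sector_q_def)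
      then have 3: "d12 = 0" by (simp add: sin_45 cos_45)
      note sym = symmetric_matrix_inner[OF eigenframe_symmetric[OF N]]
      have "(N *v e1) \<bullet> e1 = v" "(N *v e1) \<bullet> e2 = 0" "(N *v e1) \<bullet> e3 = 0" "(N *v e2) \<bullet> e1 = 0" "(N *v e2) \<bullet> e2 = p" "(N *v e2) \<bullet> e3 = 0"
        using 1 2 3 cross sym[of e1 e2] sym[of e1 e3] sym[of e2 e3] by (simp_all add: d1_def d2_def d12_def inner_commute)
      then have "N *v e1 = v *\<^sub>R e1" "N *v e2 = p *\<^sub>R e2"
        using frame_expansion[OF e, of "N *v e1"] frame_expansion[OF e, of "N *v e2"] by simp_all
      then have "eigenframe N v p (-1) e1 e2 e3" using Ne3 e by (simp add: eigenframe_def)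
      then show False using eigenframe_unique[OF M] ne by blast
    qed
    then obtain \<phi>\<^sub>0 where "\<phi>\<^sub>0 \<in> {-pi/2..pi/2}" "?q \<phi>\<^sub>0 \<noteq> sector_q d1 d12 d2 \<phi>\<^sub>0" by blast
    then have "conic_area M - conic_area N < ?V"
      unfolding areaM areaN V' w_def
      by (rule arc_density_integral_tangent(2)[OF continuous_on_quad2 cQ qpos Qpos])
    then show ?thesis using area by linarith
  qed
qed

lemma conic_area_scale:
  assumes "0 < k"
  shows "conic_area (k *\<^sub>R M) = conic_area M"
  using assms by (simp add: conic_area_def conic_interior_def scaleR_matrix_vector_assoc[symmetric] mult_less_0_iff)

lemma encloses_scale:
  assumes "0 < k"
  shows "encloses (k *\<^sub>R M) F \<longleftrightarrow> encloses M F"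
  using assms by (simp add: encloses_def scaleR_matrix_vector_assoc[symmetric] mult_le_0_iff)

lemma segment_form:
  fixes M N :: "real^3^3"
  shows "x \<bullet> ((M + \<epsilon> *\<^sub>R (N - M)) *v y) = x \<bullet> (M *v y) + \<epsilon> * (x \<bullet> (N *v y) - x \<bullet> (M *v y))"
  by (simp add: matrix_vector_mult_add_rdistrib matrix_vector_mult_diff_rdistrib scaleR_matrix_vector_assoc[symmetric] inner_simps)

lemma encloses_segment:
  assumes "encloses M F" "encloses N F" "0 \<le> \<epsilon>" "\<epsilon> \<le> 1"
  shows "encloses (M + \<epsilon> *\<^sub>R (N - M)) F"
proof -
  have "x \<bullet> (M *v x) + \<epsilon> * (x \<bullet> (N *v x) - x \<bullet> (M *v x)) \<le> 0"
    if "x \<bullet> (M *v x) \<le> 0" "x \<bullet> (N *v x) \<le> 0" for x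
  proof -
    have "(1 - \<epsilon>) * (x \<bullet> (M *v x)) + \<epsilon> * (x \<bullet> (N *v x)) \<le> 0"
      using assms that by (intro add_nonpos_nonpos mult_nonneg_nonpos) auto
    then show ?thesis by (simp add: algebra_simps)
  qed
  then show ?thesis using assms(1,2) unfolding encloses_def segment_form by blast
qed

text \<open>
  The area of \<open>M + \<epsilon> (N - M)\<close> has a negative derivative at \<open>\<epsilon> = 0\<close>, so it is smaller than the area of \<open>M\<close> for some
  small \<open>\<epsilon> > 0\<close>.
\<close>

theorem smaller_conic_between:
  assumes M: "eigenframe M v p (-1) e1 e2 e3" and vp: "1/2 < v" "v \<le> p"
    and N: "eigenframe N v' p' (-1) f1 f2 f3" and vp': "0 < v'" "v' \<le> p'"
    and area: "conic_area N \<le> conic_area M" and ne: "M \<noteq> N"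
    and enc: "encloses M F" "encloses N F"
  shows "\<exists>K. conic_matrix K \<and> encloses K F \<and> conic_area K < conic_area M"
proof -
  let ?q = "quad2 v p"
  define d11 d12 d22 d13 d23 d33 where "d11 = e1 \<bullet> (N *v e1)" and "d12 = e1 \<bullet> (N *v e2)" and "d22 = e2 \<bullet> (N *v e2)"
    and "d13 = e1 \<bullet> (N *v e3)" and "d23 = e2 \<bullet> (N *v e3)" and "d33 = e3 \<bullet> (N *v e3)"
  define \<eta> where "\<eta> = d33 + 1"
  define l where "l = sector_h d13 d23"
  define k where "k = sector_q (d11 - v) d12 (d22 - p)"
  have e: "orthonormal_frame e1 e2 e3" using M by (auto simp: eigenframe_def)
  have v0: "0 < v" "0 < p" using vp by auto
  have \<eta>: "0 \<le> \<eta>"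
    using eigenframe_bounds(1)[OF N _ _ frame_inner(3)[OF e]] vp' by (auto simp: \<eta>_def d33_def)
  define B where "B = \<bar>d11 - v\<bar> + 2 * \<bar>d12\<bar> + \<bar>d22 - p\<bar>"
  have B: "\<bar>k \<phi>\<bar> \<le> B" for \<phi>
  proof -
    have "\<bar>(d11 - v) * (cos \<phi>)\<^sup>2\<bar> \<le> \<bar>d11 - v\<bar> * 1" "\<bar>(d22 - p) * (sin \<phi>)\<^sup>2\<bar> \<le> \<bar>d22 - p\<bar> * 1"
      unfolding abs_mult by (intro mult_left_mono; simp add: abs_square_le_1)+
    moreover have "\<bar>2 * d12 * (cos \<phi> * sin \<phi>)\<bar> \<le> 2 * \<bar>d12\<bar> * (1 * 1)"
      unfolding abs_mult by (intro mult_mono) auto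
    moreover have "\<bar>k \<phi>\<bar> \<le> \<bar>(d11 - v) * (cos \<phi>)\<^sup>2\<bar> + \<bar>2 * d12 * (cos \<phi> * sin \<phi>)\<bar> + \<bar>(d22 - p) * (sin \<phi>)\<^sup>2\<bar>"
      unfolding k_def sector_q_def
      by (rule order_trans[OF abs_triangle_ineq add_right_mono[OF abs_triangle_ineq]])
    ultimately show ?thesis unfolding B_def by simp
  qed
  \<comment> \<open>For \<open>\<epsilon> \<le> \<delta>\<close> the centre of \<open>M\<close> stays in the interior and the form stays positive on the orthogonal plane.\<close>
  define \<delta> where "\<delta> = min 1 (min (1 / (2 * (\<eta> + 1))) (v / (2 * (B + 1))))"
  have B0: "0 \<le> B" by (simp add: B_def)
  have \<delta>: "0 < \<delta>" "\<delta> \<le> 1" "\<delta> \<le> 1 / (2 * (\<eta> + 1))" "\<delta> \<le> v / (2 * (B + 1))"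
    using \<eta> B0 v0 by (auto simp: \<delta>_def)
  define U where "U = {0..\<delta>}"
  have pos1: "0 < 1 - \<epsilon> * \<eta>" if "\<epsilon> \<in> U" for \<epsilon>
  proof -
    have "\<epsilon> * \<eta> \<le> 1 / (2 * (\<eta> + 1)) * \<eta>" using that \<delta> \<eta> by (intro mult_right_mono) (auto simp: U_def)
    also have "\<dots> < 1" using \<eta> by (simp add: field_simps)
    finally show ?thesis by simp
  qed
  have pos2: "0 < ?q \<phi> + \<epsilon> * k \<phi>" if "\<epsilon> \<in> U" for \<epsilon> \<phi>
  proof -
    have "\<epsilon> * \<bar>k \<phi>\<bar> \<le> v / (2 * (B + 1)) * B" using that \<delta> B[of \<phi>] B0 v0 by (intro mult_mono) (auto simp: U_def)
    also have "\<dots> < v" using B0 v0 by (simp add: field_simps add_nonneg_pos)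
    finally have "\<epsilon> * \<bar>k \<phi>\<bar> < ?q \<phi>" using quad2_ge[of v p \<phi>] vp by simp
    moreover have "- (\<epsilon> * \<bar>k \<phi>\<bar>) \<le> \<epsilon> * k \<phi>" using that by (cases "0 \<le> k \<phi>") (auto simp: U_def)
    ultimately show ?thesis by linarith
  qed
  define I where "I \<epsilon> = integral {-pi/2..pi/2} (\<lambda>\<phi>. sector_density (1 - \<epsilon> * \<eta>) (\<epsilon> * l \<phi>) (?q \<phi> + \<epsilon> * k \<phi>))" for \<epsilon>
  have kq: "k \<phi> + \<eta> * ?q \<phi> = sector_q d11 d12 d22 \<phi> + d33 * ?q \<phi>" for \<phi>
    unfolding k_def \<eta>_def quad2_eq_sector_q sector_q_def by (simp add: algebra_simps)
  have "(I has_real_derivative integral {-pi/2..pi/2} (\<lambda>\<phi>. - (arc_weight (?q \<phi>) * (k \<phi> + \<eta> * ?q \<phi>)))) (at 0 within U)"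
    unfolding I_def[abs_def]
  proof (rule sector_integral_deriv)
    show "continuous_on {-pi/2..pi/2} l" unfolding l_def sector_h_def by (intro continuous_intros)
    show "continuous_on {-pi/2..pi/2} k" unfolding k_def sector_q_def by (intro continuous_intros)
  qed (use \<delta> pos1 pos2 in \<open>auto simp: U_def intro: continuous_on_quad2\<close>)
  moreover have "integral {-pi/2..pi/2} (\<lambda>\<phi>. - (arc_weight (?q \<phi>) * (k \<phi> + \<eta> * ?q \<phi>))) < 0"
    using first_variation_sign[OF M vp N vp' area ne]
    unfolding kq integral_neg d11_def d12_def d22_def d33_def by simp
  ultimately obtain d where d: "0 < d" "\<And>h. 0 < h \<Longrightarrow> 0 + h \<in> U \<Longrightarrow> h < d \<Longrightarrow> I (0 + h) < I 0"
    using has_real_derivative_neg_dec_right by blast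
  define \<epsilon> where "\<epsilon> = min \<delta> (d / 2)"
  have \<epsilon>: "0 < \<epsilon>" "\<epsilon> \<in> U" "\<epsilon> < d" "\<epsilon> \<le> 1" using \<delta> d(1) by (auto simp: \<epsilon>_def U_def)
  then have less: "I \<epsilon> < I 0" using d(2)[of \<epsilon>] by simp
  define K where "K = M + \<epsilon> *\<^sub>R (N - M)"
  have Me: "e1 \<bullet> (M *v e1) = v" "e1 \<bullet> (M *v e2) = 0" "e2 \<bullet> (M *v e2) = p"
    "e1 \<bullet> (M *v e3) = 0" "e2 \<bullet> (M *v e3) = 0" "e3 \<bullet> (M *v e3) = -1"
    using M frame_inner[OF e] by (simp_all add: eigenframe_def)
  have K33: "e3 \<bullet> (K *v e3) = - (1 - \<epsilon> * \<eta>)"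
    unfolding K_def segment_form Me by (simp add: \<eta>_def d33_def algebra_simps)
  have Kq: "sector_q (e1 \<bullet> (K *v e1)) (e1 \<bullet> (K *v e2)) (e2 \<bullet> (K *v e2)) \<phi> = ?q \<phi> + \<epsilon> * k \<phi>" for \<phi>
    unfolding K_def segment_form Me quad2_def sector_q_def k_def by (simp add: d11_def d12_def d22_def algebra_simps)
  have Kh: "sector_h (e1 \<bullet> (K *v e3)) (e2 \<bullet> (K *v e3)) \<phi> = \<epsilon> * l \<phi>" for \<phi>
    unfolding K_def segment_form Me l_def sector_h_def by (simp add: d13_def d23_def algebra_simps)
  have Ksym: "transpose K = K"
    using eigenframe_symmetric[OF M] eigenframe_symmetric[OF N]
    unfolding K_def by (simp add: transpose_def vec_eq_iff)
  have areaK: "conic_area K = I \<epsilon>"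
    using conic_area_in_frame[OF e Ksym] pos1[OF \<epsilon>(2)] pos2[OF \<epsilon>(2)]
    unfolding K33 Kq Kh I_def by simp
  have areaM: "conic_area M = I 0"
    unfolding conic_area_eigenframe[OF M v0] conic_area_fun_def I_def
    using quad2_pos[OF v0] by (simp add: sector_density_centred)
  obtain c where c: "0 < c" "conic_matrix (c *\<^sub>R K)"
  proof (rule indefinite_rescales_to_conic[OF Ksym])
    show "e3 \<bullet> (K *v e3) < 0" unfolding K33 using pos1[OF \<epsilon>(2)] by simp
    fix x assume x: "x \<bullet> e3 = 0" "x \<noteq> 0"
    define r where "r = norm x"
    have r: "0 < r" using x by (simp add: r_def)
    have r2: "r\<^sup>2 = (x \<bullet> e1)\<^sup>2 + (x \<bullet> e2)\<^sup>2"
      unfolding r_def power2_norm_eq_inner using frame_inner_expansion[OF e, of x x] x(1) by (simp add: power2_eq_square)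
    have "((x \<bullet> e1) / r)\<^sup>2 + ((x \<bullet> e2) / r)\<^sup>2 = r\<^sup>2 / r\<^sup>2"
      unfolding r2 power_divide add_divide_distrib by simp
    then have "((x \<bullet> e1) / r)\<^sup>2 + ((x \<bullet> e2) / r)\<^sup>2 = 1" using r by simp
    then obtain \<phi> where \<phi>: "(x \<bullet> e1) / r = cos \<phi>" "(x \<bullet> e2) / r = sin \<phi>"
      using sincos_total_2pi by metis
    define u where "u = cos \<phi> *\<^sub>R e1 + sin \<phi> *\<^sub>R e2"
    have xu: "x = r *\<^sub>R u"
    proof -
      have "x \<bullet> e1 = r * cos \<phi>" "x \<bullet> e2 = r * sin \<phi>" using \<phi> r by (auto simp: field_simps)
      then show ?thesis using frame_expansion[OF e, of x] x(1) by (simp add: u_def scaleR_add_right)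
    qed
    have "0 < u \<bullet> (K *v u)"
      unfolding sector_q_as_form[OF Ksym u_def] Kq using pos2[OF \<epsilon>(2)] .
    then show "0 < x \<bullet> (K *v x)"
      unfolding xu using r by (simp add: matrix_vector_mult_scaleR)
  qed
  have "encloses (c *\<^sub>R K) F"
    unfolding encloses_scale[OF c(1)] K_def using enc \<epsilon> by (intro encloses_segment) auto
  moreover have "conic_area (c *\<^sub>R K) < conic_area M"
    unfolding conic_area_scale[OF c(1)] areaK areaM by (rule less)
  ultimately show ?thesis using c(2) by blast
qed


section \<open>Enclosing conics\<close>

lemma elliptic_class_uminus:
  assumes "norm x = 1"
  shows "elliptic_class (- x) = elliptic_class x"
  using elliptic_class_eq_iff[of x "- x"] assms by simp

lemma form_uminus: "(- x) \<bullet> (M *v (- x)) = x \<bullet> (M *v x)" for M :: "real^3^3"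
  by (simp add: linear_neg[OF matrix_vector_mul_linear])

definition closed_conic :: "real^3^3 \<Rightarrow> elliptic_point set" where
  "closed_conic M = elliptic_class ` {x \<in> sphere 0 1. x \<bullet> (M *v x) \<le> 0}"

lemma closed_conic_eq: "closed_conic M = conic_curve M \<union> conic_interior M"
  unfolding closed_conic_def conic_curve_def conic_interior_def by (auto simp: image_iff less_le)

lemma elliptic_class_in_closed_conic:
  assumes "norm x = 1"
  shows "elliptic_class x \<in> closed_conic M \<longleftrightarrow> x \<bullet> (M *v x) \<le> 0"
proof
  assume "elliptic_class x \<in> closed_conic M"
  then obtain y where y: "norm y = 1" "y \<bullet> (M *v y) \<le> 0" "elliptic_class x = elliptic_class y"
    by (auto simp: closed_conic_def)
  then have "y = x \<or> y = - x" using elliptic_class_eq_iff assms by blast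
  then show "x \<bullet> (M *v x) \<le> 0" using y(2) form_uminus[of x M] by auto
qed (use assms in \<open>auto simp: closed_conic_def\<close>)

lemma encloses_iff_subset: "encloses M F \<longleftrightarrow> F \<subseteq> closed_conic M"
proof
  assume e: "encloses M F"
  show "F \<subseteq> closed_conic M"
  proof
    fix a assume "a \<in> F"
    moreover obtain x where "norm x = 1" "elliptic_class x = a" using elliptic_class_surj by blast
    ultimately show "a \<in> closed_conic M"
      using e elliptic_class_in_closed_conic[of x M] by (auto simp: encloses_def)
  qed
next
  assume s: "F \<subseteq> closed_conic M"
  show "encloses M F"
    unfolding encloses_def
  proof (intro ballI impI)
    fix x assume "x \<in> sphere 0 (1::real)" "elliptic_class x \<in> F"
    then show "x \<bullet> (M *v x) \<le> 0" using s elliptic_class_in_closed_conic[of x M] by auto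
  qed
qed

text \<open>
  The cone of the conic on one side of the plane orthogonal to its axis \<open>e3\<close> is described by
  \<open>sqrt (v x\<^sub>1\<^sup>2 + p x\<^sub>2\<^sup>2) \<le> x\<^sub>3\<close>, where the left-hand side is a norm.
\<close>

lemma elliptic_convex_closed_conic:
  assumes ef: "eigenframe M v p (-1) e1 e2 e3" and "0 < v" "0 < p"
  shows "elliptic_convex (closed_conic M)"
proof -
  have f: "orthonormal_frame e1 e2 e3" using ef by (simp add: eigenframe_def)
  define L where "L x = (sqrt v * (x \<bullet> e1), sqrt p * (x \<bullet> e2))" for x
  have L: "L (x + y) = L x + L y" "L (c *\<^sub>R x) = c *\<^sub>R L x" for x y c
    by (auto simp: L_def inner_simps algebra_simps)
  have nL: "(norm (L x))\<^sup>2 = v * (x \<bullet> e1)\<^sup>2 + p * (x \<bullet> e2)\<^sup>2" for x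
    using assms by (simp add: L_def norm_Pair power_mult_distrib)
  define P where "P = {x. norm (L x) \<le> x \<bullet> e3}"
  have form: "x \<bullet> (M *v x) = (norm (L x))\<^sup>2 - (x \<bullet> e3)\<^sup>2" for x
    unfolding eigenframe_form[OF ef] nL by (simp add: power2_eq_square)
  have "convex P"
  proof (rule convexI)
    fix x y and u w :: real assume h: "x \<in> P" "y \<in> P" "0 \<le> u" "0 \<le> w" "u + w = 1"
    have "norm (L (u *\<^sub>R x + w *\<^sub>R y)) \<le> u * norm (L x) + w * norm (L y)"
      unfolding L using norm_triangle_ineq[of "u *\<^sub>R L x" "w *\<^sub>R L y"] h by simp
    also have "\<dots> \<le> u * (x \<bullet> e3) + w * (y \<bullet> e3)"
      using h by (intro add_mono mult_left_mono) (auto simp: P_def)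
    finally show "u *\<^sub>R x + w *\<^sub>R y \<in> P" by (simp add: P_def inner_simps)
  qed
  moreover have "cone P"
    unfolding cone_def by (auto simp: P_def L intro: mult_left_mono)
  moreover have "e3 \<noteq> 0" using frame_inner[OF f] by auto
  moreover have "\<forall>x\<in>P - {0}. 0 < e3 \<bullet> x"
  proof
    fix x assume x: "x \<in> P - {0}"
    then have le: "norm (L x) \<le> x \<bullet> e3" by (simp add: P_def)
    have "x \<bullet> e3 \<noteq> 0"
    proof
      assume "x \<bullet> e3 = 0"
      then have "L x = 0" using le by simp
      then have "x \<bullet> e1 = 0" "x \<bullet> e2 = 0" using assms by (auto simp: L_def zero_prod_def)
      with \<open>x \<bullet> e3 = 0\<close> have "x = 0" using frame_expansion[OF f, of x] by simp
      with x show False by simp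
    qed
    moreover have "0 \<le> x \<bullet> e3" using le norm_ge_zero order_trans by blast
    ultimately show "0 < e3 \<bullet> x" by (simp add: inner_commute)
  qed
  moreover have "closed_conic M = elliptic_class ` (sphere 0 1 \<inter> P)"
  proof (intro equalityI subsetI)
    fix a assume "a \<in> closed_conic M"
    then obtain x where x: "norm x = 1" "x \<bullet> (M *v x) \<le> 0" "a = elliptic_class x" by (auto simp: closed_conic_def)
    have "(norm (L x))\<^sup>2 \<le> \<bar>x \<bullet> e3\<bar>\<^sup>2" using x(2) form[of x] by simp
    then have "norm (L x) \<le> \<bar>x \<bullet> e3\<bar>" by (rule power2_le_imp_le) simp
    moreover have "norm (L (- x)) = norm (L x)" using L(2)[of "-1" x] by simp
    ultimately have "x \<in> P \<or> - x \<in> P" unfolding P_def mem_Collect_eq inner_minus_left by linarith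
    then show "a \<in> elliptic_class ` (sphere 0 1 \<inter> P)"
    proof
      assume "- x \<in> P"
      then show ?thesis using x elliptic_class_uminus[of x] by (intro image_eqI[of _ _ "- x"]) auto
    qed (use x in auto)
  next
    fix a assume "a \<in> elliptic_class ` (sphere 0 1 \<inter> P)"
    then obtain x where x: "norm x = 1" "norm (L x) \<le> x \<bullet> e3" "a = elliptic_class x" by (auto simp: P_def)
    then have "(norm (L x))\<^sup>2 \<le> (x \<bullet> e3)\<^sup>2" by (intro power_mono) auto
    then show "a \<in> closed_conic M" using x elliptic_class_in_closed_conic[of x M] by (simp add: form)
  qed
  ultimately show ?thesis unfolding elliptic_convex_def by blast
qed

lemma elliptic_disc_centre:
  assumes "elliptic_disc \<rho> D" "0 < \<rho>" "\<rho> < pi / 2"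
  obtains m where "norm m = 1" "\<And>x. norm x = 1 \<Longrightarrow> cos \<rho> \<le> x \<bullet> m \<Longrightarrow> elliptic_class x \<in> D"
proof -
  obtain N where N: "conic_matrix N" "semi_axes N \<rho> \<rho>" "D = closed_conic N"
    using assms(1) by (auto simp: elliptic_disc_def closed_conic_eq)
  obtain p v where ev: "v \<le> p" "0 < v" "eigenvalues3 N p v (-1)" "\<rho> = arctan (1 / sqrt v)" "\<rho> = arctan (1 / sqrt p)"
    using N(2) by (auto simp: semi_axes_def)
  have "v = p" using ev by (simp add: arctan_eq_iff)
  have "transpose N = N" using N(1) by (simp add: conic_matrix_def)
  then obtain g1 g2 m where g: "eigenframe N v v (-1) g1 g2 m"
    using conic_eigenframe[OF _ ev(3,2,1)] \<open>v = p\<close> by metis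
  then have f: "orthonormal_frame g1 g2 m" by (simp add: eigenframe_def)
  have "(cos \<rho>)\<^sup>2 = 1 / (1 + 1 / v)"
    unfolding ev(4) using ev(2) by (simp add: cos_arctan power_divide)
  then have c: "(v + 1) * (cos \<rho>)\<^sup>2 = v" using ev(2) by (simp add: field_simps)
  have c0: "0 \<le> cos \<rho>" using assms by (intro cos_ge_zero) auto
  show thesis
  proof (rule that[of m])
    show "norm m = 1" using frame_inner[OF f] by (simp add: norm_eq_1)
    fix x :: "real^3" assume x: "norm x = 1" "cos \<rho> \<le> x \<bullet> m"
    have "(cos \<rho>)\<^sup>2 \<le> (x \<bullet> m)\<^sup>2" using x c0 by (intro power_mono)
    then have "(v + 1) * (cos \<rho>)\<^sup>2 \<le> (v + 1) * (x \<bullet> m)\<^sup>2" using ev(2) by (intro mult_left_mono) auto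
    moreover have "x \<bullet> (N *v x) = v * (x \<bullet> x) - (v + 1) * (x \<bullet> m)\<^sup>2"
      unfolding eigenframe_form[OF g] frame_inner_expansion[OF f, of x x]
      by (simp add: algebra_simps power2_eq_square)
    moreover have "x \<bullet> x = 1" using x(1) by (simp add: norm_eq_1)
    ultimately show "elliptic_class x \<in> D"
      using elliptic_class_in_closed_conic[OF x(1)] N(3) c by simp
  qed
qed

text \<open>
  A conic with minor semi-axis \<open>\<beta>\<close> lies in the lune \<open>\<bar>x \<bullet> e2\<bar> \<le> sin \<beta>\<close>, where \<open>sin\<^sup>2 \<beta> = 1 / (p + 1)\<close>. From the
  centre \<open>m\<close> of the disc one moves along the great circle towards \<open>e2\<close>: the points within the distance \<open>\<rho>\<close> belong
  to the disc and hence to the lune. The distance \<open>\<psi>\<close> of \<open>m\<close> from the middle line of the lune is nonnegative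
  for a suitable sign of \<open>m\<close>, so the last of these points is at least \<open>\<rho>\<close> away from this line.
\<close>

lemma minor_axis_bound:
  assumes ef: "eigenframe M v p (-1) e1 e2 e3" and vp: "0 < v" "v \<le> p"
    and D: "elliptic_disc \<rho> D" "D \<subseteq> closed_conic M" and \<rho>: "0 < \<rho>" "\<rho> < pi / 2"
  shows "p \<le> 1 / (tan \<rho>)\<^sup>2"
proof -
  have f: "orthonormal_frame e1 e2 e3" using ef by (simp add: eigenframe_def)
  obtain m0 where m0: "norm m0 = 1" "\<And>x. norm x = 1 \<Longrightarrow> cos \<rho> \<le> x \<bullet> m0 \<Longrightarrow> elliptic_class x \<in> D"
    using elliptic_disc_centre[OF D(1) \<rho>] by blast
  have lune: "(p + 1) * (x \<bullet> e2)\<^sup>2 \<le> 1" if "norm x = 1" "elliptic_class x \<in> D" for x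
  proof -
    have "x \<bullet> (M *v x) \<le> 0" using that D(2) elliptic_class_in_closed_conic[of x M] by blast
    moreover have "(x \<bullet> e1) * (x \<bullet> e1) + (x \<bullet> e2) * (x \<bullet> e2) + (x \<bullet> e3) * (x \<bullet> e3) = 1"
      using frame_inner_expansion[OF f, of x x] that(1) by (simp add: norm_eq_1)
    moreover have "0 \<le> (v + 1) * ((x \<bullet> e1) * (x \<bullet> e1))" using vp by simp
    ultimately show ?thesis
      unfolding eigenframe_form[OF ef] by (simp add: algebra_simps power2_eq_square)
  qed
  define m where "m = (if 0 \<le> m0 \<bullet> e2 then m0 else - m0)"
  have m1: "norm m = 1" "0 \<le> m \<bullet> e2" using m0(1) by (auto simp: m_def)
  have mD: "elliptic_class x \<in> D" if x: "norm x = 1" "cos \<rho> \<le> x \<bullet> m" for x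
  proof (cases "0 \<le> m0 \<bullet> e2")
    case False
    then have "elliptic_class (- x) \<in> D" using x m0(2)[of "- x"] by (simp add: m_def)
    then show ?thesis using elliptic_class_uminus[OF x(1)] by simp
  qed (use x m0(2) in \<open>simp add: m_def\<close>)
  have mm: "m \<bullet> m = 1" using m1(1) by (simp add: norm_eq_1)
  have e22: "e2 \<bullet> e2 = 1" "norm e2 = 1" using frame_inner(2)[OF f] by (auto simp: norm_eq_1)
  have le1: "m \<bullet> e2 \<le> 1" using norm_cauchy_schwarz[of m e2] m1 e22 by simp
  define \<psi> where "\<psi> = arcsin (m \<bullet> e2)"
  have \<psi>: "0 \<le> \<psi>" "\<psi> \<le> pi/2" "sin \<psi> = m \<bullet> e2"
    using m1(2) le1 arcsin_le_arcsin[of 0 "m \<bullet> e2"] arcsin_ubound[of "m \<bullet> e2"] by (auto simp: \<psi>_def)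
  have pos: "0 < p" using vp by simp
  have not1: "m \<bullet> e2 \<noteq> 1"
  proof
    assume 1: "m \<bullet> e2 = 1"
    have "cos \<rho> \<le> m \<bullet> m" using mm by simp
    from lune[OF m1(1) mD[OF m1(1) this]] show False using 1 pos by simp
  qed
  then have "\<psi> \<noteq> pi/2" using \<psi>(3) sin_pi_half by metis
  then have \<psi>2: "\<psi> < pi/2" using \<psi>(2) by linarith
  have c\<psi>: "0 < cos \<psi>" using \<psi> \<psi>2 by (intro cos_gt_zero_pi) auto
  have c2: "1 - (sin \<psi>)\<^sup>2 = cos \<psi> * cos \<psi>" by (simp add: cos_squared_eq power2_eq_square[symmetric])
  define t where "t = (e2 - sin \<psi> *\<^sub>R m) /\<^sub>R cos \<psi>"
  have te: "t \<bullet> e2 = cos \<psi>" and tm: "t \<bullet> m = 0" and tt: "t \<bullet> t = 1"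
  proof -
    have em: "e2 \<bullet> m = sin \<psi>" using \<psi>(3) by (simp add: inner_commute)
    have e: "(e2 - sin \<psi> *\<^sub>R m) \<bullet> e2 = cos \<psi> * cos \<psi>"
      using e22 \<psi>(3) c2 by (simp add: inner_simps power2_eq_square)
    show "t \<bullet> e2 = cos \<psi>" unfolding t_def inner_scaleR_left e using c\<psi> by simp
    have o: "(e2 - sin \<psi> *\<^sub>R m) \<bullet> m = 0" using em mm by (simp add: inner_simps)
    show tm: "t \<bullet> m = 0" unfolding t_def inner_scaleR_left o by simp
    have "cos \<psi> * (t \<bullet> t) = t \<bullet> (e2 - sin \<psi> *\<^sub>R m)" using c\<psi> by (simp add: t_def)
    also have "\<dots> = cos \<psi>" using \<open>t \<bullet> e2 = cos \<psi>\<close> tm by (simp add: inner_simps)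
    finally show "t \<bullet> t = 1" using c\<psi> by simp
  qed
  have arc: "(p + 1) * (sin (\<psi> + s))\<^sup>2 \<le> 1" if s: "0 \<le> s" "s \<le> \<rho>" for s
  proof -
    define x where "x = cos s *\<^sub>R m + sin s *\<^sub>R t"
    have "x \<bullet> x = (cos s)\<^sup>2 + (sin s)\<^sup>2"
      using mm tt tm by (simp add: x_def inner_simps inner_commute[of m t] power2_eq_square)
    then have nx: "norm x = 1" by (simp add: norm_eq_1)
    have "x \<bullet> m = cos s" using mm tm by (simp add: x_def inner_simps)
    moreover have "cos \<rho> \<le> cos s" using s \<rho> by (intro cos_monotone_0_pi_le) auto
    ultimately have "elliptic_class x \<in> D" using mD nx by simp
    moreover have "x \<bullet> e2 = sin (\<psi> + s)"
      using te \<psi>(3) by (simp add: x_def inner_simps sin_add)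
    ultimately show ?thesis using lune[OF nx] by simp
  qed
  \<comment> \<open>Otherwise the arc would pass through \<open>e2\<close>, which lies outside the conic.\<close>
  have \<psi>\<rho>: "\<psi> + \<rho> \<le> pi/2"
  proof (rule ccontr)
    assume "\<not> ?thesis"
    then have "(p + 1) * (sin (\<psi> + (pi/2 - \<psi>)))\<^sup>2 \<le> 1" using \<psi> by (intro arc) auto
    then show False using pos by simp
  qed
  have s\<rho>: "0 < sin \<rho>" using \<rho> by (intro sin_gt_zero) auto
  have "sin \<rho> \<le> sin (\<psi> + \<rho>)" using \<psi> \<psi>\<rho> \<rho> by (intro sin_monotone_2pi_le) auto
  then have "(sin \<rho>)\<^sup>2 \<le> (sin (\<psi> + \<rho>))\<^sup>2" using s\<rho> by (intro power_mono) auto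
  then have "(p + 1) * (sin \<rho>)\<^sup>2 \<le> (p + 1) * (sin (\<psi> + \<rho>))\<^sup>2" using pos by (intro mult_left_mono) auto
  also have "\<dots> \<le> 1" using \<rho> by (intro arc) auto
  finally have "p * (sin \<rho>)\<^sup>2 \<le> (cos \<rho>)\<^sup>2" by (simp add: cos_squared_eq algebra_simps)
  then have "p \<le> (cos \<rho>)\<^sup>2 / (sin \<rho>)\<^sup>2" using s\<rho> by (simp add: pos_le_divide_eq)
  then show ?thesis by (simp add: tan_def power_divide)
qed

text \<open>
  The integrand of \<open>semi_axes_area\<close> has the period \<open>\<pi>\<close>, so its integral is twice the integral over half a turn.
\<close>

lemma semi_axes_area_eq:
  assumes "0 < v" "0 < b"
  shows "semi_axes_area (1 / sqrt v) b = conic_area_fun v (1 / b\<^sup>2)"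
proof -
  let ?q = "quad2 v (1 / b\<^sup>2)"
  define G where "G \<phi> = sqrt (?q \<phi> / (1 + ?q \<phi>))" for \<phi>
  have pos: "0 < ?q \<phi>" for \<phi> using assms by (intro quad2_pos) auto
  have nz: "1 + ?q \<phi> \<noteq> 0" for \<phi> using pos[of \<phi>] by linarith
  have cG: "continuous_on S G" for S unfolding G_def using nz by (intro continuous_intros) auto
  have "((1 / sqrt v)\<^sup>2 * (sin \<phi>)\<^sup>2 + b\<^sup>2 * (cos \<phi>)\<^sup>2) /
      ((1 / sqrt v)\<^sup>2 * b\<^sup>2 + (1 / sqrt v)\<^sup>2 * (sin \<phi>)\<^sup>2 + b\<^sup>2 * (cos \<phi>)\<^sup>2) = ?q \<phi> / (1 + ?q \<phi>)" for \<phi>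
  proof -
    have "(1 / sqrt v)\<^sup>2 * (sin \<phi>)\<^sup>2 + b\<^sup>2 * (cos \<phi>)\<^sup>2 = b\<^sup>2 / v * ?q \<phi>"
      using assms by (simp add: quad2_def power_divide field_simps)
    moreover have "(1 / sqrt v)\<^sup>2 * b\<^sup>2 = b\<^sup>2 / v * 1" using assms by (simp add: power_divide)
    ultimately have "((1 / sqrt v)\<^sup>2 * (sin \<phi>)\<^sup>2 + b\<^sup>2 * (cos \<phi>)\<^sup>2) /
      ((1 / sqrt v)\<^sup>2 * b\<^sup>2 + (1 / sqrt v)\<^sup>2 * (sin \<phi>)\<^sup>2 + b\<^sup>2 * (cos \<phi>)\<^sup>2) = (b\<^sup>2 / v * ?q \<phi>) / (b\<^sup>2 / v * (1 + ?q \<phi>))"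
      by (simp only: add.assoc distrib_left)
    then show ?thesis using assms by simp
  qed
  then have A: "semi_axes_area (1 / sqrt v) b = 2 * pi - integral {-pi..pi} G"
    unfolding semi_axes_area_def G_def by simp
  have per: "G (x + pi) = G x" for x by (simp add: G_def quad2_def)
  have shift: "integral {x..y} G = integral {x + pi..y + pi} G" for x y
    using integral_shift_Icc_real[of x y G pi] per by (simp add: comp_def add.commute)
  have int: "G integrable_on {x..y}" for x y using integrable_continuous_real[OF cG] .
  have "integral {-pi..pi} G = integral {-pi..-pi/2} G + integral {-pi/2..pi/2} G + integral {pi/2..pi} G"
    using Henstock_Kurzweil_Integration.integral_combine[of "-pi" "-pi/2" "pi/2" G]
      Henstock_Kurzweil_Integration.integral_combine[of "-pi" "pi/2" pi G] int by simp
  moreover have "integral {-pi..-pi/2} G = integral {0..pi/2} G"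
    using shift[of "-pi" "-pi/2"] by (simp add: field_simps)
  moreover have "integral {pi/2..pi} G = integral {-pi/2..0} G"
    using shift[of "-pi/2" 0] by (simp add: field_simps)
  moreover have "integral {-pi/2..0} G + integral {0..pi/2} G = integral {-pi/2..pi/2} G"
    by (intro Henstock_Kurzweil_Integration.integral_combine int) auto
  ultimately have B: "integral {-pi..pi} G = 2 * integral {-pi/2..pi/2} G" by linarith
  have "conic_area_fun v (1 / b\<^sup>2) = integral {-pi/2..pi/2} (\<lambda>\<phi>. 2 - 2 * G \<phi>)"
    unfolding conic_area_fun_def arc_density_def G_def by (simp add: algebra_simps)
  also have "\<dots> = integral {-pi/2..pi/2} (\<lambda>\<phi>. 2) - integral {-pi/2..pi/2} (\<lambda>\<phi>. 2 * G \<phi>)"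
    by (intro integral_diff integrable_continuous_real continuous_intros cG)
  also have "\<dots> = 2 * pi - 2 * integral {-pi/2..pi/2} G" by simp
  finally show ?thesis unfolding A B by simp
qed

lemma conic_with_frame:
  assumes f: "orthonormal_frame e1 e2 e3"
  obtains M where "eigenframe M v p (-1) e1 e2 e3"
proof -
  define h where "h x = (v * (x \<bullet> e1)) *\<^sub>R e1 + (p * (x \<bullet> e2)) *\<^sub>R e2 - (x \<bullet> e3) *\<^sub>R e3" for x
  have lin: "linear h"
    by (rule linearI) (simp_all add: h_def inner_simps algebra_simps)
  have "matrix h *v x = h x" for x using lin by (simp add: matrix_works)
  then have "eigenframe (matrix h) v p (-1) e1 e2 e3"
    using f frame_inner[OF f] by (simp add: eigenframe_def h_def)
  then show thesis by (rule that)
qed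

lemma conic_matrix_eigenframe:
  assumes "conic_matrix M"
  obtains v p e1 e2 e3 where "0 < v" "v \<le> p" "eigenframe M v p (-1) e1 e2 e3"
proof -
  obtain v p where "v \<le> p" "0 < v" "eigenvalues3 M p v (-1)" "transpose M = M"
    using assms by (auto simp: conic_matrix_def)
  then show thesis using conic_eigenframe that by metis
qed

lemma continuous_on_conic_area_fun:
  assumes "0 < c"
  shows "continuous_on ({c..} \<times> {c..}) (\<lambda>(v, p). conic_area_fun v p)"
proof -
  have pos: "0 < quad2 v p \<phi>" if "c \<le> v" "c \<le> p" for v p \<phi>
    using that assms by (intro quad2_pos) auto
  have "continuous_on (({c..} \<times> {c..}) \<times> cbox (-pi/2) (pi/2)) (\<lambda>x. arc_density (quad2 (fst (fst x)) (snd (fst x)) (snd x)))"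
  proof (rule continuous_on_arc_density)
    show "continuous_on (({c..} \<times> {c..}) \<times> cbox (-pi/2) (pi/2)) (\<lambda>x. quad2 (fst (fst x)) (snd (fst x)) (snd x))"
      unfolding quad2_def by (intro continuous_intros)
  qed (use pos in auto)
  then have "continuous_on ({c..} \<times> {c..}) (\<lambda>x. integral (cbox (-pi/2) (pi/2)) (\<lambda>\<phi>. arc_density (quad2 (fst x) (snd x) \<phi>)))"
    by (intro integral_continuous_on_param) (simp add: split_beta)
  then show ?thesis by (simp add: conic_area_fun_def split_beta cbox_interval)
qed

text \<open>
  The frames and eigenvalues of the conics in question form a closed and bounded set, because enclosing \<open>F\<close> is a
  closed condition, and the area is a continuous function of the eigenvalues.
\<close>

lemma minimal_conic_in_compact_family:
  assumes c: "0 < c" and M0: "eigenframe M0 v0 p0 (-1) a1 a2 a3" "c \<le> v0" "v0 \<le> p0" "p0 \<le> d" "encloses M0 F"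
  obtains M v p e1 e2 e3 where "eigenframe M v p (-1) e1 e2 e3" "c \<le> v" "v \<le> p" "encloses M F"
    "\<forall>N v' p' f1 f2 f3. eigenframe N v' p' (-1) f1 f2 f3 \<longrightarrow> c \<le> v' \<longrightarrow> v' \<le> p' \<longrightarrow> p' \<le> d \<longrightarrow> encloses N F
       \<longrightarrow> conic_area M \<le> conic_area N"
proof -
  define X where "X = {x \<in> sphere 0 (1::real). elliptic_class x \<in> F}"
  define S :: "((real^3) \<times> (real^3) \<times> (real^3) \<times> real \<times> real) set"
    where "S = {(e1, e2, e3, v, p). orthonormal_frame e1 e2 e3 \<and> c \<le> v \<and> v \<le> p \<and> p \<le> d \<and>
      (\<forall>x\<in>X. v * (x \<bullet> e1)\<^sup>2 + p * (x \<bullet> e2)\<^sup>2 - (x \<bullet> e3)\<^sup>2 \<le> 0)}"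
  have enc: "encloses M F \<longleftrightarrow> (\<forall>x\<in>X. v * (x \<bullet> e1)\<^sup>2 + p * (x \<bullet> e2)\<^sup>2 - (x \<bullet> e3)\<^sup>2 \<le> 0)"
    if "eigenframe M v p (-1) e1 e2 e3" for M v p e1 e2 e3
    unfolding encloses_def X_def eigenframe_form[OF that] by (auto simp: power2_eq_square)
  have S_iff: "(e1, e2, e3, v, p) \<in> S \<longleftrightarrow> c \<le> v \<and> v \<le> p \<and> p \<le> d \<and> encloses M F"
    if "eigenframe M v p (-1) e1 e2 e3" for M v p e1 e2 e3
    using enc[OF that] that by (auto simp: S_def eigenframe_def)
  have "S = {y. fst y \<bullet> fst y = 1 \<and> fst (snd y) \<bullet> fst (snd y) = 1 \<and> fst (snd (snd y)) \<bullet> fst (snd (snd y)) = 1 \<and>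
      fst y \<bullet> fst (snd y) = 0 \<and> fst y \<bullet> fst (snd (snd y)) = 0 \<and> fst (snd y) \<bullet> fst (snd (snd y)) = 0 \<and>
      c \<le> fst (snd (snd (snd y))) \<and> fst (snd (snd (snd y))) \<le> snd (snd (snd (snd y))) \<and> snd (snd (snd (snd y))) \<le> d}
    \<inter> (\<Inter>x\<in>X. {y. fst (snd (snd (snd y))) * (x \<bullet> fst y)\<^sup>2 + snd (snd (snd (snd y))) * (x \<bullet> fst (snd y))\<^sup>2 - (x \<bullet> fst (snd (snd y)))\<^sup>2 \<le> 0})"
    by (auto simp: S_def orthonormal_frame_def split_beta)
  also have "closed \<dots>"
    by (intro closed_Int closed_INT ballI closed_Collect_conj closed_Collect_eq closed_Collect_le continuous_intros)
  finally have "closed S" .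
  moreover have sub: "S \<subseteq> sphere 0 1 \<times> sphere 0 1 \<times> sphere 0 1 \<times> {c..d} \<times> {c..d}"
    by (auto simp: S_def orthonormal_frame_def norm_eq_1)
  then have "bounded S"
    by (rule bounded_subset[rotated]) (intro bounded_Times; simp)
  ultimately have "compact S" by (simp add: compact_eq_bounded_closed)
  moreover have "S \<noteq> {}" using S_iff[OF M0(1)] M0 by auto
  moreover have "continuous_on S (\<lambda>y. conic_area_fun (fst (snd (snd (snd y)))) (snd (snd (snd (snd y)))))"
    using continuous_on_compose2[OF continuous_on_conic_area_fun[OF c], of S "\<lambda>y. snd (snd (snd y))"] sub
    by (force simp: split_beta intro!: continuous_intros)
  ultimately obtain y where y: "y \<in> S"
    "\<And>z. z \<in> S \<Longrightarrow> conic_area_fun (fst (snd (snd (snd y)))) (snd (snd (snd (snd y))))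
       \<le> conic_area_fun (fst (snd (snd (snd z)))) (snd (snd (snd (snd z))))"
    using continuous_attains_inf[of S] by blast
  obtain e1 e2 e3 v p where yeq: "y = (e1, e2, e3, v, p)" by (cases y)
  have "orthonormal_frame e1 e2 e3" using y(1) by (simp add: yeq S_def)
  then obtain M where M: "eigenframe M v p (-1) e1 e2 e3" using conic_with_frame by blast
  have vp: "c \<le> v" "v \<le> p" "encloses M F" using S_iff[OF M] y(1) by (simp_all add: yeq)
  show thesis
  proof (rule that[OF M vp], intro allI impI)
    fix N v' p' f1 f2 f3
    assume N: "eigenframe N v' p' (-1) f1 f2 f3" "c \<le> v'" "v' \<le> p'" "p' \<le> d" "encloses N F"
    then have "(f1, f2, f3, v', p') \<in> S" using S_iff[OF N(1)] by simp
    from y(2)[OF this] have "conic_area_fun v p \<le> conic_area_fun v' p'" by (simp add: yeq)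
    then show "conic_area M \<le> conic_area N"
      using conic_area_eigenframe[OF M] conic_area_eigenframe[OF N(1)] c vp N by simp
  qed
qed

theorem theorem8:
  fixes F :: "elliptic_point set" and \<rho> :: real
  assumes "compact F"
    and "0 < \<rho>" and "\<rho> < pi / 2"
    and "\<exists>D. elliptic_disc \<rho> D \<and> D \<subseteq> elliptic_convex_hull F"
    and "\<exists>M. conic_matrix M \<and> encloses M F \<and>
           conic_area M < semi_axes_area (tan critical_axis) (tan \<rho>)"
  shows "\<exists>!C. minimal_enclosing_conic F C"
proof -
  obtain D where D: "elliptic_disc \<rho> D" "D \<subseteq> elliptic_convex_hull F" using assms(4) by blast
  obtain M0 where M0: "conic_matrix M0" "encloses M0 F" "conic_area M0 < semi_axes_area (tan critical_axis) (tan \<rho>)"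
    using assms(5) by blast
  define d where "d = 1 / (tan \<rho>)\<^sup>2"
  have tan: "0 < tan \<rho>" using assms by (intro tan_gt_zero)
  have d0: "0 < d" using tan by (simp add: d_def)
  have v0: "1/2 < v\<^sub>0" by (rule critical_value)
  have bound: "semi_axes_area (tan critical_axis) (tan \<rho>) = conic_area_fun v\<^sub>0 d"
    using semi_axes_area_eq[of "v\<^sub>0" "tan \<rho>"] v0 tan by (simp add: critical_axis_def tan_arctan d_def)
  have minor: "p \<le> d" if "eigenframe M v p (-1) e1 e2 e3" "0 < v" "v \<le> p" "encloses M F" for M v p e1 e2 e3
  proof -
    have "elliptic_convex (closed_conic M)"
      by (rule elliptic_convex_closed_conic[OF that(1)]) (use that in auto)
    then have "elliptic_convex_hull F \<subseteq> closed_conic M"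
      using that(4) unfolding elliptic_convex_hull_def encloses_iff_subset by blast
    then show ?thesis
      unfolding d_def using minor_axis_bound[OF that(1-3) D(1) _ assms(2,3)] D(2) by blast
  qed
  have major: "v\<^sub>0 < v" if "eigenframe M v p (-1) e1 e2 e3" "0 < v" "v \<le> p" "encloses M F" "conic_area M < conic_area_fun v\<^sub>0 d"
    for M v p e1 e2 e3
  proof (rule ccontr)
    assume "\<not> v\<^sub>0 < v"
    then have "conic_area_fun v\<^sub>0 d \<le> conic_area_fun v p"
      using that minor[OF that(1-4)] by (intro conic_area_fun_antimono) auto
    then show False using that conic_area_eigenframe[OF that(1)] by simp
  qed
  obtain u0 p0 a1 a2 a3 where a: "0 < u0" "u0 \<le> p0" "eigenframe M0 u0 p0 (-1) a1 a2 a3"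
    using conic_matrix_eigenframe[OF M0(1)] .
  have u0: "v\<^sub>0 < u0" using major[OF a(3,1,2) M0(2)] M0(3) bound by simp
  have v00: "0 < v\<^sub>0" using v0 by simp
  obtain M v p e1 e2 e3 where M: "eigenframe M v p (-1) e1 e2 e3" "v\<^sub>0 \<le> v" "v \<le> p" "encloses M F"
    and M_min: "\<forall>N v' p' f1 f2 f3. eigenframe N v' p' (-1) f1 f2 f3 \<longrightarrow> v\<^sub>0 \<le> v' \<longrightarrow> v' \<le> p' \<longrightarrow> p' \<le> d \<longrightarrow> encloses N F
       \<longrightarrow> conic_area M \<le> conic_area N"
    using minimal_conic_in_compact_family[OF v00 a(3) less_imp_le[OF u0] a(2) minor[OF a(3,1,2) M0(2)] M0(2)] .
  have M_le: "conic_area M \<le> conic_area N" if N: "conic_matrix N" "encloses N F" for N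
  proof -
    obtain v' p' f1 f2 f3 where f: "0 < v'" "v' \<le> p'" "eigenframe N v' p' (-1) f1 f2 f3"
      using conic_matrix_eigenframe[OF N(1)] .
    show ?thesis
    proof (cases "conic_area N < conic_area_fun v\<^sub>0 d")
      case True
      then show ?thesis
        using M_min[rule_format, OF f(3) _ f(2) minor[OF f(3,1,2) N(2)] N(2)] major[OF f(3,1,2) N(2)] by simp
    next
      case False
      have "conic_area M \<le> conic_area M0"
        using M_min[rule_format, OF a(3) _ a(2) minor[OF a(3,1,2) M0(2)] M0(2)] u0 by simp
      then show ?thesis using False M0(3) bound by simp
    qed
  qed
  have M_small: "conic_area M < conic_area_fun v\<^sub>0 d"
    using M_le[OF M0(1,2)] M0(3) bound by simp
  have v: "0 < v" using M(2) v00 by simp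
  have cM: "conic_matrix M" using eigenframe_conic_matrix(2)[OF M(1) v M(3)] .
  show ?thesis
  proof (rule ex1I[of _ "conic_curve M"])
    show "minimal_enclosing_conic F (conic_curve M)"
      unfolding minimal_enclosing_conic_def using cM M(4) M_le by blast
  next
    fix C assume "minimal_enclosing_conic F C"
    then obtain N where N: "conic_matrix N" "C = conic_curve N" "encloses N F"
      and N_le: "\<And>K. conic_matrix K \<Longrightarrow> encloses K F \<Longrightarrow> conic_area N \<le> conic_area K"
      unfolding minimal_enclosing_conic_def by blast
    obtain v' p' f1 f2 f3 where f: "0 < v'" "v' \<le> p'" "eigenframe N v' p' (-1) f1 f2 f3"
      using conic_matrix_eigenframe[OF N(1)] .
    have "M = N"
    proof (rule ccontr)
      assume "M \<noteq> N"
      moreover have "1/2 < v" using M(2) v0 by simp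
      ultimately obtain K where "conic_matrix K" "encloses K F" "conic_area K < conic_area M"
        using smaller_conic_between[OF M(1) _ M(3) f(3,1,2) N_le[OF cM M(4)] _ M(4) N(3)] by blast
      then show False using M_le[of K] by simp
    qed
    then show "C = conic_curve M" using N(2) by simp
  qed
qed

end
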